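(* Let $q,r\ge 2$ be integers. The spectrum of the simple random walk operator $P$ on $\mathrm{DL}(q,r)$, acting on $\ell^2(\mathrm{DL})$, is the interval $[-\rho(P),\rho(P)]$, where $\rho(P)=2\sqrt{qr}/(q+r)$. It is a pure point spectrum, being the closure of the set of eigenvalues $$\Bigl\{\lambda_{m,n}=\rho(P)\cos\tfrac{m}{n}\pi \;:\; n\ge 2,\ 1\le m\le n-1\Bigr\}.$$ Furthermore, the set of all functions $$\mathfrak B=\Bigl\{ g_m^{[S,i,j]} : S \text{ a tetrahedron in } \mathrm{DL}(q,r) \text{ of height } n(S)\ge 2,\ m\in\{1,\dots,n(S)-1\},\ i\in\{1,\dots,q-1\},\ j\in\{1,\dots,r-1\}\Bigr\}$$ is a complete orthonormal system in $\ell^2(\mathrm{DL})$ consisting of finitely supported functions, and $$P g_m^{[S,i,j]}=\lambda_{m,n}\, g_m^{[S,i,j]},$$ where $n=n(S)$ is the height of $S$.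
   Context: Trees. For an integer $p\ge2$, $\mathbb T_p$ is the homogeneous tree of degree $p+1$ with a chosen root $o$ and a chosen reference end $\omega$ (an end is an equivalence class of geodesic rays, two rays being equivalent if their supports have finite symmetric difference). For a vertex $x$, $\overline{x\,\omega}$ is the unique geodesic ray from $x$ representing $\omega$; for vertices $v,z$ the confluent $b=v\curlywedge z$ is defined by $\overline{v\,\omega}\cap\overline{z\,\omega}=\overline{b\,\omega}$. Write $z\preccurlyeq v$ if $z\curlywedge v=z$ (i.e. $z$ lies on $\overline{v\,\omega}$). The Busemann function is $\mathfrak h(x)=d(x,x\curlywedge o)-d(o,x\curlywedge o)$. Each vertex $x$ has exactly one neighbour $x^-$ (predecessor) with $\mathfrak h(x^-)=\mathfrak h(x)-1$ and $p$ neighbours (successors) with $\mathfrak h$-value $\mathfrak h(x)+1$. The edges from each vertex to its $p$ successors are labelled bijectively by $\mathbb Z_p=\{0,\dots,p-1\}$, in such a way that along every ray $\overline{x\,\omega}$ only finitely many labels are non-zero. Diestel-Leader graph. Let $\mathbb T^1=\mathbb T_q$, $\mathbb T^2=\mathbb T_r$ with roots $o_1,o_2$ and ends $\omega_1,\omega_2$. $\mathrm{DL}=\mathrm{DL}(q,r)$ has vertex set $\{x_1x_2\in\mathbb T_q\times\mathbb T_r:\mathfrak h(x_1)+\mathfrak h(x_2)=0\}$, with $x_1x_2\sim y_1y_2$ iff $x_1\sim y_1$ and $x_2\sim y_2$. It is $(q+r)$-regular. The simple random walk operator is $Pf(x)=\frac1{q+r}\sum_{y\sim x}f(y)$, a self-adjoint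 operator on $\ell^2(\mathrm{DL})$ (counting measure). Tetrahedra. For $a_1\in\mathbb T^1$, $a_2\in\mathbb T^2$ with $-\mathfrak h(a_2)=\mathfrak h(a_1)+n$, $n\ge0$, the tetrahedron of height $n(S)=n$ is the induced subgraph $S=S(a_1,a_2)=\{x_1x_2\in\mathrm{DL}:a_1\preccurlyeq x_1,\ a_2\preccurlyeq x_2\}$. Let $v_{1,s}$ ($s\in\mathbb Z_q$) be the successor of $a_1$ reached by the edge labelled $s$, and $v_{2,t}$ ($t\in\mathbb Z_r$) the successor of $a_2$ reached by the edge labelled $t$. The functions $g_m^{[S,i,j]}$. For $i=1,\dots,q-1$ and $s\in\mathbb Z_q$, set $\varphi_i^1(s)=\frac{q-i}{\sqrt{(q-i)(q+1-i)}}$ if $s=i-1$, $\varphi_i^1(s)=-\frac{1}{\sqrt{(q-i)(q+1-i)}}$ if $s\in\{i,\dots,q-1\}$, and $\varphi_i^1(s)=0$ otherwise; $\varphi_j^2(t)$, $j=1,\dots,r-1$, $t\in\mathbb Z_r$, is defined by the same formula with $r,j,t$ in place of $q,i,s$. For a tetrahedron $S=S(a_1,a_2)$ of height $n\ge2$ and $k\ge1$, let $f_k^1(x_1)=\varphi_i^1(s)\,q^{(1-k)/2}$ if $v_{1,s}\preccurlyeq x_1$ and $\mathfrak h(x_1)=\mathfrak h(a_1)+k$, and $0$ otherwise; $f_k^2(x_2)=\varphi_j^2(t)\,r^{(1-k)/2}$ if $v_{2,t}\preccurlyeq x_2$ and $\mathfrak h(x_2)=\mathfrak h(a_2)+k$,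 and $0$ otherwise. For $k=1,\dots,n-1$ put $f_k^{[S,i,j]}(x_1x_2)=f_k^1(x_1)f_{n-k}^2(x_2)$ for $x_1x_2\in S$, extended by $0$ outside $S$. Finally, for $m=1,\dots,n-1$, $g_m^{[S,i,j]}=\sum_{k=1}^{n-1}\sqrt{\tfrac2n}\,\sin\bigl(\tfrac{km}{n}\pi\bigr)\,f_k^{[S,i,j]}$. *)

theory Defs
  imports "HOL-Analysis.Analysis"
begin

section \<open>Graphs given by an adjacency relation on a type of vertices\<close>

definition simple_graph :: "('a \<Rightarrow> 'a \<Rightarrow> bool) \<Rightarrow> bool" where
  "simple_graph E \<longleftrightarrow> (\<forall>x. \<not> E x x) \<and> (\<forall>x y. E x y \<longrightarrow> E y x)"

definition graph_cycle :: "('a \<Rightarrow> 'a \<Rightarrow> bool) \<Rightarrow> 'a list \<Rightarrow> bool" where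
  "graph_cycle E xs \<longleftrightarrow>
     length xs \<ge> 3 \<and> distinct xs \<and> successively E xs \<and> E (last xs) (hd xs)"

definition graph_tree :: "('a \<Rightarrow> 'a \<Rightarrow> bool) \<Rightarrow> bool" where
  "graph_tree E \<longleftrightarrow>
     simple_graph E \<and> (\<forall>x y. E\<^sup>*\<^sup>* x y) \<and> (\<nexists>xs. graph_cycle E xs)"

definition graph_dist :: "('a \<Rightarrow> 'a \<Rightarrow> bool) \<Rightarrow> 'a \<Rightarrow> 'a \<Rightarrow> nat" where
  "graph_dist E x y = (LEAST n. (E ^^ n) x y)"

definition geodesic_rays :: "('a \<Rightarrow> 'a \<Rightarrow> bool) \<Rightarrow> (nat \<Rightarrow> 'a) set" where
  "geodesic_rays E = {\<gamma>. \<forall>m n. m \<le> n \<longrightarrow> graph_dist E (\<gamma> m) (\<gamma> n) = n - m}"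

definition ray_equiv :: "('a \<Rightarrow> 'a \<Rightarrow> bool) \<Rightarrow> ((nat \<Rightarrow> 'a) \<times> (nat \<Rightarrow> 'a)) set" where
  "ray_equiv E = {(\<gamma>, \<delta>). \<gamma> \<in> geodesic_rays E \<and> \<delta> \<in> geodesic_rays E \<and>
     finite ((range \<gamma> - range \<delta>) \<union> (range \<delta> - range \<gamma>))}"

definition graph_ends :: "('a \<Rightarrow> 'a \<Rightarrow> bool) \<Rightarrow> (nat \<Rightarrow> 'a) set set" where
  "graph_ends E = geodesic_rays E // ray_equiv E"


section \<open>Homogeneous trees with root, reference end and edge labels\<close>

text \<open>The vertices of the tree are all elements of the type \<open>'a\<close>.  The value
  \<open>elabel T x y\<close> is meaningful only when \<open>y\<close> is a successor of \<open>x\<close>;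
  the label set \<open>{0, \<dots>, p - 1}\<close> is used purely as a set of names.\<close>

record 'a labelled_tree =
  tadj :: "'a \<Rightarrow> 'a \<Rightarrow> bool"
  troot :: 'a
  tend :: "(nat \<Rightarrow> 'a) set"
  elabel :: "'a \<Rightarrow> 'a \<Rightarrow> nat"

abbreviation tdist :: "'a labelled_tree \<Rightarrow> 'a \<Rightarrow> 'a \<Rightarrow> nat" where
  "tdist T \<equiv> graph_dist (tadj T)"

definition ray_from :: "'a labelled_tree \<Rightarrow> 'a \<Rightarrow> nat \<Rightarrow> 'a" where
  "ray_from T x = (THE \<gamma>. \<gamma> \<in> tend T \<and> \<gamma> 0 = x)"

definition confluent :: "'a labelled_tree \<Rightarrow> 'a \<Rightarrow> 'a \<Rightarrow> 'a" where
  "confluent T v z =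
     (THE b. range (ray_from T v) \<inter> range (ray_from T z) = range (ray_from T b))"

definition tree_le :: "'a labelled_tree \<Rightarrow> 'a \<Rightarrow> 'a \<Rightarrow> bool" where
  "tree_le T z v \<longleftrightarrow> confluent T z v = z"

definition busemann :: "'a labelled_tree \<Rightarrow> 'a \<Rightarrow> int" where
  "busemann T x = int (tdist T x (confluent T x (troot T)))
                - int (tdist T (troot T) (confluent T x (troot T)))"

definition successors :: "'a labelled_tree \<Rightarrow> 'a \<Rightarrow> 'a set" where
  "successors T x = {y. tadj T x y \<and> busemann T y = busemann T x + 1}"

text \<open>Along a ray towards the reference end one moves from each vertex to its predecessor,
  so the edge between the \<open>n\<close>-th and the next vertex carries the label
  \<open>elabel T (\<gamma> (Suc n)) (\<gamma> n)\<close>.\<close>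

definition homogeneous_tree :: "nat \<Rightarrow> 'a labelled_tree \<Rightarrow> bool" where
  "homogeneous_tree p T \<longleftrightarrow>
     graph_tree (tadj T) \<and>
     (\<forall>x. card {y. tadj T x y} = p + 1) \<and>
     tend T \<in> graph_ends (tadj T) \<and>
     (\<forall>x. bij_betw (elabel T x) (successors T x) {0..<p}) \<and>
     (\<forall>x. finite {n. elabel T (ray_from T x (Suc n)) (ray_from T x n) \<noteq> 0})"

definition labelled_succ :: "'a labelled_tree \<Rightarrow> 'a \<Rightarrow> nat \<Rightarrow> 'a" where
  "labelled_succ T a s = (THE y. y \<in> successors T a \<and> elabel T a y = s)"


section \<open>Operators on square-summable functions\<close>

text \<open>A complex function on a set \<open>V\<close> is represented by a function on the whole type
  that vanishes outside \<open>V\<close>; operators are maps between such functions.\<close>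

definition ell2 :: "'v set \<Rightarrow> ('v \<Rightarrow> complex) set" where
  "ell2 V = {f. (\<forall>x. x \<notin> V \<longrightarrow> f x = 0) \<and> (\<lambda>x. (cmod (f x))\<^sup>2) summable_on V}"

definition ell2_inner :: "'v set \<Rightarrow> ('v \<Rightarrow> complex) \<Rightarrow> ('v \<Rightarrow> complex) \<Rightarrow> complex" where
  "ell2_inner V f g = (\<Sum>\<^sub>\<infinity>x\<in>V. f x * cnj (g x))"

definition ell2_norm :: "'v set \<Rightarrow> ('v \<Rightarrow> complex) \<Rightarrow> real" where
  "ell2_norm V f = sqrt (\<Sum>\<^sub>\<infinity>x\<in>V. (cmod (f x))\<^sup>2)"

definition bounded_operator ::
  "'v set \<Rightarrow> (('v \<Rightarrow> complex) \<Rightarrow> ('v \<Rightarrow> complex)) \<Rightarrow> bool" where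
  "bounded_operator V A \<longleftrightarrow>
     (\<forall>f\<in>ell2 V. A f \<in> ell2 V) \<and>
     (\<forall>f\<in>ell2 V. \<forall>g\<in>ell2 V. A (\<lambda>x. f x + g x) = (\<lambda>x. A f x + A g x)) \<and>
     (\<forall>c. \<forall>f\<in>ell2 V. A (\<lambda>x. c * f x) = (\<lambda>x. c * A f x)) \<and>
     (\<exists>C. \<forall>f\<in>ell2 V. ell2_norm V (A f) \<le> C * ell2_norm V f)"

text \<open>The complement of the set of those \<open>z\<close> for which \<open>A - z\<close> has
  a bounded two-sided inverse.\<close>

definition op_spectrum ::
  "'v set \<Rightarrow> (('v \<Rightarrow> complex) \<Rightarrow> ('v \<Rightarrow> complex)) \<Rightarrow> complex set" where
  "op_spectrum V A = {z. \<not> (\<exists>R. bounded_operator V R \<and>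
     (\<forall>f\<in>ell2 V. R (\<lambda>x. A f x - z * f x) = f \<and> (\<lambda>x. A (R f) x - z * R f x) = f))}"

definition op_eigenvalues ::
  "'v set \<Rightarrow> (('v \<Rightarrow> complex) \<Rightarrow> ('v \<Rightarrow> complex)) \<Rightarrow> complex set" where
  "op_eigenvalues V A = {z. \<exists>f\<in>ell2 V. f \<noteq> (\<lambda>x. 0) \<and> A f = (\<lambda>x. z * f x)}"

definition orthonormal_system :: "'v set \<Rightarrow> ('v \<Rightarrow> complex) set \<Rightarrow> bool" where
  "orthonormal_system V B \<longleftrightarrow> B \<subseteq> ell2 V \<and>
     (\<forall>f\<in>B. \<forall>g\<in>B. ell2_inner V f g = (if f = g then 1 else 0))"

definition complete_orthonormal_system :: "'v set \<Rightarrow> ('v \<Rightarrow> complex) set \<Rightarrow> bool" where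
  "complete_orthonormal_system V B \<longleftrightarrow> orthonormal_system V B \<and>
     (\<forall>f\<in>ell2 V. \<forall>\<epsilon>>0. \<exists>F c. finite F \<and> F \<subseteq> B \<and>
        ell2_norm V (\<lambda>x. f x - (\<Sum>b\<in>F. c b * b x)) < \<epsilon>)"

text \<open>Used for self-adjoint operators, where this says that all spectral measures are
  purely atomic.\<close>

definition pure_point_spectrum ::
  "'v set \<Rightarrow> (('v \<Rightarrow> complex) \<Rightarrow> ('v \<Rightarrow> complex)) \<Rightarrow> bool" where
  "pure_point_spectrum V A \<longleftrightarrow>
     (\<exists>B. complete_orthonormal_system V B \<and> (\<forall>b\<in>B. \<exists>z. A b = (\<lambda>x. z * b x)))"


section \<open>The Diestel-Leader graph and its simple random walk\<close>

definition DL :: "'a labelled_tree \<Rightarrow> 'b labelled_tree \<Rightarrow> ('a \<times> 'b) set" where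
  "DL T1 T2 = {(x1, x2). busemann T1 x1 + busemann T2 x2 = 0}"

definition DL_adj ::
  "'a labelled_tree \<Rightarrow> 'b labelled_tree \<Rightarrow> 'a \<times> 'b \<Rightarrow> 'a \<times> 'b \<Rightarrow> bool" where
  "DL_adj T1 T2 x y \<longleftrightarrow> x \<in> DL T1 T2 \<and> y \<in> DL T1 T2 \<and>
     tadj T1 (fst x) (fst y) \<and> tadj T2 (snd x) (snd y)"

definition srw_op :: "nat \<Rightarrow> nat \<Rightarrow> 'a labelled_tree \<Rightarrow> 'b labelled_tree
    \<Rightarrow> ('a \<times> 'b \<Rightarrow> complex) \<Rightarrow> ('a \<times> 'b \<Rightarrow> complex)" where
  "srw_op q r T1 T2 f x = 1 / of_nat (q + r) * (\<Sum>y | DL_adj T1 T2 x y. f y)"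

definition rho :: "nat \<Rightarrow> nat \<Rightarrow> real" where
  "rho q r = 2 * sqrt (real (q * r)) / real (q + r)"

definition dl_eigenvalue :: "nat \<Rightarrow> nat \<Rightarrow> nat \<Rightarrow> nat \<Rightarrow> real" where
  "dl_eigenvalue q r m n = rho q r * cos (real m / real n * pi)"


section \<open>Tetrahedra and the functions supported on them\<close>

text \<open>A tetrahedron is given by its pair of apexes \<open>a1\<close>, \<open>a2\<close>.\<close>

definition tetra_height ::
  "'a labelled_tree \<Rightarrow> 'b labelled_tree \<Rightarrow> 'a \<Rightarrow> 'b \<Rightarrow> nat \<Rightarrow> bool" where
  "tetra_height T1 T2 a1 a2 n \<longleftrightarrow> - busemann T2 a2 = busemann T1 a1 + int n"

definition tetrahedron ::
  "'a labelled_tree \<Rightarrow> 'b labelled_tree \<Rightarrow> 'a \<Rightarrow> 'b \<Rightarrow> ('a \<times> 'b) set" where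
  "tetrahedron T1 T2 a1 a2 =
     {(x1, x2) \<in> DL T1 T2. tree_le T1 a1 x1 \<and> tree_le T2 a2 x2}"

definition label_fn :: "nat \<Rightarrow> nat \<Rightarrow> nat \<Rightarrow> real" where
  "label_fn p i s =
     (if Suc s = i then (real p - real i) / sqrt ((real p - real i) * (real p + 1 - real i))
      else if i \<le> s \<and> s < p then - 1 / sqrt ((real p - real i) * (real p + 1 - real i))
      else 0)"

text \<open>For \<open>k \<ge> 1\<close> the label \<open>s\<close> of the branch at \<open>a\<close> containing \<open>x\<close>
  is unique if it exists.\<close>

definition level_fn :: "nat \<Rightarrow> 'a labelled_tree \<Rightarrow> 'a \<Rightarrow> nat \<Rightarrow> nat \<Rightarrow> 'a \<Rightarrow> real" where
  "level_fn p T a i k x =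
     (if busemann T x = busemann T a + int k \<and> (\<exists>s<p. tree_le T (labelled_succ T a s) x)
      then label_fn p i (THE s. s < p \<and> tree_le T (labelled_succ T a s) x)
             * real p powr ((1 - real k) / 2)
      else 0)"

definition tetra_level_fn :: "nat \<Rightarrow> nat \<Rightarrow> 'a labelled_tree \<Rightarrow> 'b labelled_tree
    \<Rightarrow> 'a \<Rightarrow> 'b \<Rightarrow> nat \<Rightarrow> nat \<Rightarrow> nat \<Rightarrow> nat \<Rightarrow> 'a \<times> 'b \<Rightarrow> real" where
  "tetra_level_fn q r T1 T2 a1 a2 n i j k x =
     (if x \<in> tetrahedron T1 T2 a1 a2
      then level_fn q T1 a1 i k (fst x) * level_fn r T2 a2 j (n - k) (snd x)
      else 0)"

text \<open>Here \<open>n\<close> is always the height of the tetrahedron with apexes \<open>a1\<close>, \<open>a2\<close>.\<close>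

definition tetra_fn :: "nat \<Rightarrow> nat \<Rightarrow> 'a labelled_tree \<Rightarrow> 'b labelled_tree
    \<Rightarrow> 'a \<Rightarrow> 'b \<Rightarrow> nat \<Rightarrow> nat \<Rightarrow> nat \<Rightarrow> nat \<Rightarrow> 'a \<times> 'b \<Rightarrow> complex" where
  "tetra_fn q r T1 T2 a1 a2 n i j m x = complex_of_real
     (\<Sum>k=1..n-1. sqrt (2 / real n) * sin (real (k * m) / real n * pi)
                    * tetra_level_fn q r T1 T2 a1 a2 n i j k x)"

definition tetra_basis :: "nat \<Rightarrow> nat \<Rightarrow> 'a labelled_tree \<Rightarrow> 'b labelled_tree
    \<Rightarrow> ('a \<times> 'b \<Rightarrow> complex) set" where
  "tetra_basis q r T1 T2 = {tetra_fn q r T1 T2 a1 a2 n i j m | a1 a2 n i j m.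
     n \<ge> 2 \<and> tetra_height T1 T2 a1 a2 n \<and>
     m \<in> {1..n-1} \<and> i \<in> {1..q-1} \<and> j \<in> {1..r-1}}"

end

theory Submission
  imports Defs
begin

text \<open>
  Every vertex of a homogeneous tree with a reference end has exactly one neighbour closer to the
  end, its parent, and the other \<open>p\<close> neighbours are its children.  In these terms a neighbour of
  \<open>(x1, x2)\<close> in the Diestel-Leader graph arises by moving to the parent in one coordinate and to a
  child in the other.

  \<^bold>\<open>Eigenfunctions.\<close> Let \<open>f k\<close> be the function on generation \<open>k\<close> below a vertex \<open>a\<close> that depends
  only on the child of \<open>a\<close> whose branch is visited, through a fixed function of mean zero on the
  labels, scaled by \<open>p powr ((1 - k) / 2)\<close>.  Precomposition with the parent map turns \<open>f k\<close> into
  \<open>sqrt p * f (k + 1)\<close>, and summation over children turns it into \<open>sqrt p * f (k - 1)\<close>, where the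
  mean zero condition makes the result vanish for \<open>k = 1\<close>.  For a tetrahedron of height \<open>n\<close> and the
  products \<open>f1 k * f2 (n - k)\<close> with \<open>0 < k < n\<close>, the walk therefore acts as \<open>sqrt (q * r) / (q + r)\<close>
  times the adjacency matrix of a path on \<open>n - 1\<close> vertices.  The discrete sine transform
  diagonalises that matrix (\<open>sine_coeff_sum_by_parts\<close>, \<open>tetra_fn_eigen\<close>).

  \<^bold>\<open>Orthonormality.\<close> In one tree all the functions \<open>f k\<close> together, for every apex \<open>a\<close>, form an
  orthonormal system: for different apexes or generations, either the supports are disjoint or one
  function is constant on the support of the other, and the other sums to zero
  (\<open>tree_haar_orthonormal\<close>).  Products inherit orthonormality, and the sine transform is orthogonal.

  \<^bold>\<open>Completeness.\<close> The difference between averaging over a cell of generation \<open>k\<close> and over one of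
  generation \<open>k + 1\<close> is a finite combination of the \<open>f k\<close>.  Since there are infinitely many
  ancestors, iterating writes the indicator of a vertex as a finite combination of these functions
  plus the density of a cell with \<open>p ^ K\<close> elements, whose norm \<open>p powr (- K / 2)\<close> tends to zero
  (\<open>cell_telescope\<close>).  Multiplying two such expansions approximates the point masses of the
  Diestel-Leader graph (\<open>delta_approximation\<close>).

  \<^bold>\<open>Spectrum.\<close> The rest uses only that an orthonormal basis of finitely supported eigenvectors
  exists and that the operator is symmetric and has finite range.  Symmetry excludes further
  eigenvalues (\<open>eigenvalues\<close>).  Approximate eigenvectors put the closure of the
  set of eigenvalues into the spectrum.  Conversely, a point \<open>z\<close> off the segment
  \<open>{- rho q r..rho q r}\<close> can be separated from it by a disc with some centre \<open>w\<close>; then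
  \<open>(P - w) / (z - w)\<close> is a strict contraction and the Neumann series gives the resolvent at \<open>z\<close>.
  Finally, the numbers \<open>cos (m / n * pi)\<close> are dense in \<open>{-1..1}\<close>.
\<close>

section \<open>Trees seen from an end: the parent map\<close>

text \<open>Walks without immediate reversal.  Only the values of \<open>w\<close> up to \<open>n\<close> matter, so that initial
  segments of an infinite ray are covered without changing the function.\<close>

definition nb_walk :: "('a \<Rightarrow> 'a \<Rightarrow> bool) \<Rightarrow> (nat \<Rightarrow> 'a) \<Rightarrow> nat \<Rightarrow> bool" where
  "nb_walk E w n \<longleftrightarrow> (\<forall>i<n. E (w i) (w (Suc i))) \<and> (\<forall>i. Suc (Suc i) \<le> n \<longrightarrow> w i \<noteq> w (Suc (Suc i)))"

text \<open>A repetition at minimal distance would close a cycle: the distance is not \<open>1\<close> because there are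
  no loops and not \<open>2\<close> because the walk never reverses.\<close>

lemma nb_walk_distinct:
  assumes "graph_tree E" "nb_walk E w n" "i < j" "j \<le> n"
  shows "w i \<noteq> w j"
  using assms(3,4)
proof (induction "j - i" arbitrary: i j rule: less_induct)
  case less
  show ?case
  proof
    assume eq: "w i = w j"
    have adj: "\<And>k. k < n \<Longrightarrow> E (w k) (w (Suc k))" and nb: "\<And>k. Suc (Suc k) \<le> n \<Longrightarrow> w k \<noteq> w (Suc (Suc k))"
      using assms(2) by (auto simp: nb_walk_def)
    have irr: "\<not> E x x" for x using assms(1) by (auto simp: graph_tree_def simple_graph_def)
    have "j \<noteq> Suc i" using adj[of i] irr eq less.prems by auto
    moreover have "j \<noteq> Suc (Suc i)" using nb[of i] eq less.prems by auto
    ultimately have l3: "j \<ge> i + 3" using less.prems by linarith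
    let ?xs = "map w [i..<j]"
    have "w a \<noteq> w b" if "i \<le> a" "a < b" "b < j" for a b
      using less.hyps[of b a] that less.prems by auto
    hence "inj_on w {i..<j}" by (intro linorder_inj_onI) auto
    hence "distinct ?xs" by (simp add: distinct_map)
    moreover have "successively E ?xs"
      unfolding successively_conv_nth using adj less.prems by auto
    moreover have "E (last ?xs) (hd ?xs)"
    proof -
      have "last ?xs = w (j - 1)" "hd ?xs = w i" using l3 by (auto simp: last_map hd_map)
      thus ?thesis using adj[of "j - 1"] less.prems eq by auto
    qed
    ultimately have "graph_cycle E ?xs" using l3 by (auto simp: graph_cycle_def)
    thus False using assms(1) by (auto simp: graph_tree_def)
  qed
qed

lemma nb_walk_tail: "nb_walk E w (Suc n) \<Longrightarrow> nb_walk E (\<lambda>i. w (Suc i)) n"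
  by (auto simp: nb_walk_def)

text \<open>If two such walks with common end points leave the start in different directions, running
  backwards along one and forwards along the other never reverses at the joint and returns to where
  it began, against distinctness.\<close>

lemma nb_walk_unique:
  assumes "graph_tree E" "nb_walk E u m" "nb_walk E w n" "u 0 = w 0" "u m = w n"
  shows "m = n \<and> (\<forall>i\<le>n. u i = w i)"
  using assms(2-)
proof (induction m arbitrary: u w n)
  case 0
  then show ?case using nb_walk_distinct[OF assms(1), of w n 0 n] by (cases n) auto
next
  case (Suc m)
  show ?case
  proof (cases n)
    case 0
    then show ?thesis using nb_walk_distinct[OF assms(1) Suc.prems(1), of 0 "Suc m"] Suc.prems by auto
  next
    case (Suc n')
    show ?thesis
    proof (cases "u 1 = w 1")
      case True
      have "m = n' \<and> (\<forall>i\<le>n'. u (Suc i) = w (Suc i))"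
        using Suc.IH[of "\<lambda>i. u (Suc i)" "\<lambda>i. w (Suc i)" n'] Suc.prems True Suc nb_walk_tail by auto
      moreover have "u i = w i" if "i \<le> n" for i
        using calculation that Suc Suc.prems(3) by (cases i) auto
      ultimately show ?thesis using Suc by auto
    next
      case False
      define v where "v = (\<lambda>i. if i \<le> Suc m then u (Suc m - i) else w (i - Suc m))"
      have sym: "E x y \<Longrightarrow> E y x" for x y using assms(1) by (auto simp: graph_tree_def simple_graph_def)
      have adju: "\<And>k. k \<le> m \<Longrightarrow> E (u k) (u (Suc k))" and nbu: "\<And>k. Suc k \<le> m \<Longrightarrow> u k \<noteq> u (Suc (Suc k))"
        using Suc.prems(1) by (auto simp: nb_walk_def)
      have adjw: "\<And>k. k < n \<Longrightarrow> E (w k) (w (Suc k))" and nbw: "\<And>k. Suc (Suc k) \<le> n \<Longrightarrow> w k \<noteq> w (Suc (Suc k))"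
        using Suc.prems(2) by (auto simp: nb_walk_def)
      have "nb_walk E v (Suc m + n)"
        unfolding nb_walk_def
      proof (intro conjI allI impI)
        fix i assume i: "i < Suc m + n"
        consider "i \<le> m" | "i = Suc m" | "i > Suc m" by linarith
        then show "E (v i) (v (Suc i))"
        proof cases
          case 1
          hence "Suc m - i = Suc (m - i)" by auto
          then show ?thesis using 1 sym adju[of "m - i"] by (auto simp: v_def)
        next
          case 2
          then show ?thesis using adjw[of 0] Suc.prems(3) i by (auto simp: v_def)
        next
          case 3
          hence "i - m = Suc (i - Suc m)" by auto
          then show ?thesis using 3 adjw[of "i - Suc m"] i by (auto simp: v_def)
        qed
      next
        fix i assume i: "Suc (Suc i) \<le> Suc m + n"
        consider "Suc i \<le> m" | "i = m" | "i = Suc m" | "i > Suc m" by linarith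
        then show "v i \<noteq> v (Suc (Suc i))"
        proof cases
          case 1
          hence *: "Suc m - i = Suc (Suc (m - Suc i))" "Suc (m - Suc i) \<le> m" by linarith+
          from nbu[OF *(2)] show ?thesis using 1 * by (simp add: v_def)
        next
          case 2
          then show ?thesis using False by (auto simp: v_def)
        next
          case 3
          then show ?thesis using nbw[of 0] Suc.prems(3) i by (auto simp: v_def numeral_2_eq_2)
        next
          case 4
          hence "Suc i - m = Suc (Suc (i - Suc m))" by auto
          then show ?thesis using 4 nbw[of "i - Suc m"] i by (auto simp: v_def)
        qed
      qed
      from nb_walk_distinct[OF assms(1) this, of 0 "Suc m + n"] Suc.prems(4) Suc
      show ?thesis by (auto simp: v_def)
    qed
  qed
qed

lemma graph_dist_walk:
  assumes "graph_tree E"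
  shows "(E ^^ graph_dist E x y) x y"
proof -
  have "\<exists>n. (E ^^ n) x y" using assms rtranclp_power[of E x y] by (auto simp: graph_tree_def)
  thus ?thesis unfolding graph_dist_def by (rule LeastI_ex)
qed

lemma graph_dist_le: "(E ^^ n) x y \<Longrightarrow> graph_dist E x y \<le> n"
  unfolding graph_dist_def by (rule Least_le)

text \<open>A shortest walk does not reverse, and such walks are unique, so it has the same length.\<close>

lemma graph_dist_nb_walk:
  assumes "graph_tree E" "nb_walk E w n"
  shows "graph_dist E (w 0) (w n) = n"
proof -
  define m where "m = graph_dist E (w 0) (w n)"
  obtain f where f: "f 0 = w 0" "f m = w n" "\<And>i. i < m \<Longrightarrow> E (f i) (f (Suc i))"
    using graph_dist_walk[OF assms(1), of "w 0" "w n"] unfolding m_def[symmetric] relpowp_fun_conv by auto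
  have "nb_walk E f m"
    unfolding nb_walk_def
  proof (intro conjI allI impI)
    fix i assume i: "Suc (Suc i) \<le> m"
    show "f i \<noteq> f (Suc (Suc i))"
    proof
      assume eq: "f i = f (Suc (Suc i))"
      \<comment> \<open>Cutting out the detour would give a shorter walk.\<close>
      define g where "g = (\<lambda>j. if j \<le> i then f j else f (j + 2))"
      have "g 0 = w 0" using f by (auto simp: g_def)
      moreover have "g (m - 2) = w n"
        using f i eq by (cases "m - 2 = i") (auto simp: g_def Suc_diff_Suc numeral_2_eq_2)
      moreover have "E (g j) (g (Suc j))" if "j < m - 2" for j
      proof -
        consider "j < i" | "j = i" | "j > i" by linarith
        thus ?thesis
          by cases (use f(3)[of j] f(3)[of "j + 2"] eq that i in \<open>auto simp: g_def\<close>)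
      qed
      ultimately have "(E ^^ (m - 2)) (w 0) (w n)" unfolding relpowp_fun_conv by blast
      hence "m \<le> m - 2" using graph_dist_le m_def by metis
      thus False using i by auto
    qed
  qed (use f in auto)
  from nb_walk_unique[OF assms(1) this assms(2)] f show ?thesis by (auto simp: m_def)
qed

text \<open>A local description of geodesic rays, which makes it easy to prolong one at its start.\<close>

lemma geodesic_rays_eq_nb:
  assumes "graph_tree E"
  shows "\<gamma> \<in> geodesic_rays E \<longleftrightarrow> (\<forall>n. nb_walk E \<gamma> n)"
proof
  assume g: "\<gamma> \<in> geodesic_rays E"
  hence d: "graph_dist E (\<gamma> m) (\<gamma> n) = n - m" if "m \<le> n" for m n
    using that by (auto simp: geodesic_rays_def)
  have "E (\<gamma> i) (\<gamma> (Suc i))" for i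
    using graph_dist_walk[OF assms, of "\<gamma> i" "\<gamma> (Suc i)"] d[of i "Suc i"] by (simp add: eq_OO)
  moreover have "\<gamma> i \<noteq> \<gamma> (Suc (Suc i))" for i
    using d[of i "Suc (Suc i)"] d[of i i] by auto
  ultimately show "\<forall>n. nb_walk E \<gamma> n" by (auto simp: nb_walk_def)
next
  assume nb: "\<forall>n. nb_walk E \<gamma> n"
  show "\<gamma> \<in> geodesic_rays E" unfolding geodesic_rays_def
  proof (intro CollectI allI impI)
    fix m n :: nat assume "m \<le> n"
    have "nb_walk E (\<lambda>i. \<gamma> (m + i)) (n - m)" using nb[rule_format, of n] by (auto simp: nb_walk_def)
    from graph_dist_nb_walk[OF assms this] \<open>m \<le> n\<close>
    show "graph_dist E (\<gamma> m) (\<gamma> n) = n - m" by simp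
  qed
qed

lemma ray_inj:
  assumes "graph_tree E" "\<gamma> \<in> geodesic_rays E"
  shows "inj \<gamma>"
  using nb_walk_distinct[OF assms(1)] assms geodesic_rays_eq_nb[OF assms(1)]
  by (metis linorder_injI order_refl)

lemma ray_equiv_equiv: "equiv (geodesic_rays E) (ray_equiv E)"
proof (rule equivI)
  show "trans (ray_equiv E)"
  proof (rule transI)
    fix a b c assume *: "(a, b) \<in> ray_equiv E" "(b, c) \<in> ray_equiv E"
    hence "finite ((range a - range b) \<union> (range b - range a) \<union> ((range b - range c) \<union> (range c - range b)))"
      unfolding ray_equiv_def by blast
    hence "finite ((range a - range c) \<union> (range c - range a))" by (rule finite_subset[rotated]) blast
    thus "(a, c) \<in> ray_equiv E" using * by (auto simp: ray_equiv_def)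
  qed
qed (auto simp: ray_equiv_def refl_on_def sym_def)


locale end_tree =
  fixes T :: "'a labelled_tree" and p :: nat
  assumes hom: "homogeneous_tree p T" and p2: "p \<ge> 2"
begin

abbreviation "adj \<equiv> tadj T"
abbreviation "\<omega> \<equiv> tend T"
abbreviation "h \<equiv> busemann T"

lemma tree: "graph_tree adj" using hom by (auto simp: homogeneous_tree_def)

lemma adj_sym: "adj x y \<Longrightarrow> adj y x" using tree by (auto simp: graph_tree_def simple_graph_def)

lemma end_class:
  obtains \<gamma>0 where "\<gamma>0 \<in> geodesic_rays adj" "\<omega> = ray_equiv adj `` {\<gamma>0}"
  using hom by (auto simp: homogeneous_tree_def graph_ends_def elim!: quotientE)

lemma end_ray: "\<gamma> \<in> \<omega> \<Longrightarrow> \<gamma> \<in> geodesic_rays adj"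
  by (rule end_class) (auto simp: ray_equiv_def)

lemma end_equiv: "\<gamma> \<in> \<omega> \<Longrightarrow> \<delta> \<in> \<omega> \<Longrightarrow> (\<gamma>, \<delta>) \<in> ray_equiv adj"
  using ray_equiv_equiv[of adj] by (rule_tac end_class) (metis Image_singleton_iff equiv_def symE transE)

lemma end_closed: "\<gamma> \<in> \<omega> \<Longrightarrow> (\<gamma>, \<delta>) \<in> ray_equiv adj \<Longrightarrow> \<delta> \<in> \<omega>"
  using ray_equiv_equiv[of adj] by (rule_tac end_class) (metis Image_singleton_iff equiv_def transE)

lemma end_tail: assumes "\<gamma> \<in> \<omega>" shows "(\<lambda>i. \<gamma> (Suc i)) \<in> \<omega>"
proof (rule end_closed[OF assms])
  have g: "\<gamma> \<in> geodesic_rays adj" by (rule end_ray[OF assms])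
  hence "(\<lambda>i. \<gamma> (Suc i)) \<in> geodesic_rays adj" by (auto simp: geodesic_rays_def)
  moreover have "range \<gamma> - range (\<lambda>i. \<gamma> (Suc i)) \<subseteq> {\<gamma> 0}"
  proof
    fix y assume y: "y \<in> range \<gamma> - range (\<lambda>i. \<gamma> (Suc i))"
    then obtain i where "y = \<gamma> i" by auto
    with y show "y \<in> {\<gamma> 0}" by (cases i) auto
  qed
  moreover have "range (\<lambda>i. \<gamma> (Suc i)) - range \<gamma> = {}" by auto
  ultimately have "finite ((range \<gamma> - range (\<lambda>i. \<gamma> (Suc i))) \<union> (range (\<lambda>i. \<gamma> (Suc i)) - range \<gamma>))"
    by (metis Un_empty_right finite.emptyI finite.insertI finite_subset)
  thus "(\<gamma>, \<lambda>i. \<gamma> (Suc i)) \<in> ray_equiv adj"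
    using g \<open>(\<lambda>i. \<gamma> (Suc i)) \<in> geodesic_rays adj\<close> unfolding ray_equiv_def by blast
qed

text \<open>Together with passing to tails, this moves the starting point of a ray across any edge without
  leaving the end; connectedness then yields a ray from every vertex.\<close>

lemma end_cons:
  assumes "\<gamma> \<in> \<omega>" "adj x (\<gamma> 0)" "\<gamma> 1 \<noteq> x"
  shows "case_nat x \<gamma> \<in> \<omega>"
proof (rule end_closed[OF assms(1)])
  have g: "\<gamma> \<in> geodesic_rays adj" by (rule end_ray[OF assms(1)])
  hence nb: "nb_walk adj \<gamma> n" for n using geodesic_rays_eq_nb[OF tree] by auto
  have "nb_walk adj (case_nat x \<gamma>) n" for n
    using nb[of n] assms(2,3) by (auto simp: nb_walk_def split: nat.splits)
  hence g': "case_nat x \<gamma> \<in> geodesic_rays adj" using geodesic_rays_eq_nb[OF tree] by auto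
  have "range (case_nat x \<gamma>) - range \<gamma> \<subseteq> {x}" by (auto split: nat.splits)
  moreover have "\<gamma> n \<in> range (case_nat x \<gamma>)" for n
    by (rule image_eqI[of _ _ "Suc n"]) auto
  hence "range \<gamma> - range (case_nat x \<gamma>) = {}" by blast
  ultimately have "finite ((range \<gamma> - range (case_nat x \<gamma>)) \<union> (range (case_nat x \<gamma>) - range \<gamma>))"
    using finite_subset[of _ "{x}"] by (metis Un_empty_left finite.emptyI finite.insertI)
  thus "(\<gamma>, case_nat x \<gamma>) \<in> ray_equiv adj" using g g' unfolding ray_equiv_def by blast
qed

lemma end_ray_exists: "\<exists>\<gamma>\<in>\<omega>. \<gamma> 0 = x"
proof -
  obtain \<gamma>0 where g0: "\<gamma>0 \<in> geodesic_rays adj" "\<omega> = ray_equiv adj `` {\<gamma>0}" by (rule end_class)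
  hence "\<gamma>0 \<in> \<omega>" by (auto simp: ray_equiv_def)
  have "adj\<^sup>*\<^sup>* (\<gamma>0 0) x" using tree by (auto simp: graph_tree_def)
  thus ?thesis
  proof (induction rule: rtranclp_induct)
    case base
    then show ?case using \<open>\<gamma>0 \<in> \<omega>\<close> by auto
  next
    case (step y z)
    then obtain \<gamma> where "\<gamma> \<in> \<omega>" "\<gamma> 0 = y" by auto
    then show ?case
      using end_tail[of \<gamma>] bexI[OF _ end_cons[of \<gamma> z], of "\<lambda>\<delta>. \<delta> 0 = z"] adj_sym[OF step.hyps(2)]
      by (cases "\<gamma> 1 = z") auto
  qed
qed

text \<open>Once two rays from the same vertex have separated they never meet again, so they would differ in
  infinitely many vertices.\<close>

lemma end_ray_unique:
  assumes "\<gamma> \<in> \<omega>" "\<delta> \<in> \<omega>" "\<gamma> 0 = \<delta> 0"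
  shows "\<gamma> = \<delta>"
proof (rule ccontr)
  assume "\<gamma> \<noteq> \<delta>"
  then obtain n where n: "\<gamma> n \<noteq> \<delta> n" by auto
  have nb: "nb_walk adj \<gamma> i" "nb_walk adj \<delta> i" for i
    using assms end_ray geodesic_rays_eq_nb[OF tree] by auto
  have "\<gamma> i \<notin> range \<delta>" if "i \<ge> n" for i
  proof
    assume "\<gamma> i \<in> range \<delta>"
    then obtain j where "\<gamma> i = \<delta> j" by auto
    from nb_walk_unique[OF tree nb(1)[of i] nb(2)[of j] assms(3) this] that n show False by auto
  qed
  hence "\<gamma> ` {n..} \<subseteq> (range \<gamma> - range \<delta>) \<union> (range \<delta> - range \<gamma>)" by auto
  moreover have "infinite (\<gamma> ` {n..})"
    using ray_inj[OF tree end_ray[OF assms(1)]] finite_imageD[of \<gamma> "{n..}"] infinite_Ici[of n]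
    by (meson inj_on_subset subset_UNIV)
  ultimately show False
    using end_equiv[OF assms(1,2)] finite_subset by (auto simp: ray_equiv_def)
qed

lemma ray_from_props: "ray_from T x \<in> \<omega>" "ray_from T x 0 = x"
proof -
  have "\<exists>!\<gamma>. \<gamma> \<in> \<omega> \<and> \<gamma> 0 = x" using end_ray_exists[of x] end_ray_unique by blast
  from theI'[OF this] show "ray_from T x \<in> \<omega>" "ray_from T x 0 = x" by (auto simp: ray_from_def)
qed

lemma ray_from_eqI: "\<gamma> \<in> \<omega> \<Longrightarrow> \<gamma> 0 = x \<Longrightarrow> ray_from T x = \<gamma>"
  using end_ray_unique ray_from_props by metis

text \<open>The first step towards the reference end.  All order-theoretic notions attached to the end become
  statements about iterates of this map.\<close>

definition parent :: "'a \<Rightarrow> 'a" where "parent x = ray_from T x 1"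

lemma ray_from_par: "ray_from T x n = (parent ^^ n) x"
proof (induction n arbitrary: x)
  case 0
  then show ?case by (simp add: ray_from_props)
next
  case (Suc n)
  have "ray_from T (parent x) = (\<lambda>i. ray_from T x (Suc i))"
    by (rule ray_from_eqI) (auto simp: ray_from_props end_tail parent_def)
  then show ?case using Suc[of "parent x"] by (metis funpow_Suc_right o_apply)
qed

lemma ray_from_par': "ray_from T x = (\<lambda>n. (parent ^^ n) x)" by (rule ext) (rule ray_from_par)

lemma ray_from_nb: "nb_walk adj (\<lambda>n. (parent ^^ n) x) n"
  using end_ray[OF ray_from_props(1)[of x]] geodesic_rays_eq_nb[OF tree] by (auto simp: ray_from_par')

lemma adj_par: "adj x (parent x)"
  using ray_from_nb[of x 1] by (auto simp: nb_walk_def)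

lemma par_par_neq: "parent (parent x) \<noteq> x"
  using ray_from_nb[of x 2] by (auto simp: nb_walk_def)

text \<open>For an edge from \<open>x\<close> to \<open>y\<close>, either the ray from \<open>y\<close> passes through \<open>x\<close>, or prefixing \<open>x\<close> to it
  gives the ray from \<open>x\<close>.\<close>

lemma adj_iff: "adj x y \<longleftrightarrow> y = parent x \<or> x = parent y"
proof
  assume a: "adj x y"
  show "y = parent x \<or> x = parent y"
  proof (cases "x = parent y")
    case False
    have "ray_from T x = case_nat x (ray_from T y)"
      by (rule ray_from_eqI[OF end_cons]) (use a False in \<open>auto simp: ray_from_props parent_def\<close>)
    thus ?thesis by (simp add: parent_def ray_from_props)
  qed auto
qed (use adj_par adj_sym in auto)

lemma par_funpow_inj: "inj (\<lambda>n. (parent ^^ n) x)"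
  using ray_inj[OF tree end_ray[OF ray_from_props(1)[of x]]] by (simp add: ray_from_par')

lemma par_funpow_eq: "(parent ^^ m) x = (parent ^^ n) x \<longleftrightarrow> m = n"
  using par_funpow_inj[of x] by (auto dest: injD)

lemma dist_par: "tdist T x ((parent ^^ n) x) = n"
  using graph_dist_nb_walk[OF tree ray_from_nb, of x n] by simp

lemma common_ancestor: "\<exists>m n. (parent ^^ m) x = (parent ^^ n) y"
proof (rule ccontr)
  assume no: "\<not> ?thesis"
  have "(ray_from T x, ray_from T y) \<in> ray_equiv adj" by (rule end_equiv) (rule ray_from_props)+
  hence "finite (range (ray_from T x) - range (ray_from T y))" by (auto simp: ray_equiv_def)
  moreover have "range (ray_from T x) - range (ray_from T y) = range (ray_from T x)"
    using no by (auto simp: ray_from_par')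
  moreover have "infinite (range (ray_from T x))"
    using par_funpow_inj[of x] by (auto simp: ray_from_par' dest: finite_imageD)
  ultimately show False by simp
qed

text \<open>The vertex \<open>b\<close> is recovered from its ray because iterating the parent map never returns.  This
  is what makes the confluent well defined.\<close>

lemma range_ray_eq_iff: "range (ray_from T b) = range (ray_from T c) \<longleftrightarrow> b = c"
proof
  assume eq: "range (ray_from T b) = range (ray_from T c)"
  have "b \<in> range (ray_from T c)" "c \<in> range (ray_from T b)"
    using eq ray_from_props(2) rangeI by metis+
  then obtain m n where mn: "b = (parent ^^ m) c" "c = (parent ^^ n) b" by (auto simp: ray_from_par')
  hence "(parent ^^ (m + n)) b = (parent ^^ 0) b" by (simp add: funpow_add)
  thus "b = c" unfolding par_funpow_eq using mn by simp
qed auto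

lemma confluent_eqI:
  assumes "range (ray_from T v) \<inter> range (ray_from T z) = range (ray_from T b)"
  shows "confluent T v z = b"
  unfolding confluent_def assms by (rule the_equality) (auto simp: range_ray_eq_iff)

lemma range_ray_Int:
  assumes "(parent ^^ m) v = (parent ^^ n) z" and min: "\<And>i j. (parent ^^ i) v = (parent ^^ j) z \<Longrightarrow> m \<le> i"
  shows "range (ray_from T v) \<inter> range (ray_from T z) = range (ray_from T ((parent ^^ m) v))"
proof (intro equalityI subsetI)
  fix y assume "y \<in> range (ray_from T v) \<inter> range (ray_from T z)"
  then obtain i j where ij: "y = (parent ^^ i) v" "y = (parent ^^ j) z" unfolding ray_from_par' by blast
  hence "m \<le> i" using min by metis
  hence "y = (parent ^^ (i - m)) ((parent ^^ m) v)" using ij(1) by (metis add.commute funpow_add le_add_diff_inverse o_apply)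
  thus "y \<in> range (ray_from T ((parent ^^ m) v))" by (auto simp: ray_from_par')
next
  fix y assume "y \<in> range (ray_from T ((parent ^^ m) v))"
  then obtain k where "y = (parent ^^ k) ((parent ^^ m) v)" by (auto simp: ray_from_par')
  hence "y = (parent ^^ (k + m)) v" "y = (parent ^^ (k + n)) z" using assms(1) by (simp_all add: funpow_add)
  thus "y \<in> range (ray_from T v) \<inter> range (ray_from T z)" unfolding ray_from_par' by blast
qed

lemma confluent_ex:
  obtains m n where "confluent T v z = (parent ^^ m) v" "(parent ^^ m) v = (parent ^^ n) z"
    "\<And>i j. (parent ^^ i) v = (parent ^^ j) z \<Longrightarrow> m \<le> i"
proof -
  define m where "m = (LEAST i. \<exists>j. (parent ^^ i) v = (parent ^^ j) z)"
  have "\<exists>j. (parent ^^ m) v = (parent ^^ j) z" 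
    unfolding m_def by (rule LeastI_ex) (rule common_ancestor)
  then obtain n where n: "(parent ^^ m) v = (parent ^^ n) z" by auto
  have min: "\<And>i j. (parent ^^ i) v = (parent ^^ j) z \<Longrightarrow> m \<le> i" unfolding m_def by (rule Least_le) blast
  show ?thesis
    by (rule that[OF confluent_eqI[OF range_ray_Int[OF n]] n]) (erule min)+
qed

lemma tree_le_iff: "tree_le T z v \<longleftrightarrow> (\<exists>k. z = (parent ^^ k) v)"
proof
  assume "tree_le T z v"
  thus "\<exists>k. z = (parent ^^ k) v" unfolding tree_le_def by (rule_tac confluent_ex[of z v]) auto
next
  assume "\<exists>k. z = (parent ^^ k) v"
  then obtain k where "(parent ^^ 0) z = (parent ^^ k) v" by auto
  from confluent_eqI[OF range_ray_Int[OF this]] show "tree_le T z v" by (simp add: tree_le_def)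
qed

text \<open>Any common ancestor of \<open>x\<close> and the root computes the Busemann function, since going further up
  lengthens both paths equally.\<close>

lemma busemann_eqI:
  assumes "(parent ^^ i) x = (parent ^^ j) (troot T)"
  shows "h x = int i - int j"
proof -
  obtain m n where *: "confluent T x (troot T) = (parent ^^ m) x" "(parent ^^ m) x = (parent ^^ n) (troot T)"
    "\<And>i j. (parent ^^ i) x = (parent ^^ j) (troot T) \<Longrightarrow> m \<le> i" using confluent_ex by metis
  have mi: "m \<le> i" using *(3) assms by auto
  have "(parent ^^ j) (troot T) = (parent ^^ (i - m)) ((parent ^^ m) x)"
    using assms mi by (metis add.commute funpow_add le_add_diff_inverse o_apply)
  also have "\<dots> = (parent ^^ (i - m + n)) (troot T)" by (simp add: *(2) funpow_add)
  finally have "j = i - m + n" unfolding par_funpow_eq .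
  moreover have "h x = int m - int n"
    unfolding busemann_def *(1) using dist_par[of x m] dist_par[of "troot T" n] *(2) by simp
  ultimately show ?thesis using mi by simp
qed

lemma busemann_par: "h (parent x) = h x - 1"
proof -
  obtain i j where ij: "(parent ^^ i) x = (parent ^^ j) (troot T)" using common_ancestor by blast
  hence "(parent ^^ i) (parent x) = (parent ^^ Suc j) (troot T)" by (simp flip: funpow_swap1)
  from busemann_eqI[OF this] busemann_eqI[OF ij] show ?thesis by simp
qed

lemma busemann_funpow: "h ((parent ^^ k) x) = h x - int k"
  by (induction k) (auto simp: busemann_par)

abbreviation "children x \<equiv> {y. parent y = x}"

lemma successors_eq: "successors T x = children x"
proof -
  have "adj x y \<and> h y = h x + 1 \<longleftrightarrow> parent y = x" for y
    using busemann_par[of x] busemann_par[of y] by (auto simp: adj_iff)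
  thus ?thesis by (auto simp: successors_def)
qed

lemma elabel_bij: "bij_betw (elabel T x) (children x) {0..<p}"
  using hom by (auto simp: homogeneous_tree_def successors_eq)

lemma finite_ch: "finite (children x)" and card_ch: "card (children x) = p"
  using bij_betw_finite[OF elabel_bij] bij_betw_same_card[OF elabel_bij] by auto

lemma labelled_succ:
  assumes "s < p"
  shows "parent (labelled_succ T a s) = a" "elabel T a (labelled_succ T a s) = s"
proof -
  have "\<exists>!y. y \<in> children a \<and> elabel T a y = s"
    using elabel_bij[of a] assms unfolding bij_betw_def inj_on_def by (auto simp: set_eq_iff image_iff) metis
  from theI'[OF this] show "parent (labelled_succ T a s) = a" "elabel T a (labelled_succ T a s) = s"
    by (auto simp: labelled_succ_def successors_eq)
qed

lemma elabel_less: "parent y = a \<Longrightarrow> elabel T a y < p"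
  using elabel_bij[of a] by (auto simp: bij_betw_def)

lemma elabel_inj: "parent y = a \<Longrightarrow> parent z = a \<Longrightarrow> elabel T a y = elabel T a z \<Longrightarrow> y = z"
  using elabel_bij[of a] by (auto simp: bij_betw_def inj_on_def)

end

section \<open>Haar functions on a tree\<close>

text \<open>The function \<open>label_fn p i\<close> vanishes below \<open>i - 1\<close>, peaks there and is constant afterwards, which
  reduces its pairings to one value and one tail sum.\<close>

lemma sum_label_fn_mult:
  assumes "1 \<le> i" "i < p"
  shows "(\<Sum>s<p. label_fn p i s * g s)
    = ((real p - real i) * g (i - 1) - (\<Sum>s=i..<p. g s)) / sqrt ((real p - real i) * (real p + 1 - real i))"
proof -
  let ?D = "sqrt ((real p - real i) * (real p + 1 - real i))"
  have "(\<Sum>s<p. label_fn p i s * g s) = (\<Sum>s\<in>insert (i - 1) {i..<p}. label_fn p i s * g s)"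
    using assms by (intro sum.mono_neutral_right) (auto simp: label_fn_def)
  also have "\<dots> = label_fn p i (i - 1) * g (i - 1) + (\<Sum>s=i..<p. label_fn p i s * g s)"
    using assms by (intro sum.insert) auto
  also have "(\<Sum>s=i..<p. label_fn p i s * g s) = (\<Sum>s=i..<p. - g s / ?D)"
    by (rule sum.cong) (auto simp: label_fn_def)
  also have "\<dots> = - (\<Sum>s=i..<p. g s) / ?D" by (simp add: sum_negf sum_divide_distrib)
  also have "label_fn p i (i - 1) * g (i - 1) = (real p - real i) * g (i - 1) / ?D"
    using assms by (simp add: label_fn_def)
  finally show ?thesis by (simp add: diff_divide_distrib)
qed

lemma sum_label_fn:
  assumes "1 \<le> i" "i < p"
  shows "(\<Sum>s<p. label_fn p i s) = 0"
  using sum_label_fn_mult[OF assms, of "\<lambda>_. 1"] assms by (simp add: of_nat_diff)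

text \<open>For \<open>j < i\<close> the function with index \<open>j\<close> is constant on the support of the one with index \<open>i\<close>,
  and the latter has sum zero.\<close>

lemma label_fn_orthonormal:
  assumes "1 \<le> i" "i < p" "1 \<le> j" "j < p"
  shows "(\<Sum>s<p. label_fn p i s * label_fn p j s) = (if i = j then 1 else 0)"
  using assms
proof (induction i j rule: linorder_wlog)
  case (le j i)
  define D where "D = (\<lambda>i. sqrt ((real p - real i) * (real p + 1 - real i)))"
  have D: "D i > 0" "D i * D i = (real p - real i) * (real p + 1 - real i)"
    using le by (auto simp: D_def)
  show ?case
  proof (cases "i = j")
    case True
    have "(\<Sum>s<p. label_fn p i s * label_fn p i s)
      = ((real p - real i) * ((real p - real i) / D i) - (\<Sum>s=i..<p. - 1 / D i)) / D i"
      using le by (subst sum_label_fn_mult) (auto simp: label_fn_def D_def intro!: sum.cong)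
    also have "\<dots> = (real p - real i) * (real p + 1 - real i) / (D i * D i)"
      using D(1) le by (simp add: of_nat_diff field_simps)
    also have "\<dots> = 1" unfolding D(2) using le by simp
    finally show ?thesis using True by simp
  next
    case False
    have c: "label_fn p j s = - 1 / D j" if "i - 1 \<le> s" "s < p" for s
      using that le False by (auto simp: label_fn_def D_def)
    have "(\<Sum>s<p. label_fn p i s * label_fn p j s)
      = ((real p - real i) * (- 1 / D j) - (\<Sum>s=i..<p. - 1 / D j)) / D i"
    proof -
      have "(\<Sum>s=i..<p. label_fn p j s) = (\<Sum>s=i..<p. - 1 / D j)" by (rule sum.cong) (auto simp: c)
      thus ?thesis using le by (subst sum_label_fn_mult) (simp_all add: c D_def)
    qed
    also have "\<dots> = 0" using le by (simp add: of_nat_diff)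
    finally show ?thesis using False by (simp add: mult.commute)
  qed
next
  case (sym j i)
  then show ?case by (simp add: mult.commute eq_commute)
qed

text \<open>As long as both labels lie in the constant tail, the products are
  \<open>1 / ((p - i) * (p + 1 - i))\<close> and telescope.\<close>

lemma sum_label_fn_partial:
  assumes "m \<le> s" "s \<le> t" "t < p"
  shows "(\<Sum>i=1..m. label_fn p i s * label_fn p i t) = 1 / (real p - real m) - 1 / real p"
  using assms(1)
proof (induction m)
  case (Suc m)
  define x where "x = real p - real (Suc m)"
  have x: "x > 0" using Suc.prems assms by (simp add: x_def)
  have "label_fn p (Suc m) u = - 1 / sqrt (x * (x + 1))" if "s \<le> u" "u < p" for u
    using Suc.prems that by (simp add: label_fn_def x_def)
  from this[of s] this[of t] have "label_fn p (Suc m) s * label_fn p (Suc m) t = 1 / (x * (x + 1))"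
    using assms x by simp
  also have "\<dots> = 1 / x - 1 / (x + 1)" using x by (simp add: field_simps)
  also have "x + 1 = real p - real m" by (simp add: x_def)
  finally show ?case using Suc by (simp add: x_def)
qed simp

text \<open>The label functions form an orthonormal basis of the functions of mean zero on \<open>{0..<p}\<close>; the
  right-hand side is the kernel of the projection onto these.\<close>

lemma label_fn_complete:
  assumes "s < p" "t < p"
  shows "(\<Sum>i=1..p-1. label_fn p i s * label_fn p i t) = (if s = t then 1 else 0) - 1 / real p"
  using assms
proof (induction s t rule: linorder_wlog)
  case (le s t)
  show ?case
  proof (cases "Suc s = p")
    case True
    hence "p - 1 = s" "t = s" using le by auto
    with sum_label_fn_partial[of s s s p] True show ?thesis by auto
  next
    case False
    define x where "x = real p - real (Suc s)"
    have x: "x > 0" using le False by (simp add: x_def)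
    have "(\<Sum>i=1..p-1. label_fn p i s * label_fn p i t) = (\<Sum>i=1..Suc s. label_fn p i s * label_fn p i t)"
      using le False by (intro sum.mono_neutral_right) (auto simp: label_fn_def)
    also have "\<dots> = (\<Sum>i=1..s. label_fn p i s * label_fn p i t) + label_fn p (Suc s) s * label_fn p (Suc s) t"
      by simp
    also have "(\<Sum>i=1..s. label_fn p i s * label_fn p i t) = 1 / (x + 1) - 1 / real p"
      using sum_label_fn_partial[of s s t p] le by (simp add: x_def)
    also have "label_fn p (Suc s) s * label_fn p (Suc s) t = (if s = t then x / (x + 1) else - 1 / (x + 1))"
    proof -
      have sq: "sqrt (x * (x + 1)) * sqrt (x * (x + 1)) = x * (x + 1)" using x by simp
      have eq: "label_fn p (Suc s) s = x / sqrt (x * (x + 1))" by (simp add: label_fn_def x_def)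
      show ?thesis
      proof (cases "s = t")
        case True
        hence "label_fn p (Suc s) s * label_fn p (Suc s) t = (x * x) / (sqrt (x * (x + 1)) * sqrt (x * (x + 1)))"
          using eq by simp
        also have "\<dots> = x / (x + 1)" unfolding sq using x by simp
        finally show ?thesis using True by simp
      next
        case False
        hence "label_fn p (Suc s) t = - 1 / sqrt (x * (x + 1))" using le by (simp add: label_fn_def x_def)
        hence "label_fn p (Suc s) s * label_fn p (Suc s) t = - x / (sqrt (x * (x + 1)) * sqrt (x * (x + 1)))"
          using eq by simp
        also have "\<dots> = - 1 / (x + 1)" unfolding sq using x by simp
        finally show ?thesis using False by simp
      qed
    qed
    also have "1 / (x + 1) - 1 / real p + (if s = t then x / (x + 1) else - 1 / (x + 1))
      = (if s = t then 1 else 0) - 1 / real p"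
    proof (cases "s = t")
      case True
      have "1 / (x + 1) + x / (x + 1) = 1" using x by (simp flip: add_divide_distrib add: add.commute)
      thus ?thesis using True by simp
    qed simp
    finally show ?thesis .
  qed
next
  case (sym t s)
  have "(\<Sum>i=1..p-1. label_fn p i t * label_fn p i s) = (\<Sum>i=1..p-1. label_fn p i s * label_fn p i t)"
    by (rule sum.cong[OF refl mult.commute])
  with sym(1)[OF sym(3,2)] show ?case by (cases "s = t") simp_all
qed

context end_tree begin

text \<open>A closed form of \<open>level_fn\<close> for \<open>k > 0\<close> without definite descriptions.  The value \<open>0\<close> at
  \<open>k = 0\<close> is the boundary condition that lets the formula for summation over children include
  \<open>k = 1\<close>.\<close>

definition tree_haar :: "'a \<Rightarrow> nat \<Rightarrow> nat \<Rightarrow> 'a \<Rightarrow> real" where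
  "tree_haar a i k x = (if 0 < k \<and> (parent ^^ k) x = a
     then label_fn p i (elabel T a ((parent ^^ (k - 1)) x)) * real p powr ((1 - real k) / 2) else 0)"

abbreviation "desc a k \<equiv> {x. (parent ^^ k) x = a}"

lemma tree_haar_0 [simp]: "tree_haar a i 0 x = 0" by (simp add: tree_haar_def)

lemma tree_haar_eq_0: "(parent ^^ k) x \<noteq> a \<Longrightarrow> tree_haar a i k x = 0" by (simp add: tree_haar_def)

text \<open>Comparing Busemann values, the successor of \<open>a\<close> preceding \<open>x\<close> can only be the ancestor of \<open>x\<close> of order
  \<open>k - 1\<close>.\<close>

lemma level_fn_eq:
  assumes "1 \<le> k"
  shows "level_fn p T a i k x = tree_haar a i k x"
proof -
  let ?v = "(parent ^^ (k - 1)) x"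
  have pv: "parent ?v = (parent ^^ k) x" using assms by (cases k) auto
  have le: "busemann T x = busemann T a + int k \<and> s < p \<and> tree_le T (labelled_succ T a s) x
     \<longleftrightarrow> (parent ^^ k) x = a \<and> s = elabel T a ?v" for s
  proof safe
    assume hx: "h x = h a + int k" and s: "s < p" and tl: "tree_le T (labelled_succ T a s) x"
    then obtain j where j: "labelled_succ T a s = (parent ^^ j) x" by (auto simp: tree_le_iff)
    have "h (labelled_succ T a s) = h a + 1"
      using busemann_par[of "labelled_succ T a s"] labelled_succ(1)[OF s, of a] by simp
    hence "j = k - 1" using busemann_funpow[of j x] j hx assms by simp
    thus "(parent ^^ k) x = a" "s = elabel T a ?v" using pv labelled_succ[OF s, of a] j by auto
  next
    assume a: "a = (parent ^^ k) x"
    show "h x = h ((parent ^^ k) x) + int k" by (simp add: busemann_funpow)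
    show el: "elabel T ((parent ^^ k) x) ?v < p" by (rule elabel_less) (rule pv)
    have "labelled_succ T ((parent ^^ k) x) (elabel T ((parent ^^ k) x) ?v) = ?v"
      by (rule elabel_inj[of _ "(parent ^^ k) x"]) (use pv labelled_succ[OF el] in auto)
    thus "tree_le T (labelled_succ T ((parent ^^ k) x) (elabel T ((parent ^^ k) x) ?v)) x"
      by (auto simp: tree_le_iff)
  qed
  show ?thesis
  proof (cases "(parent ^^ k) x = a")
    case True
    have c: "h x = h a + int k" "elabel T a ?v < p" "tree_le T (labelled_succ T a (elabel T a ?v)) x"
      using le[of "elabel T a ?v"] True by auto
    have "(THE s. s < p \<and> tree_le T (labelled_succ T a s) x) = elabel T a ?v"
      by (rule the_equality) (use le c in blast)+
    thus ?thesis using c True assms unfolding level_fn_def tree_haar_def by auto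
  next
    case False
    hence "\<not> (h x = h a + int k \<and> (\<exists>s<p. tree_le T (labelled_succ T a s) x))" using le by blast
    hence "level_fn p T a i k x = 0" unfolding level_fn_def by (rule if_not_P)
    thus ?thesis using False by (simp add: tree_haar_def)
  qed
qed

lemma tree_haar_par:
  assumes "1 \<le> k"
  shows "tree_haar a i k (parent x) = sqrt p * tree_haar a i (Suc k) x"
proof -
  obtain l where k: "k = Suc l" using assms by (cases k) auto
  have "sqrt p * real p powr ((1 - real (Suc k)) / 2) = real p powr (1/2 + (1 - real (Suc k)) / 2)"
    using p2 by (simp only: powr_add powr_half_sqrt)
  also have "1/2 + (1 - real (Suc k)) / 2 = (1 - real k) / 2" by (simp add: field_simps)
  finally have "real p powr ((1 - real k) / 2) = sqrt p * real p powr ((1 - real (Suc k)) / 2)" by simp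
  thus ?thesis unfolding tree_haar_def k by (simp add: funpow_swap1)
qed

lemma sum_children: "(\<Sum>c\<in>children a. g (elabel T a c)) = (\<Sum>s<p. g s)"
  using sum.reindex_bij_betw[OF elabel_bij[of a], of g] by (simp add: atLeast0LessThan)

text \<open>For \<open>k > 1\<close> all children of \<open>x\<close> carry the same value; for \<open>k = 1\<close> and \<open>x = a\<close> they carry the whole
  label function, whose sum is zero.\<close>

lemma sum_tree_haar_children:
  assumes "1 \<le> k" "1 \<le> i" "i < p"
  shows "(\<Sum>c\<in>children x. tree_haar a i k c) = sqrt p * tree_haar a i (k - 1) x"
proof (cases "k = 1")
  case True
  have "(\<Sum>c\<in>children x. tree_haar a i 1 c) = (\<Sum>c\<in>children x. if x = a then label_fn p i (elabel T x c) else 0)"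
    using p2 by (intro sum.cong) (auto simp: tree_haar_def)
  also have "\<dots> = 0"
    using sum_children[of "label_fn p i" x] sum_label_fn[OF assms(2,3)] by (cases "x = a") auto
  finally show ?thesis using True by simp
next
  case False
  then obtain l where k: "k = Suc l" "l \<ge> 1" using assms by (cases k) auto
  have pp: "sqrt p * sqrt p = p" by simp
  have "tree_haar a i k c = tree_haar a i l x / sqrt p" if "c \<in> children x" for c
    using tree_haar_par[OF k(2), of a i c] that p2 by (simp add: k)
  hence "(\<Sum>c\<in>children x. tree_haar a i k c) = (\<Sum>c\<in>children x. tree_haar a i l x / sqrt p)" by (intro sum.cong) auto
  also have "\<dots> = p * (tree_haar a i l x / sqrt p)" by (simp add: card_ch)
  also have "\<dots> = sqrt p * tree_haar a i l x" using p2 pp by (simp add: field_simps)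
  finally show ?thesis by (simp add: k)
qed

lemma desc_Suc: "desc a (Suc k) = (\<Union>c\<in>children a. desc c k)"
  by auto

lemma finite_desc: "finite (desc a k)"
proof (induction k arbitrary: a)
  case (Suc k)
  then show ?case using finite_ch unfolding desc_Suc by blast
qed simp

lemma card_desc: "card (desc a k) = p ^ k"
proof (induction k arbitrary: a)
  case (Suc k)
  have "card (\<Union>c\<in>children a. desc c k) = (\<Sum>c\<in>children a. card (desc c k))"
    by (rule card_UN_disjoint) (auto intro: finite_ch finite_desc)
  then show ?case unfolding desc_Suc by (simp add: Suc card_ch)
qed simp

lemma sum_desc:
  "(\<Sum>x\<in>desc a (Suc k). g (elabel T a ((parent ^^ k) x))) = real p ^ k * (\<Sum>s<p. g s :: real)"
proof -
  have "(\<Sum>x\<in>desc a (Suc k). g (elabel T a ((parent ^^ k) x)))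
    = (\<Sum>c\<in>children a. \<Sum>x\<in>desc c k. g (elabel T a ((parent ^^ k) x)))"
    unfolding desc_Suc by (rule sum.UNION_disjoint) (auto intro: finite_ch finite_desc)
  also have "\<dots> = (\<Sum>c\<in>children a. real p ^ k * g (elabel T a c))"
    by (intro sum.cong refl) (simp add: card_desc)
  also have "\<dots> = real p ^ k * (\<Sum>c\<in>children a. g (elabel T a c))" by (simp add: sum_distrib_left)
  finally show ?thesis by (simp add: sum_children)
qed

lemma powr_half_sq: "real p powr ((1 - real (Suc k)) / 2) * real p powr ((1 - real (Suc k)) / 2) = 1 / real p ^ k"
proof -
  have "real p powr ((1 - real (Suc k)) / 2) * real p powr ((1 - real (Suc k)) / 2) = real p powr ((1 - real (Suc k)) / 2 + (1 - real (Suc k)) / 2)"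
    by (rule powr_add[symmetric])
  also have "(1 - real (Suc k)) / 2 + (1 - real (Suc k)) / 2 = - real k" by simp
  finally show ?thesis using p2 by (simp only: powr_minus divide_inverse) (simp add: powr_realpow)
qed

text \<open>On equal generations this is orthonormality of the label functions, each label being hit by
  \<open>p ^ (k - 1)\<close> descendants.  On different generations the function from the higher apex is constant
  on the descendants of the lower one.\<close>

lemma tree_haar_orthonormal:
  assumes "finite X" "desc a k \<subseteq> X" "desc b l \<subseteq> X"
    and "1 \<le> i" "i < p" "1 \<le> j" "j < p" "1 \<le> k" "1 \<le> l"
  shows "(\<Sum>x\<in>X. tree_haar a i k x * tree_haar b j l x) = (if a = b \<and> i = j \<and> k = l then 1 else 0)"
  using assms(2-)
proof (induction k l arbitrary: a b i j rule: linorder_wlog)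
  case (le k l)
  obtain k' where k: "k = Suc k'" using le by (cases k) auto
  let ?P = "real p powr ((1 - real k) / 2)"
  have restr: "(\<Sum>x\<in>X. tree_haar a i k x * tree_haar b j l x) = (\<Sum>x\<in>desc a k. tree_haar a i k x * tree_haar b j l x)"
    using le assms(1) by (intro sum.mono_neutral_right) (auto simp: tree_haar_eq_0)
  show ?case
  proof (cases "k = l")
    case True
    show ?thesis
    proof (cases "a = b")
      case ab: True
      have "(\<Sum>x\<in>desc a k. tree_haar a i k x * tree_haar b j l x) = (\<Sum>x\<in>desc a (Suc k').
           (\<lambda>s. label_fn p i s * label_fn p j s * (?P * ?P)) (elabel T a ((parent ^^ k') x)))"
        using k True ab by (intro sum.cong) (auto simp: tree_haar_def)
      also have "\<dots> = real p ^ k' * (\<Sum>s<p. label_fn p i s * label_fn p j s * (?P * ?P))"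
        by (rule sum_desc)
      also have "\<dots> = real p ^ k' * (?P * ?P) * (\<Sum>s<p. label_fn p i s * label_fn p j s)"
        by (simp add: sum_distrib_left sum_distrib_right mult_ac)
      also have "real p ^ k' * (?P * ?P) = 1" unfolding k powr_half_sq using p2 by simp
      finally show ?thesis using ab True label_fn_orthonormal[of i p j] le restr by simp
    next
      case False
      hence "(\<Sum>x\<in>desc a k. tree_haar a i k x * tree_haar b j l x) = 0"
        using True by (intro sum.neutral) (auto simp: tree_haar_eq_0)
      thus ?thesis using False restr by simp
    qed
  next
    case False
    \<comment> \<open>On the descendants of \<open>a\<close>, the function with apex \<open>b\<close> is a constant \<open>C\<close>.\<close>
    define l' where "l' = l - k"
    have l': "l = l' + k" "l' \<ge> 1" using le False by (auto simp: l'_def)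
    have c: "(parent ^^ l) x = (parent ^^ l') a \<and> (parent ^^ (l - 1)) x = (parent ^^ (l' - 1)) a" if "x \<in> desc a k" for x
    proof -
      have "l - 1 = (l' - 1) + k" using l' by simp
      thus ?thesis using that l' by (simp only: funpow_add) auto
    qed
    define C where "C = (if (parent ^^ l') a = b then label_fn p j (elabel T b ((parent ^^ (l' - 1)) a)) * real p powr ((1 - real l) / 2) else 0)"
    have "(\<Sum>x\<in>desc a k. tree_haar a i k x * tree_haar b j l x)
       = (\<Sum>x\<in>desc a (Suc k'). (\<lambda>s. label_fn p i s * (?P * C)) (elabel T a ((parent ^^ k') x)))"
      using k c le by (intro sum.cong) (auto simp: tree_haar_def C_def)
    also have "\<dots> = real p ^ k' * (\<Sum>s<p. label_fn p i s * (?P * C))" by (rule sum_desc)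
    also have "\<dots> = 0" using sum_label_fn[of i p] le by (simp flip: sum_distrib_right)
    finally show ?thesis using restr False by simp
  qed
next
  case (sym l k)
  show ?case using sym(1)[of b a j i] sym(2-) by (simp add: mult.commute eq_commute conj_commute)
qed

text \<open>The uniform probability density on the descendants, in the generation of \<open>x\<close>, of the ancestor of
  order \<open>k\<close> of \<open>x\<close>.\<close>

definition cell :: "'a \<Rightarrow> nat \<Rightarrow> 'a \<Rightarrow> real" where
  "cell x k y = (if (parent ^^ k) y = (parent ^^ k) x then 1 / real p ^ k else 0)"

text \<open>Refining the averaging by one generation is described by the projection kernel of
  \<open>label_fn_complete\<close>, scaled by \<open>1 / p ^ k\<close>.\<close>

lemma cell_diff:
  "cell x k y - cell x (Suc k) y
    = (\<Sum>i=1..p-1. tree_haar ((parent ^^ Suc k) x) i (Suc k) x * tree_haar ((parent ^^ Suc k) x) i (Suc k) y)"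
proof (cases "(parent ^^ Suc k) y = (parent ^^ Suc k) x")
  case True
  let ?a = "(parent ^^ Suc k) x" and ?P = "real p powr ((1 - real (Suc k)) / 2)"
  let ?s = "elabel T ?a ((parent ^^ k) x)" and ?t = "elabel T ?a ((parent ^^ k) y)"
  have st: "?s < p" "?t < p" using True by (auto intro!: elabel_less)
  have st_eq: "?s = ?t \<longleftrightarrow> (parent ^^ k) y = (parent ^^ k) x"
  proof
    assume "?s = ?t"
    moreover have "parent ((parent ^^ k) x) = ?a" "parent ((parent ^^ k) y) = ?a" using True by simp_all
    ultimately show "(parent ^^ k) y = (parent ^^ k) x" using elabel_inj by metis
  qed simp
  have "(\<Sum>i=1..p-1. tree_haar ?a i (Suc k) x * tree_haar ?a i (Suc k) y)
     = (\<Sum>i=1..p-1. label_fn p i ?s * label_fn p i ?t * (?P * ?P))"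
    using True by (intro sum.cong) (auto simp: tree_haar_def)
  also have "\<dots> = ((if ?s = ?t then 1 else 0) - 1 / real p) * (?P * ?P)"
    by (simp only: label_fn_complete[OF st] flip: sum_distrib_right)
  also have "\<dots> = cell x k y - cell x (Suc k) y"
  proof -
    have "cell x (Suc k) y = (1 / real p) * (1 / real p ^ k)" using True by (simp add: cell_def)
    moreover have "cell x k y = (if (parent ^^ k) y = (parent ^^ k) x then 1 else 0) * (1 / real p ^ k)"
      by (simp add: cell_def)
    ultimately show ?thesis unfolding powr_half_sq st_eq by (simp only: left_diff_distrib)
  qed
  finally show ?thesis by simp
next
  case False
  hence "(parent ^^ k) y \<noteq> (parent ^^ k) x" by auto
  with False have "cell x k y = 0" "cell x (Suc k) y = 0" unfolding cell_def by (simp_all only: if_False)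
  thus ?thesis using tree_haar_eq_0[OF False] by (simp del: funpow.simps)
qed

lemma cell_telescope:
  "(if y = x then 1 else 0) = (\<Sum>k=1..K. \<Sum>i=1..p-1. tree_haar ((parent ^^ k) x) i k x * tree_haar ((parent ^^ k) x) i k y) + cell x K y"
proof (induction K)
  case 0
  then show ?case by (simp add: cell_def)
next
  case (Suc K)
  show ?case unfolding Suc using cell_diff[of x K y] by (simp del: funpow.simps)
qed

lemma sum_cell_sq:
  assumes "finite X"
  shows "(\<Sum>y\<in>X. (cell x K y)\<^sup>2) \<le> 1 / real p ^ K"
proof -
  have "(\<Sum>y\<in>X. (cell x K y)\<^sup>2) \<le> (\<Sum>y\<in>X \<union> desc ((parent ^^ K) x) K. (cell x K y)\<^sup>2)"
    using assms finite_desc by (intro sum_mono2) auto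
  also have "\<dots> = (\<Sum>y\<in>desc ((parent ^^ K) x) K. (1 / real p ^ K)\<^sup>2)"
    using assms finite_desc by (intro sum.mono_neutral_cong_right) (auto simp: cell_def)
  also have "\<dots> = 1 / real p ^ K" using p2 by (simp add: card_desc power2_eq_square)
  finally show ?thesis .
qed

end

section \<open>Square-summable functions and diagonal operators\<close>

text \<open>Membership in \<open>ell2\<close> and norm bounds are both tested on finite sets, where Minkowski's inequality
  for \<open>L2_set\<close> is available.\<close>

lemma ell2_boundI:
  assumes "\<And>x. x \<notin> V \<Longrightarrow> f x = 0"
    and "\<And>F. finite F \<Longrightarrow> F \<subseteq> V \<Longrightarrow> L2_set (\<lambda>x. cmod (f x)) F \<le> C"
  shows "f \<in> ell2 V" "ell2_norm V f \<le> C"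
proof -
  have C0: "C \<ge> 0" using assms(2)[of "{}"] by simp
  have le: "(\<Sum>x\<in>F. (cmod (f x))\<^sup>2) \<le> C\<^sup>2" if "finite F" "F \<subseteq> V" for F
  proof -
    have "(\<Sum>x\<in>F. (cmod (f x))\<^sup>2) = (L2_set (\<lambda>x. cmod (f x)) F)\<^sup>2"
      by (simp add: L2_set_def sum_nonneg)
    also have "\<dots> \<le> C\<^sup>2" using assms(2)[OF that] by (intro power_mono) auto
    finally show ?thesis .
  qed
  have sm: "(\<lambda>x. (cmod (f x))\<^sup>2) summable_on V"
    by (rule nonneg_bdd_above_summable_on) (auto intro!: bdd_aboveI2[where M="C\<^sup>2"] le)
  show "f \<in> ell2 V" using sm assms(1) by (auto simp: ell2_def)
  have "(\<Sum>\<^sub>\<infinity>x\<in>V. (cmod (f x))\<^sup>2) \<le> C\<^sup>2" by (rule infsum_le_finite_sums[OF sm]) (rule le)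
  thus "ell2_norm V f \<le> C" unfolding ell2_norm_def using C0 by (intro real_le_lsqrt) auto
qed

lemma ell2_zero: "f \<in> ell2 V \<Longrightarrow> x \<notin> V \<Longrightarrow> f x = 0" by (simp add: ell2_def)

lemma L2_set_le_ell2_norm:
  assumes "f \<in> ell2 V" "finite F"
  shows "L2_set (\<lambda>x. cmod (f x)) F \<le> ell2_norm V f"
proof -
  have "(\<Sum>x\<in>F. (cmod (f x))\<^sup>2) = (\<Sum>x\<in>F \<inter> V. (cmod (f x))\<^sup>2)"
    using assms by (intro sum.mono_neutral_right) (auto simp: ell2_zero)
  also have "\<dots> \<le> (\<Sum>\<^sub>\<infinity>x\<in>V. (cmod (f x))\<^sup>2)"
    using assms by (intro finite_sum_le_infsum) (auto simp: ell2_def)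
  finally show ?thesis unfolding L2_set_def ell2_norm_def by (rule real_sqrt_le_mono)
qed

lemma cmod_le_ell2_norm: "f \<in> ell2 V \<Longrightarrow> cmod (f x) \<le> ell2_norm V f"
  using L2_set_le_ell2_norm[of f V "{x}"] by simp

lemma ell2_norm_nonneg: "f \<in> ell2 V \<Longrightarrow> 0 \<le> ell2_norm V f"
  using L2_set_le_ell2_norm[of f V "{}"] by simp

lemma ell2_norm_pos: "f \<in> ell2 V \<Longrightarrow> f \<noteq> (\<lambda>x. 0) \<Longrightarrow> 0 < ell2_norm V f"
  using cmod_le_ell2_norm[of f V] by (metis ext less_le_trans zero_less_norm_iff)

lemma ell2_add:
  assumes "f \<in> ell2 V" "g \<in> ell2 V"
  shows "(\<lambda>x. f x + g x) \<in> ell2 V" "ell2_norm V (\<lambda>x. f x + g x) \<le> ell2_norm V f + ell2_norm V g"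
proof -
  have "L2_set (\<lambda>x. cmod (f x + g x)) F \<le> ell2_norm V f + ell2_norm V g" if "finite F" for F
  proof -
    have "L2_set (\<lambda>x. cmod (f x + g x)) F \<le> L2_set (\<lambda>x. cmod (f x) + cmod (g x)) F"
      by (intro L2_set_mono) (auto simp: norm_triangle_ineq)
    also have "\<dots> \<le> L2_set (\<lambda>x. cmod (f x)) F + L2_set (\<lambda>x. cmod (g x)) F" by (rule L2_set_triangle_ineq)
    also have "\<dots> \<le> ell2_norm V f + ell2_norm V g"
      using assms that by (intro add_mono L2_set_le_ell2_norm)
    finally show ?thesis .
  qed
  moreover have "\<And>x. x \<notin> V \<Longrightarrow> f x + g x = 0" using assms by (simp add: ell2_zero)
  ultimately show "(\<lambda>x. f x + g x) \<in> ell2 V" "ell2_norm V (\<lambda>x. f x + g x) \<le> ell2_norm V f + ell2_norm V g"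
    using ell2_boundI[of V "\<lambda>x. f x + g x"] by blast+
qed

lemma ell2_scale:
  assumes "f \<in> ell2 V"
  shows "(\<lambda>x. c * f x) \<in> ell2 V" "ell2_norm V (\<lambda>x. c * f x) = cmod c * ell2_norm V f"
  using assms
  by (auto simp: ell2_def ell2_norm_def norm_mult power_mult_distrib infsum_cmult_right' real_sqrt_mult
      intro: summable_on_cmult_right)

lemma ell2_diff:
  assumes "f \<in> ell2 V" "g \<in> ell2 V"
  shows "(\<lambda>x. f x - g x) \<in> ell2 V" "ell2_norm V (\<lambda>x. f x - g x) \<le> ell2_norm V f + ell2_norm V g"
  using ell2_add[OF assms(1) ell2_scale(1)[OF assms(2), of "-1"]] ell2_scale(2)[OF assms(2), of "-1"] by auto

lemma ell2_const_0: "(\<lambda>x. 0) \<in> ell2 V" "ell2_norm V (\<lambda>x. 0) = 0"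
  by (auto simp: ell2_def ell2_norm_def)

lemma ell2_sum:
  assumes "\<And>i. i \<in> I \<Longrightarrow> f i \<in> ell2 V"
  shows "(\<lambda>x. \<Sum>i\<in>I. f i x) \<in> ell2 V \<and> ell2_norm V (\<lambda>x. \<Sum>i\<in>I. f i x) \<le> (\<Sum>i\<in>I. ell2_norm V (f i))"
proof (cases "finite I")
  case True
  thus ?thesis using assms
  proof (induction I)
    case empty
    show ?case using ell2_const_0[of V] by simp
  next
    case (insert i I)
    from insert.IH insert.prems have IH: "(\<lambda>x. \<Sum>i\<in>I. f i x) \<in> ell2 V"
      "ell2_norm V (\<lambda>x. \<Sum>i\<in>I. f i x) \<le> (\<Sum>i\<in>I. ell2_norm V (f i))" by auto
    from ell2_add[OF insert.prems[of i] IH(1)] IH(2) insert.hyps show ?case by auto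
  qed
next
  case False
  thus ?thesis using ell2_const_0[of V] by simp
qed

lemma ell2_finite_support:
  assumes "finite X" "X \<subseteq> V" "\<And>x. x \<notin> X \<Longrightarrow> f x = 0"
  shows "f \<in> ell2 V" "ell2_norm V f = L2_set (\<lambda>x. cmod (f x)) X"
proof -
  have "L2_set (\<lambda>x. cmod (f x)) F \<le> L2_set (\<lambda>x. cmod (f x)) X" if "finite F" for F
  proof -
    have "(\<Sum>x\<in>F. (cmod (f x))\<^sup>2) = (\<Sum>x\<in>F \<inter> X. (cmod (f x))\<^sup>2)"
      using assms(3) that by (intro sum.mono_neutral_right) auto
    also have "\<dots> \<le> (\<Sum>x\<in>X. (cmod (f x))\<^sup>2)" using assms(1) by (intro sum_mono2) auto
    finally show ?thesis unfolding L2_set_def by (rule real_sqrt_le_mono)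
  qed
  moreover have "f x = 0" if "x \<notin> V" for x using assms that by blast
  ultimately have *: "f \<in> ell2 V" "ell2_norm V f \<le> L2_set (\<lambda>x. cmod (f x)) X"
    using ell2_boundI[of V f] by blast+
  show "f \<in> ell2 V" by fact
  show "ell2_norm V f = L2_set (\<lambda>x. cmod (f x)) X"
    using *(2) L2_set_le_ell2_norm[OF *(1) assms(1)] by simp
qed

lemma ell2_inner_finite_support:
  assumes "finite X" "X \<subseteq> V" "\<And>x. x \<notin> X \<Longrightarrow> g x = 0"
  shows "ell2_inner V f g = (\<Sum>x\<in>X. f x * cnj (g x))"
proof -
  have "ell2_inner V f g = (\<Sum>\<^sub>\<infinity>x\<in>X. f x * cnj (g x))"
    unfolding ell2_inner_def using assms by (intro infsum_cong_neutral) auto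
  thus ?thesis using assms(1) by simp
qed

definition fspan :: "('v \<Rightarrow> complex) set \<Rightarrow> ('v \<Rightarrow> complex) set" where
  "fspan B = {f. \<exists>F c. finite F \<and> F \<subseteq> B \<and> f = (\<lambda>x. \<Sum>b\<in>F. c b * b x)}"

lemma fspanI: "finite F \<Longrightarrow> F \<subseteq> B \<Longrightarrow> (\<lambda>x. \<Sum>b\<in>F. c b * b x) \<in> fspan B"
  unfolding fspan_def by blast

lemma fspan_zero: "(\<lambda>x. 0) \<in> fspan B"
  unfolding fspan_def by (auto intro!: exI[of _ "{}"])

lemma fspan_base: "b \<in> B \<Longrightarrow> b \<in> fspan B"
  unfolding fspan_def by (auto intro!: exI[of _ "{b}"] exI[of _ "\<lambda>_. 1"])

lemma fspan_scale: "f \<in> fspan B \<Longrightarrow> (\<lambda>x. c * f x) \<in> fspan B"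
proof -
  assume "f \<in> fspan B"
  then obtain F d where "finite F" "F \<subseteq> B" "f = (\<lambda>x. \<Sum>b\<in>F. d b * b x)" by (auto simp: fspan_def)
  thus ?thesis unfolding fspan_def
    by (intro CollectI exI[of _ F] exI[of _ "\<lambda>b. c * d b"]) (auto simp: sum_distrib_left mult_ac)
qed

lemma fspan_add:
  assumes "f \<in> fspan B" "g \<in> fspan B"
  shows "(\<lambda>x. f x + g x) \<in> fspan B"
proof -
  obtain F c where F: "finite F" "F \<subseteq> B" "f = (\<lambda>x. \<Sum>b\<in>F. c b * b x)" using assms by (auto simp: fspan_def)
  obtain G d where G: "finite G" "G \<subseteq> B" "g = (\<lambda>x. \<Sum>b\<in>G. d b * b x)" using assms by (auto simp: fspan_def)
  have "f x = (\<Sum>b\<in>F \<union> G. (if b \<in> F then c b else 0) * b x)" for x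
    unfolding F(3) using F G by (intro sum.mono_neutral_cong_left) auto
  moreover have "g x = (\<Sum>b\<in>F \<union> G. (if b \<in> G then d b else 0) * b x)" for x
    unfolding G(3) using F G by (intro sum.mono_neutral_cong_left) auto
  ultimately have eq: "(\<lambda>x. f x + g x) = (\<lambda>x. \<Sum>b\<in>F \<union> G. ((if b \<in> F then c b else 0) + (if b \<in> G then d b else 0)) * b x)"
    by (simp only: distrib_right sum.distrib)
  show ?thesis unfolding eq using F G by (intro fspanI) auto
qed

lemma fspan_sum: "(\<And>i. i \<in> I \<Longrightarrow> f i \<in> fspan B) \<Longrightarrow> (\<lambda>x. \<Sum>i\<in>I. f i x) \<in> fspan B"
proof (induction I rule: infinite_finite_induct)
  case (insert i I)
  then show ?case using fspan_add[of "f i" B "\<lambda>x. \<Sum>i\<in>I. f i x"] by simp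
qed (auto simp: fspan_zero)

lemma fspan_ell2:
  assumes "B \<subseteq> ell2 V" "f \<in> fspan B"
  shows "f \<in> ell2 V"
proof -
  obtain F c where F: "finite F" "F \<subseteq> B" "f = (\<lambda>x. \<Sum>b\<in>F. c b * b x)" using assms by (auto simp: fspan_def)
  have "(\<lambda>x. c b * b x) \<in> ell2 V" if "b \<in> F" for b using that F assms(1) by (intro ell2_scale(1)) auto
  thus ?thesis unfolding F(3) using ell2_sum[of F "\<lambda>b x. c b * b x" V] by blast
qed

lemma ell2_tail_small:
  assumes "f \<in> ell2 V" "\<epsilon> > 0"
  obtains F where "finite F" "F \<subseteq> V" "ell2_norm V (\<lambda>x. f x - (if x \<in> F then f x else 0)) < \<epsilon>"
proof -
  let ?S = "\<Sum>\<^sub>\<infinity>x\<in>V. (cmod (f x))\<^sup>2"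
  have sm: "(\<lambda>x. (cmod (f x))\<^sup>2) summable_on V" using assms by (simp add: ell2_def)
  from infsum_tendsto[OF sm] have "\<forall>\<^sub>F F in finite_subsets_at_top V. (\<Sum>x\<in>F. (cmod (f x))\<^sup>2) > ?S - (\<epsilon>/2)\<^sup>2"
    using assms(2) by (intro order_tendstoD(1)) auto
  then obtain F where F: "finite F" "F \<subseteq> V" "(\<Sum>x\<in>F. (cmod (f x))\<^sup>2) > ?S - (\<epsilon>/2)\<^sup>2"
    unfolding eventually_finite_subsets_at_top by auto
  have "ell2_norm V (\<lambda>x. f x - (if x \<in> F then f x else 0)) \<le> \<epsilon> / 2"
  proof (rule ell2_boundI(2))
    fix G assume G: "finite G" "G \<subseteq> V"
    have "(\<Sum>x\<in>G. (cmod (f x - (if x \<in> F then f x else 0)))\<^sup>2) = (\<Sum>x\<in>G - F. (cmod (f x))\<^sup>2)"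
      using G by (intro sum.mono_neutral_cong_right) auto
    also have "\<dots> + (\<Sum>x\<in>F. (cmod (f x))\<^sup>2) = (\<Sum>x\<in>(G - F) \<union> F. (cmod (f x))\<^sup>2)"
      using F G by (intro sum.union_disjoint[symmetric]) auto
    also have "\<dots> \<le> ?S" using F G by (intro finite_sum_le_infsum sm) auto
    finally show "L2_set (\<lambda>x. cmod (f x - (if x \<in> F then f x else 0))) G \<le> \<epsilon> / 2"
      unfolding L2_set_def using F(3) assms(2) by (intro real_le_lsqrt) auto
  qed (use assms in \<open>auto simp: ell2_zero\<close>)
  thus ?thesis using that F assms(2) by simp
qed

text \<open>Point masses span the finitely supported functions, which are dense.\<close>

lemma complete_if_deltas_approximable:
  assumes ons: "orthonormal_system V B"
    and approx: "\<And>v \<epsilon>. v \<in> V \<Longrightarrow> \<epsilon> > 0 \<Longrightarrow> \<exists>g\<in>fspan B. ell2_norm V (\<lambda>x. (if x = v then 1 else 0) - g x) < \<epsilon>"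
  shows "complete_orthonormal_system V B"
proof -
  have Bl: "B \<subseteq> ell2 V" using ons by (simp add: orthonormal_system_def)
  have fin: "\<exists>g\<in>fspan B. ell2_norm V (\<lambda>x. (if x \<in> F then c x else 0) - g x) < \<epsilon>"
    if "finite F" "F \<subseteq> V" "\<epsilon> > 0" for F c \<epsilon>
    using that
  proof (induction F arbitrary: \<epsilon>)
    case empty
    then show ?case using ell2_finite_support(2)[of "{}" V "\<lambda>x. 0"] by (auto intro!: bexI[OF _ fspan_zero])
  next
    case (insert v F)
    have "\<epsilon> / 2 > 0" "\<epsilon> / (2 * (cmod (c v) + 1)) > 0"
      using insert.prems by (auto intro!: divide_pos_pos add_nonneg_pos)
    obtain g where g: "g \<in> fspan B" "ell2_norm V (\<lambda>x. (if x \<in> F then c x else 0) - g x) < \<epsilon> / 2"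
      using insert.IH[of "\<epsilon> / 2"] insert.prems by auto
    obtain k where k: "k \<in> fspan B" "ell2_norm V (\<lambda>x. (if x = v then 1 else 0) - k x) < \<epsilon> / (2 * (cmod (c v) + 1))"
      using approx[of v "\<epsilon> / (2 * (cmod (c v) + 1))"] insert.prems \<open>\<epsilon> / (2 * (cmod (c v) + 1)) > 0\<close> by auto
    have l1: "(\<lambda>x. (if x \<in> F then c x else 0) - g x) \<in> ell2 V"
      by (intro ell2_diff fspan_ell2[OF Bl g(1)] ell2_finite_support(1)[of F]) (use insert in auto)
    have l2: "(\<lambda>x. (if x = v then 1 else 0) - k x) \<in> ell2 V"
      by (intro ell2_diff fspan_ell2[OF Bl k(1)] ell2_finite_support(1)[of "{v}"]) (use insert in auto)
    have eq: "(\<lambda>x. (if x \<in> insert v F then c x else 0) - (g x + c v * k x))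
      = (\<lambda>x. ((if x \<in> F then c x else 0) - g x) + c v * ((if x = v then 1 else 0) - k x))"
      using insert.hyps by (auto simp: fun_eq_iff algebra_simps)
    have "ell2_norm V (\<lambda>x. (if x \<in> insert v F then c x else 0) - (g x + c v * k x))
      \<le> ell2_norm V (\<lambda>x. (if x \<in> F then c x else 0) - g x) + cmod (c v) * ell2_norm V (\<lambda>x. (if x = v then 1 else 0) - k x)"
      unfolding eq using ell2_add(2)[OF l1 ell2_scale(1)[OF l2]] ell2_scale(2)[OF l2] by simp
    also have "\<dots> < \<epsilon> / 2 + \<epsilon> / 2"
    proof (rule add_less_le_mono[OF g(2)])
      have "cmod (c v) * ell2_norm V (\<lambda>x. (if x = v then 1 else 0) - k x) \<le> (cmod (c v) + 1) * (\<epsilon> / (2 * (cmod (c v) + 1)))"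
        using k(2) ell2_norm_nonneg[OF l2] by (intro mult_mono) auto
      also have "\<dots> = \<epsilon> / 2"
        using add_nonneg_pos[OF norm_ge_zero[of "c v"] zero_less_one] by (simp add: field_simps)
      finally show "cmod (c v) * ell2_norm V (\<lambda>x. (if x = v then 1 else 0) - k x) \<le> \<epsilon> / 2" .
    qed
    finally have "ell2_norm V (\<lambda>x. (if x \<in> insert v F then c x else 0) - (g x + c v * k x)) < \<epsilon>" by simp
    thus ?case by (intro bexI[OF _ fspan_add[OF g(1) fspan_scale[OF k(1), of "c v"]]])
  qed
  have "\<exists>F c. finite F \<and> F \<subseteq> B \<and> ell2_norm V (\<lambda>x. f x - (\<Sum>b\<in>F. c b * b x)) < \<epsilon>"
    if f: "f \<in> ell2 V" and e: "\<epsilon> > 0" for f \<epsilon>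
  proof -
    obtain F where F: "finite F" "F \<subseteq> V" "ell2_norm V (\<lambda>x. f x - (if x \<in> F then f x else 0)) < \<epsilon> / 2"
      using ell2_tail_small[OF f, of "\<epsilon>/2"] e by auto
    obtain g where g: "g \<in> fspan B" "ell2_norm V (\<lambda>x. (if x \<in> F then f x else 0) - g x) < \<epsilon> / 2"
      using fin[OF F(1,2), of "\<epsilon>/2" f] e by auto
    have fF: "(\<lambda>x. if x \<in> F then f x else 0) \<in> ell2 V" using F by (intro ell2_finite_support(1)[of F]) auto
    have eq: "(\<lambda>x. f x - g x) = (\<lambda>x. (f x - (if x \<in> F then f x else 0)) + ((if x \<in> F then f x else 0) - g x))"
      by (auto simp: fun_eq_iff)
    have "ell2_norm V (\<lambda>x. f x - g x) < \<epsilon>"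
      unfolding eq using F(3) g(2) ell2_add(2)[OF ell2_diff(1)[OF f fF] ell2_diff(1)[OF fF fspan_ell2[OF Bl g(1)]]]
      by linarith
    thus ?thesis using g(1) by (auto simp: fspan_def)
  qed
  thus ?thesis using ons by (auto simp: complete_orthonormal_system_def)
qed


section \<open>Operators of finite range and their resolvents\<close>

text \<open>Operators of finite range.  They make sense on all functions and commute with pointwise limits,
  which is how norm bounds pass from a dense subspace to the whole space.\<close>

definition local_op :: "(('v \<Rightarrow> complex) \<Rightarrow> ('v \<Rightarrow> complex)) \<Rightarrow> bool" where
  "local_op A \<longleftrightarrow> (\<exists>N a. (\<forall>x. finite (N x)) \<and> (\<forall>f x. A f x = (\<Sum>y\<in>N x. a x y * f y)))"

lemma local_op_scale: "local_op A \<Longrightarrow> A (\<lambda>x. c * f x) = (\<lambda>x. c * A f x)"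
  by (auto simp: local_op_def sum_distrib_left fun_eq_iff mult_ac)

lemma local_op_add: "local_op A \<Longrightarrow> A (\<lambda>x. f x + g x) = (\<lambda>x. A f x + A g x)"
  by (auto simp: local_op_def sum.distrib fun_eq_iff distrib_left)

lemma local_op_diff: "local_op A \<Longrightarrow> A (\<lambda>x. f x - g x) = (\<lambda>x. A f x - A g x)"
  by (auto simp: local_op_def sum_subtractf fun_eq_iff right_diff_distrib)

lemma local_op_sum: "local_op A \<Longrightarrow> A (\<lambda>x. \<Sum>i\<in>I. f i x) = (\<lambda>x. \<Sum>i\<in>I. A (f i) x)"
proof -
  assume "local_op A"
  then obtain N a where A: "\<And>f x. A f x = (\<Sum>y\<in>N x. a x y * f y)" by (auto simp: local_op_def)
  show ?thesis unfolding A by (auto simp: fun_eq_iff sum_distrib_left intro: sum.swap)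
qed

lemma local_op_suminf:
  assumes "local_op A" "\<And>x. summable (\<lambda>n. F n x)"
  shows "A (\<lambda>x. \<Sum>n. F n x) = (\<lambda>x. \<Sum>n. A (F n) x)"
proof
  fix x
  obtain N a where A: "\<And>f x. A f x = (\<Sum>y\<in>N x. a x y * f y)" "\<And>x. finite (N x)"
    using assms by (auto simp: local_op_def)
  have "A (\<lambda>x. \<Sum>n. F n x) x = (\<Sum>y\<in>N x. \<Sum>n. a x y * F n y)"
    unfolding A(1) by (intro sum.cong refl suminf_mult[symmetric] assms)
  also have "\<dots> = (\<Sum>n. \<Sum>y\<in>N x. a x y * F n y)"
    by (rule suminf_sum[symmetric]) (intro summable_mult assms)
  finally show "A (\<lambda>x. \<Sum>n. F n x) x = (\<Sum>n. A (F n) x)" by (simp add: A(1))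
qed

lemma local_op_affine:
  assumes "local_op A"
  shows "local_op (\<lambda>f x. c * (A f x - w * f x))"
proof -
  obtain N a where A: "\<And>f x. A f x = (\<Sum>y\<in>N x. a x y * f y)" "\<And>x. finite (N x)"
    using assms by (auto simp: local_op_def)
  have "c * (A f x - w * f x) = (\<Sum>y\<in>insert x (N x). (c * ((if y \<in> N x then a x y else 0) - (if y = x then w else 0))) * f y)" for f x
  proof -
    have "(\<Sum>y\<in>N x. a x y * f y) = (\<Sum>y\<in>insert x (N x). (if y \<in> N x then a x y else 0) * f y)"
      using A(2) by (intro sum.mono_neutral_cong_left) auto
    moreover have "w * f x = (\<Sum>y\<in>insert x (N x). (if y = x then w else 0) * f y)"
    proof -
      have "(\<Sum>y\<in>insert x (N x). (if y = x then w else 0) * f y) = (\<Sum>y\<in>{x}. w * f y)"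
        using A(2) by (intro sum.mono_neutral_cong_right) auto
      thus ?thesis by simp
    qed
    ultimately show ?thesis
      unfolding A(1) by (simp add: sum_distrib_left sum_subtractf left_diff_distrib right_diff_distrib mult.assoc)
  qed
  thus ?thesis unfolding local_op_def using A(2)
    by (intro exI[of _ "\<lambda>x. insert x (N x)"] exI[of _ "\<lambda>x y. c * ((if y \<in> N x then a x y else 0) - (if y = x then w else 0))"]) auto
qed

text \<open>The resolvent is the pointwise sum of the powers of \<open>A\<close>; point evaluations are bounded by the norm,
  so the geometric bound on the powers gives convergence at every vertex, and the norm of the
  limit is controlled on finite sets.\<close>

lemma neumann_series:
  assumes loc: "local_op A"
    and bnd: "\<And>f. f \<in> ell2 V \<Longrightarrow> A f \<in> ell2 V \<and> ell2_norm V (A f) \<le> k * ell2_norm V f"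
    and k: "0 \<le> k" "k < 1"
  obtains R where "bounded_operator V R"
    "\<And>f. f \<in> ell2 V \<Longrightarrow> R (\<lambda>x. f x - A f x) = f \<and> (\<lambda>x. R f x - A (R f) x) = f"
proof -
  have pw: "(A ^^ n) f \<in> ell2 V \<and> ell2_norm V ((A ^^ n) f) \<le> k ^ n * ell2_norm V f" if "f \<in> ell2 V" for f n
  proof (induction n)
    case (Suc n)
    then show ?case using bnd[of "(A ^^ n) f"] k(1) mult_left_mono[of "ell2_norm V ((A ^^ n) f)" "k ^ n * ell2_norm V f" k]
      by (auto simp: mult.assoc)
  qed (use that in auto)
  have sumk: "summable (\<lambda>n. k ^ n * C)" for C
    using k by (intro summable_mult2 summable_geometric) auto
  have sm: "summable (\<lambda>n. (A ^^ n) f x)" if "f \<in> ell2 V" for f x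
    by (rule summable_comparison_test'[OF sumk[of "ell2_norm V f"], of 0])
       (meson cmod_le_ell2_norm pw[OF that] order_trans)
  define R where "R = (\<lambda>f x. \<Sum>n. (A ^^ n) f x)"
  have Rl: "R f \<in> ell2 V \<and> ell2_norm V (R f) \<le> 1 / (1 - k) * ell2_norm V f" if f: "f \<in> ell2 V" for f
  proof -
    have "L2_set (\<lambda>x. cmod (R f x)) F \<le> 1 / (1 - k) * ell2_norm V f" if F: "finite F" for F
    proof (rule LIMSEQ_le_const2)
      show "(\<lambda>m. L2_set (\<lambda>x. cmod (\<Sum>n<m. (A ^^ n) f x)) F) \<longlonglongrightarrow> L2_set (\<lambda>x. cmod (R f x)) F"
        unfolding L2_set_def R_def using sm[OF f]
        by (intro tendsto_intros summable_LIMSEQ)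
      have "L2_set (\<lambda>x. cmod (\<Sum>n<m. (A ^^ n) f x)) F \<le> 1 / (1 - k) * ell2_norm V f" for m
      proof -
        have s: "(\<lambda>x. \<Sum>n<m. (A ^^ n) f x) \<in> ell2 V"
          "ell2_norm V (\<lambda>x. \<Sum>n<m. (A ^^ n) f x) \<le> (\<Sum>n<m. ell2_norm V ((A ^^ n) f))"
          using ell2_sum[of "{..<m}" "\<lambda>n. (A ^^ n) f" V] pw[OF f] by auto
        have "L2_set (\<lambda>x. cmod (\<Sum>n<m. (A ^^ n) f x)) F \<le> (\<Sum>n<m. ell2_norm V ((A ^^ n) f))"
          using L2_set_le_ell2_norm[OF s(1) F] s(2) by linarith
        also have "\<dots> \<le> (\<Sum>n<m. k ^ n * ell2_norm V f)" using pw[OF f] by (intro sum_mono) auto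
        also have "\<dots> \<le> (\<Sum>n. k ^ n * ell2_norm V f)"
          using k ell2_norm_nonneg[OF f] by (intro sum_le_suminf sumk) auto
        also have "\<dots> = 1 / (1 - k) * ell2_norm V f"
          using k by (subst suminf_mult2[symmetric]) (auto simp: suminf_geometric)
        finally show ?thesis .
      qed
      thus "\<exists>N. \<forall>m\<ge>N. L2_set (\<lambda>x. cmod (\<Sum>n<m. (A ^^ n) f x)) F \<le> 1 / (1 - k) * ell2_norm V f" by blast
    qed
    moreover have "R f x = 0" if "x \<notin> V" for x
      using ell2_zero[OF conjunct1[OF pw[OF f]] that] by (simp add: R_def)
    ultimately show ?thesis using ell2_boundI[of V "R f"] by blast
  qed
  have pow_scale: "(A ^^ n) (\<lambda>x. c * f x) = (\<lambda>x. c * (A ^^ n) f x)" for n c f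
    by (induction n) (auto simp: local_op_scale[OF loc])
  have pow_add: "(A ^^ n) (\<lambda>x. f x + g x) = (\<lambda>x. (A ^^ n) f x + (A ^^ n) g x)" for n f g
    by (induction n) (auto simp: local_op_add[OF loc])
  have pow_diff: "(A ^^ n) (\<lambda>x. f x - g x) = (\<lambda>x. (A ^^ n) f x - (A ^^ n) g x)" for n f g
    by (induction n) (auto simp: local_op_diff[OF loc])
  have "bounded_operator V R"
    unfolding bounded_operator_def
  proof (intro conjI ballI allI)
    show "\<exists>C. \<forall>f\<in>ell2 V. ell2_norm V (R f) \<le> C * ell2_norm V f" using Rl by blast
  qed (use Rl sm in \<open>auto simp: R_def pow_scale pow_add suminf_add suminf_mult fun_eq_iff\<close>)
  moreover have "R (\<lambda>x. f x - A f x) = f \<and> (\<lambda>x. R f x - A (R f) x) = f" if f: "f \<in> ell2 V" for f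
  proof -
    have shift: "(\<Sum>n. (A ^^ Suc n) f x) = R f x - f x" for x
      using suminf_split_head[OF sm[OF f, of x]] by (simp add: R_def)
    have "R (\<lambda>x. f x - A f x) x = f x" for x
    proof -
      have "R (\<lambda>x. f x - A f x) x = (\<Sum>n. (A ^^ n) f x - (A ^^ Suc n) f x)"
        unfolding R_def pow_diff by (simp add: funpow_swap1)
      also have "\<dots> = (\<Sum>n. (A ^^ n) f x) - (\<Sum>n. (A ^^ Suc n) f x)"
        using sm[OF f, of x] summable_Suc_iff[of "\<lambda>n. (A ^^ n) f x"] by (intro suminf_diff[symmetric]) auto
      finally show ?thesis unfolding shift by (simp add: R_def)
    qed
    moreover have "A (R f) x = R f x - f x" for x
    proof -
      have "A (R f) x = (\<Sum>n. A ((A ^^ n) f) x)"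
        unfolding R_def by (subst local_op_suminf[OF loc sm[OF f]]) (rule refl)
      thus ?thesis using shift[of x] by simp
    qed
    ultimately show ?thesis by auto
  qed
  ultimately show ?thesis using that by blast
qed

section \<open>Operators with an orthonormal basis of finitely supported eigenvectors\<close>

locale eigenbasis =
  fixes V :: "'v set" and B :: "('v \<Rightarrow> complex) set" and A :: "('v \<Rightarrow> complex) \<Rightarrow> ('v \<Rightarrow> complex)"
    and \<mu> :: "('v \<Rightarrow> complex) \<Rightarrow> complex"
  assumes complete: "complete_orthonormal_system V B"
    and finite_support: "b \<in> B \<Longrightarrow> finite {x. b x \<noteq> 0}"
    and loc: "local_op A"
    and outside: "f \<in> ell2 V \<Longrightarrow> x \<notin> V \<Longrightarrow> A f x = 0"
    and eigen: "b \<in> B \<Longrightarrow> A b = (\<lambda>x. \<mu> b * b x)"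
begin

lemma B_ell2: "b \<in> B \<Longrightarrow> b \<in> ell2 V"
  and inner_B: "b \<in> B \<Longrightarrow> b' \<in> B \<Longrightarrow> ell2_inner V b b' = (if b = b' then 1 else 0)"
  using complete by (auto simp: complete_orthonormal_system_def orthonormal_system_def)

lemma support_subset: "b \<in> B \<Longrightarrow> {x. b x \<noteq> 0} \<subseteq> V"
  using ell2_zero[OF B_ell2] by blast

lemma common_support:
  assumes "finite F" "F \<subseteq> B"
  obtains X where "finite X" "X \<subseteq> V" "\<And>b x. b \<in> F \<Longrightarrow> x \<notin> X \<Longrightarrow> b x = 0"
proof (rule that[of "\<Union>b\<in>F. {x. b x \<noteq> 0}"])
  show "finite (\<Union>b\<in>F. {x. b x \<noteq> 0})" using assms finite_support by blast
  show "(\<Union>b\<in>F. {x. b x \<noteq> 0}) \<subseteq> V" using assms support_subset by blast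
qed auto

lemma norm_combination:
  assumes "finite F" "F \<subseteq> B"
  shows "(ell2_norm V (\<lambda>x. \<Sum>b\<in>F. c b * b x))\<^sup>2 = (\<Sum>b\<in>F. (cmod (c b))\<^sup>2)"
proof -
  obtain X where X: "finite X" "X \<subseteq> V" "\<And>b x. b \<in> F \<Longrightarrow> x \<notin> X \<Longrightarrow> b x = 0"
    using common_support[OF assms] by blast
  let ?g = "\<lambda>x. \<Sum>b\<in>F. c b * b x"
  have "ell2_norm V ?g = L2_set (\<lambda>x. cmod (?g x)) X"
    using X by (intro ell2_finite_support(2) sum.neutral) auto
  hence "complex_of_real ((ell2_norm V ?g)\<^sup>2) = (\<Sum>x\<in>X. ?g x * cnj (?g x))"
    by (simp add: L2_set_def sum_nonneg complex_norm_square del: cnj_sum of_real_power flip: of_real_power)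
  also have "\<dots> = (\<Sum>x\<in>X. \<Sum>b\<in>F. \<Sum>b'\<in>F. c b * cnj (c b') * (b x * cnj (b' x)))"
    by (simp add: sum_product mult_ac)
  also have "\<dots> = (\<Sum>b\<in>F. \<Sum>x\<in>X. \<Sum>b'\<in>F. c b * cnj (c b') * (b x * cnj (b' x)))" by (rule sum.swap)
  also have "\<dots> = (\<Sum>b\<in>F. \<Sum>b'\<in>F. c b * cnj (c b') * (\<Sum>x\<in>X. b x * cnj (b' x)))"
    by (subst sum.swap) (simp add: sum_distrib_left)
  also have "\<dots> = (\<Sum>b\<in>F. \<Sum>b'\<in>F. c b * cnj (c b') * (if b = b' then 1 else 0))"
  proof (intro sum.cong refl)
    fix b b' assume bb: "b \<in> F" "b' \<in> F"
    hence "b \<in> B" "b' \<in> B" using assms(2) by auto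
    thus "c b * cnj (c b') * (\<Sum>x\<in>X. b x * cnj (b' x)) = c b * cnj (c b') * (if b = b' then 1 else 0)"
      using inner_B[of b b'] bb ell2_inner_finite_support[of X V b' b] X by auto
  qed
  also have "\<dots> = (\<Sum>b\<in>F. \<Sum>b'\<in>F. if b = b' then c b * cnj (c b') else 0)"
    by (intro sum.cong refl) auto
  also have "\<dots> = (\<Sum>b\<in>F. c b * cnj (c b))" using assms(1) by (simp add: sum.delta')
  also have "\<dots> = complex_of_real (\<Sum>b\<in>F. (cmod (c b))\<^sup>2)"
    unfolding of_real_sum by (intro sum.cong refl) (rule complex_norm_square[symmetric])
  finally show ?thesis by (simp only: of_real_eq_iff)
qed

lemma A_combination:
  assumes "F \<subseteq> B"
  shows "A (\<lambda>x. \<Sum>b\<in>F. c b * b x) = (\<lambda>x. \<Sum>b\<in>F. (c b * \<mu> b) * b x)"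
proof -
  have "A (\<lambda>x. c b * b x) x = (c b * \<mu> b) * b x" if "b \<in> F" for b x
    using eigen[of b] that assms by (subst local_op_scale[OF loc]) auto
  thus ?thesis by (subst local_op_sum[OF loc]) (auto intro!: ext sum.cong)
qed

lemma combination_ell2: "F \<subseteq> B \<Longrightarrow> (\<lambda>x. \<Sum>b\<in>F. c b * b x) \<in> ell2 V"
  using ell2_sum[of F "\<lambda>b x. c b * b x" V] ell2_scale(1) B_ell2 by blast

lemma approx:
  assumes "f \<in> ell2 V" "\<epsilon> > 0"
  obtains F c where "finite F" "F \<subseteq> B" "ell2_norm V (\<lambda>x. f x - (\<Sum>b\<in>F. c b * b x)) < \<epsilon>"
  using complete assms unfolding complete_orthonormal_system_def by blast

text \<open>On the span of \<open>B\<close> the bound is Pythagoras.  For general \<open>f\<close> one restricts to a finite set \<open>X\<close>: there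
  finite range gives a crude constant \<open>M\<close> depending on \<open>X\<close>, which is harmless because it only
  multiplies the distance from \<open>f\<close> to the span.\<close>

lemma norm_bound:
  assumes mu: "\<And>b. b \<in> B \<Longrightarrow> cmod (\<mu> b) \<le> k" and k0: "k \<ge> 0" and f: "f \<in> ell2 V"
  shows "A f \<in> ell2 V" "ell2_norm V (A f) \<le> k * ell2_norm V f"
proof -
  obtain N a where A: "\<And>f x. A f x = (\<Sum>y\<in>N x. a x y * f y)" "\<And>x. finite (N x)"
    using loc by (auto simp: local_op_def)
  have le: "L2_set (\<lambda>x. cmod (A f x)) X \<le> k * ell2_norm V f" if X: "finite X" for X
  proof -
    define M where "M = L2_set (\<lambda>x. \<Sum>y\<in>N x. cmod (a x y)) X"
    have M0: "M \<ge> 0" by (simp add: M_def)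
    have main: "L2_set (\<lambda>x. cmod (A f x)) X \<le> k * ell2_norm V f + \<epsilon> * (k + M)" if e: "\<epsilon> > 0" for \<epsilon>
    proof -
      obtain F c where F: "finite F" "F \<subseteq> B" "ell2_norm V (\<lambda>x. f x - (\<Sum>b\<in>F. c b * b x)) < \<epsilon>"
        using approx[OF f e] by blast
      let ?g = "\<lambda>x. \<Sum>b\<in>F. c b * b x"
      let ?d = "\<lambda>x. f x - ?g x"
      have g: "?g \<in> ell2 V" by (rule combination_ell2[OF F(2)])
      have d: "?d \<in> ell2 V" by (rule ell2_diff(1)[OF f g])
      have Ag: "A ?g \<in> ell2 V" unfolding A_combination[OF F(2)] by (rule combination_ell2[OF F(2)])
      have "(ell2_norm V (A ?g))\<^sup>2 = (\<Sum>b\<in>F. (cmod (c b * \<mu> b))\<^sup>2)"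
        unfolding A_combination[OF F(2)] by (rule norm_combination[OF F(1,2)])
      also have "\<dots> \<le> (\<Sum>b\<in>F. k\<^sup>2 * (cmod (c b))\<^sup>2)"
        using mu F by (intro sum_mono)
          (auto simp: norm_mult power_mult_distrib mult.commute[of "k\<^sup>2"] intro!: mult_left_mono power_mono)
      also have "\<dots> = (k * ell2_norm V ?g)\<^sup>2"
        by (simp add: norm_combination[OF F(1,2)] power_mult_distrib sum_distrib_left)
      finally have Agn: "ell2_norm V (A ?g) \<le> k * ell2_norm V ?g"
        using k0 ell2_norm_nonneg[OF g] by (rule_tac power2_le_imp_le) auto
      have "ell2_norm V ?g \<le> ell2_norm V f + ell2_norm V ?d"
        using ell2_diff(2)[OF f d] by simp
      hence gn: "ell2_norm V ?g \<le> ell2_norm V f + \<epsilon>" using F(3) by linarith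
      have Ad: "A f x = A ?g x + A ?d x" for x
        using fun_cong[OF local_op_diff[OF loc, of f ?g], of x] by simp
      have "L2_set (\<lambda>x. cmod (A f x)) X \<le> L2_set (\<lambda>x. cmod (A ?g x) + cmod (A ?d x)) X"
        unfolding Ad by (intro L2_set_mono) (auto simp: norm_triangle_ineq)
      also have "\<dots> \<le> L2_set (\<lambda>x. cmod (A ?g x)) X + L2_set (\<lambda>x. cmod (A ?d x)) X"
        by (rule L2_set_triangle_ineq)
      also have "L2_set (\<lambda>x. cmod (A ?g x)) X \<le> k * ell2_norm V f + k * \<epsilon>"
        using L2_set_le_ell2_norm[OF Ag X] Agn mult_left_mono[OF gn k0] by (simp add: distrib_left)
      also have "L2_set (\<lambda>x. cmod (A ?d x)) X \<le> M * \<epsilon>"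
      proof -
        have "cmod (A ?d x) \<le> (\<Sum>y\<in>N x. cmod (a x y)) * \<epsilon>" for x
        proof -
          have "cmod (A ?d x) \<le> (\<Sum>y\<in>N x. cmod (a x y) * cmod (?d y))"
            unfolding A(1) by (rule order_trans[OF norm_sum]) (simp add: norm_mult)
          also have "\<dots> \<le> (\<Sum>y\<in>N x. cmod (a x y) * \<epsilon>)"
            using cmod_le_ell2_norm[OF d] F(3) by (intro sum_mono mult_left_mono) (auto intro: order_trans less_imp_le)
          finally show ?thesis by (simp add: sum_distrib_right)
        qed
        hence "L2_set (\<lambda>x. cmod (A ?d x)) X \<le> L2_set (\<lambda>x. (\<Sum>y\<in>N x. cmod (a x y)) * \<epsilon>) X"
          by (intro L2_set_mono) auto
        thus ?thesis using e by (simp add: M_def L2_set_left_distrib)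
      qed
      finally show ?thesis by (simp add: algebra_simps)
    qed
    show ?thesis
    proof (rule field_le_epsilon)
      fix e :: real assume e: "e > 0"
      have "e / (k + M + 1) * (k + M) \<le> e" using k0 M0 e by (simp add: field_simps)
      moreover have "e / (k + M + 1) > 0" using k0 M0 e by simp
      ultimately show "L2_set (\<lambda>x. cmod (A f x)) X \<le> k * ell2_norm V f + e"
        using main[of "e / (k + M + 1)"] by linarith
    qed
  qed
  show "A f \<in> ell2 V" "ell2_norm V (A f) \<le> k * ell2_norm V f"
    by (rule ell2_boundI[OF outside[OF f] le]; assumption)+
qed

text \<open>If \<open>f\<close> is orthogonal to \<open>B\<close>, subtracting a combination of \<open>B\<close> cannot decrease the norm, so \<open>f\<close> is
  approximable only if it is zero.\<close>

lemma basis_total: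
  assumes f: "f \<in> ell2 V" and orth: "\<And>b. b \<in> B \<Longrightarrow> ell2_inner V f b = 0"
  shows "f = (\<lambda>x. 0)"
proof (rule ccontr)
  assume "f \<noteq> (\<lambda>x. 0)"
  hence pos: "ell2_norm V f > 0" using ell2_norm_pos[OF f] by blast
  obtain F c where F: "finite F" "F \<subseteq> B" "ell2_norm V (\<lambda>x. f x - (\<Sum>b\<in>F. c b * b x)) < ell2_norm V f"
    using approx[OF f pos] by blast
  let ?g = "\<lambda>x. \<Sum>b\<in>F. c b * b x"
  have d: "(\<lambda>x. f x - ?g x) \<in> ell2 V" by (rule ell2_diff(1)[OF f combination_ell2[OF F(2)]])
  obtain X where X: "finite X" "X \<subseteq> V" "\<And>b x. b \<in> F \<Longrightarrow> x \<notin> X \<Longrightarrow> b x = 0"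
    using common_support[OF F(1,2)] by blast
  have "ell2_norm V f \<le> ell2_norm V (\<lambda>x. f x - ?g x)"
  proof (rule ell2_boundI(2)[OF ell2_zero[OF f]])
    fix Y assume Y: "finite Y" "Y \<subseteq> V"
    let ?Z = "X \<union> Y"
    have "(\<Sum>x\<in>?Z. f x * cnj (b x)) = 0" if "b \<in> F" for b
      using orth[of b] that F(2) ell2_inner_finite_support[of ?Z V b f] X Y by auto
    hence z: "(\<Sum>x\<in>?Z. f x * cnj (?g x)) = 0"
      by (simp add: sum_distrib_left mult.left_commute[of "f _"])
         (subst sum.swap, simp flip: sum_distrib_left)
    have e': "(cmod (u - v))\<^sup>2 = (cmod u)\<^sup>2 + (cmod v)\<^sup>2 - 2 * Re (u * cnj v)" for u v
      by (simp add: cmod_power2) (simp add: power2_eq_square algebra_simps)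
    note e = e'[of "f _" "?g _"]
    have "(\<Sum>x\<in>Y. (cmod (f x))\<^sup>2) \<le> (\<Sum>x\<in>?Z. (cmod (f x))\<^sup>2)"
      using X Y by (intro sum_mono2) auto
    also have "\<dots> \<le> (\<Sum>x\<in>?Z. (cmod (f x))\<^sup>2) + (\<Sum>x\<in>?Z. (cmod (?g x))\<^sup>2) - 2 * Re (\<Sum>x\<in>?Z. f x * cnj (?g x))"
      unfolding z by (simp add: sum_nonneg)
    also have "\<dots> = (\<Sum>x\<in>?Z. (cmod (f x - ?g x))\<^sup>2)"
      unfolding e Re_sum by (simp add: sum.distrib sum_subtractf sum_distrib_left)
    finally have "L2_set (\<lambda>x. cmod (f x)) Y \<le> L2_set (\<lambda>x. cmod (f x - ?g x)) ?Z"
      unfolding L2_set_def by (rule real_sqrt_le_mono)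
    also have "\<dots> \<le> ell2_norm V (\<lambda>x. f x - ?g x)" using X Y by (intro L2_set_le_ell2_norm[OF d]) auto
    finally show "L2_set (\<lambda>x. cmod (f x)) Y \<le> ell2_norm V (\<lambda>x. f x - ?g x)" .
  qed
  with F(3) show False by simp
qed

lemma basis_norm: "b \<in> B \<Longrightarrow> ell2_norm V b = 1"
  using norm_combination[of "{b}" "\<lambda>_. 1"] ell2_norm_nonneg[OF B_ell2, of b] by (auto simp: power2_eq_1_iff)

text \<open>The operator \<open>D = (A - w) / (z - w)\<close> is a strict contraction with the same eigenbasis, and
  \<open>A - z = - (z - w) * (1 - D)\<close>.\<close>

lemma not_in_spectrum:
  assumes mu: "\<And>b. b \<in> B \<Longrightarrow> cmod (\<mu> b - w) \<le> M" and M: "M \<ge> 0" "M < cmod (z - w)"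
  shows "z \<notin> op_spectrum V A"
proof -
  define D where "D = (\<lambda>f x. 1 / (z - w) * (A f x - w * f x))"
  have zw: "z - w \<noteq> 0" using M by auto
  interpret D: eigenbasis V B D "\<lambda>b. (\<mu> b - w) / (z - w)"
  proof
    show "local_op D" unfolding D_def by (rule local_op_affine[OF loc])
    show "D f x = 0" if "f \<in> ell2 V" "x \<notin> V" for f x
      using outside[OF that] ell2_zero[OF that] by (simp add: D_def)
  qed (use complete finite_support eigen zw in \<open>auto simp: D_def field_simps\<close>)
  have "cmod ((\<mu> b - w) / (z - w)) \<le> M / cmod (z - w)" if "b \<in> B" for b
    using mu[OF that] by (simp add: norm_divide divide_right_mono)
  from D.norm_bound[OF this] M
  have bd: "f \<in> ell2 V \<Longrightarrow> D f \<in> ell2 V \<and> ell2_norm V (D f) \<le> M / cmod (z - w) * ell2_norm V f" for f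
    by auto
  have M': "0 \<le> M / cmod (z - w)" "M / cmod (z - w) < 1" using M zw by (auto simp: divide_less_eq_1)
  obtain R where R: "bounded_operator V R"
    "\<And>f. f \<in> ell2 V \<Longrightarrow> R (\<lambda>x. f x - D f x) = f \<and> (\<lambda>x. R f x - D (R f) x) = f"
    using neumann_series[OF D.loc bd M'] by blast
  define u where "u = - 1 / (z - w)"
  have Az: "A f x - z * f x = (1 / u) * (f x - D f x)" for f x
    unfolding D_def u_def using zw by (simp add: field_simps)
  have u0: "u \<noteq> 0" using zw by (simp add: u_def)
  from R(1) have Rlin: "\<And>f. f \<in> ell2 V \<Longrightarrow> R f \<in> ell2 V"
    "\<And>f c. f \<in> ell2 V \<Longrightarrow> R (\<lambda>x. c * f x) = (\<lambda>x. c * R f x)"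
    "\<And>f g. f \<in> ell2 V \<Longrightarrow> g \<in> ell2 V \<Longrightarrow> R (\<lambda>x. f x + g x) = (\<lambda>x. R f x + R g x)"
    by (auto simp: bounded_operator_def)
  obtain C where C: "\<And>f. f \<in> ell2 V \<Longrightarrow> ell2_norm V (R f) \<le> C * ell2_norm V f"
    using R(1) unfolding bounded_operator_def by blast
  let ?R = "\<lambda>f x. u * R f x"
  have "bounded_operator V ?R"
    unfolding bounded_operator_def
  proof (intro conjI ballI allI)
    fix f g assume "f \<in> ell2 V" "g \<in> ell2 V"
    thus "(\<lambda>x. u * R (\<lambda>x. f x + g x) x) = (\<lambda>x. u * R f x + u * R g x)"
      using Rlin(3) by (simp add: distrib_left)
  next
    fix f c assume "f \<in> ell2 V"
    thus "(\<lambda>x. u * R (\<lambda>x. c * f x) x) = (\<lambda>x. c * (u * R f x))"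
      using Rlin(2) by (simp add: mult_ac)
  next
    show "\<exists>C. \<forall>f\<in>ell2 V. ell2_norm V (\<lambda>x. u * R f x) \<le> C * ell2_norm V f"
    proof (intro exI[of _ "cmod u * C"] ballI)
      fix f assume "f \<in> ell2 V"
      thus "ell2_norm V (\<lambda>x. u * R f x) \<le> cmod u * C * ell2_norm V f"
        using C ell2_scale(2)[OF Rlin(1)] by (simp add: mult.assoc mult_left_mono)
    qed
  qed (use Rlin(1) ell2_scale(1) in auto)
  moreover have "?R (\<lambda>x. A f x - z * f x) = f \<and> (\<lambda>x. A (?R f) x - z * ?R f x) = f" if f: "f \<in> ell2 V" for f
  proof
    have fD: "(\<lambda>x. f x - D f x) \<in> ell2 V" using ell2_diff(1)[OF f] bd[OF f] by blast
    show "?R (\<lambda>x. A f x - z * f x) = f"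
      unfolding Az Rlin(2)[OF fD] using R(2)[OF f] u0 by (simp add: fun_eq_iff)
    have "R f x - D (R f) x = f x" for x using R(2)[OF f] by (auto dest: fun_cong)
    moreover have "A (?R f) x - z * ?R f x = (1 / u) * (u * R f x - u * D (R f) x)" for x
      using Az[of "?R f" x] local_op_scale[OF D.loc, of u "R f"] by simp
    ultimately show "(\<lambda>x. A (?R f) x - z * ?R f x) = f"
      using u0 by (simp add: fun_eq_iff diff_divide_distrib)
  qed
  ultimately show ?thesis unfolding op_spectrum_def by blast
qed

text \<open>A bounded inverse of \<open>A - z\<close> with constant \<open>C\<close> would force every eigenvalue to have distance at
  least \<open>1 / C\<close> from \<open>z\<close>.\<close>

lemma closure_in_spectrum:
  assumes "z \<in> closure (\<mu> ` B)"
  shows "z \<in> op_spectrum V A"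
proof -
  have False if R: "bounded_operator V R" "\<forall>f\<in>ell2 V. R (\<lambda>x. A f x - z * f x) = f" for R
  proof -
    obtain C where C: "\<And>f. f \<in> ell2 V \<Longrightarrow> ell2_norm V (R f) \<le> C * ell2_norm V f"
      using R(1) unfolding bounded_operator_def by blast
    obtain b where b: "b \<in> B" "cmod (\<mu> b - z) < 1 / (\<bar>C\<bar> + 1)"
      using assms unfolding closure_approachable dist_norm
      by (metis (no_types, lifting) abs_ge_zero add_nonneg_pos image_iff zero_less_divide_1_iff zero_less_one)
    have "R (\<lambda>x. A b x - z * b x) = (\<lambda>x. (\<mu> b - z) * R b x)"
      using R(1) B_ell2[OF b(1)] by (simp add: eigen[OF b(1)] bounded_operator_def flip: left_diff_distrib)
    hence "b = (\<lambda>x. (\<mu> b - z) * R b x)" using R(2) B_ell2[OF b(1)] by simp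
    hence "1 = cmod (\<mu> b - z) * ell2_norm V (R b)"
      using ell2_scale(2)[of "R b" V "\<mu> b - z"] basis_norm[OF b(1)] R(1) B_ell2[OF b(1)]
      by (metis bounded_operator_def)
    also have "\<dots> \<le> cmod (\<mu> b - z) * \<bar>C\<bar>"
      using C[OF B_ell2[OF b(1)]] basis_norm[OF b(1)] by (intro mult_left_mono) auto
    also have "\<dots> \<le> 1 / (\<bar>C\<bar> + 1) * \<bar>C\<bar>" using b(2) by (intro mult_right_mono) auto
    also have "\<dots> < 1" by (simp add: field_simps)
    finally show False by simp
  qed
  thus ?thesis unfolding op_spectrum_def by blast
qed

text \<open>An eigenvector has a nonzero coefficient at some basis element, and symmetry shows that its
  eigenvalue agrees with the one there.\<close>

lemma eigenvalues:
  assumes sym: "\<And>f b. f \<in> ell2 V \<Longrightarrow> b \<in> B \<Longrightarrow> ell2_inner V (A f) b = ell2_inner V f (A b)"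
    and real: "\<And>b. b \<in> B \<Longrightarrow> cnj (\<mu> b) = \<mu> b"
  shows "op_eigenvalues V A = \<mu> ` B"
proof (intro equalityI subsetI)
  fix z assume "z \<in> op_eigenvalues V A"
  then obtain f where f: "f \<in> ell2 V" "f \<noteq> (\<lambda>x. 0)" "A f = (\<lambda>x. z * f x)" by (auto simp: op_eigenvalues_def)
  then obtain b where b: "b \<in> B" "ell2_inner V f b \<noteq> 0" using basis_total by blast
  have "z * ell2_inner V f b = ell2_inner V (A f) b"
    by (simp add: f(3) ell2_inner_def mult.assoc infsum_cmult_right')
  also have "\<dots> = \<mu> b * ell2_inner V f b"
    unfolding sym[OF f(1) b(1)] eigen[OF b(1)]
    by (simp add: ell2_inner_def real[OF b(1)] mult.left_commute infsum_cmult_right')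
  finally show "z \<in> \<mu> ` B" using b by simp
next
  fix z assume "z \<in> \<mu> ` B"
  then obtain b where b: "b \<in> B" "z = \<mu> b" by auto
  have "b \<noteq> (\<lambda>x. 0)" using basis_norm[OF b(1)] ell2_scale(2)[OF B_ell2[OF b(1)], of 0] by auto
  thus "z \<in> op_eigenvalues V A" using b eigen B_ell2 unfolding op_eigenvalues_def by blast
qed

end

section \<open>The discrete sine transform\<close>

text \<open>Multiplication by \<open>2 * sin (\<phi> / 2)\<close> makes the sum telescope.\<close>

lemma sum_cos_multiples:
  assumes "0 < l" "l < 2 * n"
  shows "(\<Sum>k=1..n-1. cos (real k * (real l / real n * pi))) = - (1 + (-1) ^ l) / 2"
proof -
  define \<phi> where "\<phi> = real l / real n * pi"
  have n: "n > 0" using assms by simp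
  have "0 < \<phi> / 2" "\<phi> / 2 < pi" using assms n by (auto simp: \<phi>_def field_simps)
  hence s: "sin (\<phi> / 2) > 0" by (intro sin_gt_zero)
  have step: "2 * sin (\<phi> / 2) * cos (real k * \<phi>) = sin ((real k + 1/2) * \<phi>) - sin ((real k - 1/2) * \<phi>)" for k
    by (simp add: sin_diff sin_add distrib_right left_diff_distrib)
  have tel: "2 * sin (\<phi> / 2) * (\<Sum>k=1..N. cos (real k * \<phi>)) = sin ((real N + 1/2) * \<phi>) - sin (\<phi> / 2)" for N
  proof (induction N)
    case (Suc N)
    have "2 * sin (\<phi> / 2) * (\<Sum>k=1..Suc N. cos (real k * \<phi>))
        = 2 * sin (\<phi> / 2) * (\<Sum>k=1..N. cos (real k * \<phi>)) + 2 * sin (\<phi> / 2) * cos (real (Suc N) * \<phi>)"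
      by (simp add: distrib_left)
    also have "2 * sin (\<phi> / 2) * cos (real (Suc N) * \<phi>) = sin ((real (Suc N) + 1/2) * \<phi>) - sin ((real N + 1/2) * \<phi>)"
      unfolding step by (simp add: algebra_simps)
    finally show ?case unfolding Suc by simp
  qed simp
  have "(real (n - 1) + 1/2) * \<phi> = real l * pi - \<phi> / 2"
    using n by (simp add: \<phi>_def of_nat_diff field_simps)
  hence "sin ((real (n - 1) + 1/2) * \<phi>) = - ((-1) ^ l * sin (\<phi> / 2))"
    by (simp add: sin_diff cos_npi)
  with tel[of "n - 1"] have "2 * sin (\<phi> / 2) * (\<Sum>k=1..n-1. cos (real k * \<phi>)) = - (1 + (-1) ^ l) * sin (\<phi> / 2)"
    by (simp add: algebra_simps)
  hence "(2 * (\<Sum>k=1..n-1. cos (real k * \<phi>))) * sin (\<phi> / 2) = (- (1 + (-1) ^ l)) * sin (\<phi> / 2)"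
    by (simp add: mult_ac)
  hence "2 * (\<Sum>k=1..n-1. cos (real k * \<phi>)) = - (1 + (-1) ^ l)" using s by simp
  thus ?thesis by (simp add: \<phi>_def)
qed

definition sine_coeff :: "nat \<Rightarrow> nat \<Rightarrow> nat \<Rightarrow> real" where
  "sine_coeff n m k = sqrt (2 / real n) * sin (real (k * m) / real n * pi)"

lemma sine_coeff_sym: "sine_coeff n m k = sine_coeff n k m"
  by (simp add: sine_coeff_def mult.commute)

text \<open>The product of two sines splits into cosines of the difference and of the sum of the angles.  As
  \<open>m - m'\<close> and \<open>m + m'\<close> have the same parity, the two cosine sums cancel unless \<open>m = m'\<close>.\<close>

lemma sine_coeff_orthonormal:
  assumes "1 \<le> m" "m < n" "1 \<le> m'" "m' < n"
  shows "(\<Sum>k=1..n-1. sine_coeff n m k * sine_coeff n m' k) = (if m = m' then 1 else 0)"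
  using assms
proof (induction m m' rule: linorder_wlog)
  case (le m' m)
  have n: "n > 0" using le by simp
  have prod: "sine_coeff n m k * sine_coeff n m' k
    = (cos (real k * (real (m - m') / real n * pi)) - cos (real k * (real (m + m') / real n * pi))) / real n" for k
  proof -
    let ?x = "real (k * m) / real n * pi" and ?y = "real (k * m') / real n * pi"
    have x: "?x - ?y = real k * (real (m - m') / real n * pi)" "?x + ?y = real k * (real (m + m') / real n * pi)"
      using le n by (auto simp: of_nat_diff field_simps)
    have gen: "(c * u) * (c * v) = (c * c) * (u * v)" for c u v :: real by (simp add: mult_ac)
    have "sine_coeff n m k * sine_coeff n m' k = (sqrt (2 / real n) * sqrt (2 / real n)) * (sin ?x * sin ?y)"
      unfolding sine_coeff_def by (rule gen)
    also have "sqrt (2 / real n) * sqrt (2 / real n) = 2 / real n" by simp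
    also have "sin ?x * sin ?y = (cos (?x - ?y) - cos (?x + ?y)) / 2" by (rule sin_times_sin)
    also have "(2 / real n) * ((u - v) / 2) = (u - v) / real n" for u v using n by (simp add: field_simps)
    finally show ?thesis unfolding x .
  qed
  have c2: "(\<Sum>k=1..n-1. cos (real k * (real (m + m') / real n * pi))) = - (1 + (-1) ^ (m + m')) / 2"
    by (rule sum_cos_multiples) (use le in auto)
  show ?case
  proof (cases "m = m'")
    case True
    have "(\<Sum>k=1..n-1. sine_coeff n m k * sine_coeff n m' k) = (real (n - 1) - (- (1 + (-1) ^ (m + m')) / 2)) / real n"
      unfolding prod sum_divide_distrib[symmetric] sum_subtractf c2 using True by simp
    also have "\<dots> = 1" using True n by (simp add: of_nat_diff flip: mult_2)
    finally show ?thesis using True by (simp add: mult.commute)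
  next
    case False
    have c1: "(\<Sum>k=1..n-1. cos (real k * (real (m - m') / real n * pi))) = - (1 + (-1) ^ (m - m')) / 2"
      by (rule sum_cos_multiples) (use le False in auto)
    have parent: "(-1::real) ^ (m - m') = (-1) ^ (m + m')"
    proof -
      have "m + m' = (m - m') + 2 * m'" using le by simp
      thus ?thesis by (simp only: power_add power_mult) simp
    qed
    have "(\<Sum>k=1..n-1. sine_coeff n m k * sine_coeff n m' k) = 0"
      unfolding prod sum_divide_distrib[symmetric] sum_subtractf c1 c2 parent by simp
    thus ?thesis using False by (simp add: mult.commute)
  qed
next
  case (sym m' m)
  have "(\<Sum>k=1..n-1. sine_coeff n m' k * sine_coeff n m k) = (\<Sum>k=1..n-1. sine_coeff n m k * sine_coeff n m' k)"
    by (rule sum.cong[OF refl mult.commute])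
  with sym show ?case by (cases "m = m'") simp_all
qed

lemma sine_coeff_0 [simp]: "sine_coeff n m 0 = 0"
  by (simp add: sine_coeff_def)

lemma sine_coeff_n [simp]: "sine_coeff n m n = 0"
  by (cases "n = 0") (simp_all add: sine_coeff_def)

lemma sine_coeff_recurrence:
  assumes "n > 0"
  shows "sine_coeff n m k + sine_coeff n m (Suc (Suc k)) = 2 * cos (real m / real n * pi) * sine_coeff n m (Suc k)"
proof -
  let ?t = "real m / real n * pi"
  have a: "real (k * m) / real n * pi = real (Suc k * m) / real n * pi - ?t"
    "real (Suc (Suc k) * m) / real n * pi = real (Suc k * m) / real n * pi + ?t"
    using assms by (simp_all add: field_simps)
  have "sin (x - ?t) + sin (x + ?t) = 2 * cos ?t * sin x" for x by (simp add: sin_add sin_diff)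
  hence "c * sin (x - ?t) + c * sin (x + ?t) = 2 * cos ?t * (c * sin x)" for c x :: real
    by (metis (no_types) distrib_left mult.left_commute)
  thus ?thesis unfolding sine_coeff_def a .
qed

text \<open>The sine vector is an eigenvector of the path with vertices \<open>1, \<dots>, n - 1\<close>.  The boundary values
  of \<open>F\<close> and of the sine at \<open>0\<close> and \<open>n\<close> all vanish, so shifting the index creates no boundary terms.\<close>

lemma sine_coeff_sum_by_parts:
  assumes n: "n > 0" and F: "F 0 = 0" "F n = 0"
  shows "(\<Sum>k=1..n-1. sine_coeff n m k * (F (Suc k) + F (k - 1)))
    = 2 * cos (real m / real n * pi) * (\<Sum>k=1..n-1. sine_coeff n m k * F k)"
proof -
  let ?s = "sine_coeff n m"
  have low: "(\<Sum>k=1..n-1. ?s k * g k) = (\<Sum>k<n. ?s k * g k)" for g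
    using n by (intro sum.mono_neutral_left) (auto simp: Suc_le_eq)
  have "(\<Sum>k<n. ?s k * F (Suc k)) = (\<Sum>k<Suc n. ?s (k - 1) * F k)"
    unfolding sum.lessThan_Suc_shift using F by simp
  hence up: "(\<Sum>k<n. ?s k * F (Suc k)) = (\<Sum>k<n. ?s (k - 1) * F k)" using F by simp
  have "(\<Sum>k<n. ?s (Suc k) * F k) = (\<Sum>k<Suc n. ?s k * F (k - 1))"
    unfolding sum.lessThan_Suc_shift by simp
  hence down: "(\<Sum>k<n. ?s k * F (k - 1)) = (\<Sum>k<n. ?s (Suc k) * F k)" by simp
  have rec: "(?s (k - 1) + ?s (Suc k)) * F k = 2 * cos (real m / real n * pi) * (?s k * F k)" for k
    using sine_coeff_recurrence[OF n, of m "k - 1"] F by (cases k) auto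
  have "(\<Sum>k<n. ?s k * (F (Suc k) + F (k - 1))) = (\<Sum>k<n. (?s (k - 1) + ?s (Suc k)) * F k)"
    by (simp only: distrib_left distrib_right sum.distrib up down)
  thus ?thesis unfolding low rec sum_distrib_left .
qed

section \<open>Orthonormality of the tetrahedron functions\<close>

locale diestel_leader = t1: end_tree T1 q + t2: end_tree T2 r
  for T1 :: "'a labelled_tree" and q :: nat and T2 :: "'b labelled_tree" and r :: nat
begin

abbreviation "V \<equiv> DL T1 T2"
abbreviation "P \<equiv> srw_op q r T1 T2"

text \<open>By \<open>tetra_level_fn_eq\<close> these are the level functions of a tetrahedron, with \<open>l = n - k\<close>.  As products
  they factor in sums over rectangles, which separates the two trees.\<close>

definition dl_haar :: "'a \<Rightarrow> 'b \<Rightarrow> nat \<Rightarrow> nat \<Rightarrow> nat \<Rightarrow> nat \<Rightarrow> 'a \<times> 'b \<Rightarrow> real" where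
  "dl_haar a1 a2 i j k l x = t1.tree_haar a1 i k (fst x) * t2.tree_haar a2 j l (snd x)"

lemma dl_haar_support:
  assumes "dl_haar a1 a2 i j k l x \<noteq> 0"
  shows "fst x \<in> t1.desc a1 k" "snd x \<in> t2.desc a2 l"
  using assms by (auto simp: dl_haar_def t1.tree_haar_def t2.tree_haar_def split: if_splits)

lemma dl_haar_DL:
  assumes "tetra_height T1 T2 a1 a2 (k + l)" "dl_haar a1 a2 i j k l x \<noteq> 0"
  shows "x \<in> V"
  using dl_haar_support[OF assms(2)] t1.busemann_funpow[of k "fst x"] t2.busemann_funpow[of l "snd x"] assms(1)
  by (auto simp: DL_def tetra_height_def)

lemma tetra_level_fn_eq:
  assumes "tetra_height T1 T2 a1 a2 n" "1 \<le> k" "k < n"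
  shows "tetra_level_fn q r T1 T2 a1 a2 n i j k x = dl_haar a1 a2 i j k (n - k) x"
proof -
  have eq: "level_fn q T1 a1 i k (fst x) * level_fn r T2 a2 j (n - k) (snd x) = dl_haar a1 a2 i j k (n - k) x"
    using assms by (simp add: dl_haar_def t1.level_fn_eq t2.level_fn_eq)
  have "x \<in> tetrahedron T1 T2 a1 a2" if nz: "dl_haar a1 a2 i j k (n - k) x \<noteq> 0"
  proof -
    have "x \<in> V" using dl_haar_DL[OF _ nz] assms by simp
    moreover have "tree_le T1 a1 (fst x)" "tree_le T2 a2 (snd x)"
      using dl_haar_support[OF nz] by (auto simp: t1.tree_le_iff t2.tree_le_iff)
    ultimately show ?thesis by (auto simp: tetrahedron_def case_prod_beta)
  qed
  thus ?thesis unfolding tetra_level_fn_def eq by auto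
qed

lemma tetra_fn_eq:
  assumes "tetra_height T1 T2 a1 a2 n"
  shows "tetra_fn q r T1 T2 a1 a2 n i j m x
    = complex_of_real (\<Sum>k=1..n-1. sine_coeff n m k * dl_haar a1 a2 i j k (n - k) x)"
  unfolding tetra_fn_def sine_coeff_def
  by (intro arg_cong[of _ _ complex_of_real] sum.cong refl arg_cong[of _ _ "\<lambda>z. _ * z"] tetra_level_fn_eq[OF assms]) auto

lemma tetra_fn_DL:
  assumes "tetra_height T1 T2 a1 a2 n" "tetra_fn q r T1 T2 a1 a2 n i j m x \<noteq> 0"
  shows "x \<in> V"
proof -
  have "(\<Sum>k=1..n-1. sine_coeff n m k * dl_haar a1 a2 i j k (n - k) x) \<noteq> 0"
    using assms(2) unfolding tetra_fn_eq[OF assms(1)] by (metis of_real_0)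
  then obtain k where k: "k \<in> {1..n-1}" "dl_haar a1 a2 i j k (n - k) x \<noteq> 0"
    by (metis (no_types, lifting) mult_zero_right sum.neutral)
  show ?thesis by (rule dl_haar_DL[OF _ k(2)]) (use assms(1) k(1) in auto)
qed

abbreviation "cone1 a n \<equiv> (\<Union>k\<in>{..n}. t1.desc a k)"
abbreviation "cone2 a n \<equiv> (\<Union>k\<in>{..n}. t2.desc a k)"

lemma finite_cones: "finite (cone1 a n)" "finite (cone2 b n)"
  using t1.finite_desc t2.finite_desc by blast+

lemma tetra_fn_support:
  assumes "tetra_height T1 T2 a1 a2 n"
  shows "{x. tetra_fn q r T1 T2 a1 a2 n i j m x \<noteq> 0} \<subseteq> cone1 a1 n \<times> cone2 a2 n"
proof
  fix x assume "x \<in> {x. tetra_fn q r T1 T2 a1 a2 n i j m x \<noteq> 0}"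
  hence "(\<Sum>k=1..n-1. sine_coeff n m k * dl_haar a1 a2 i j k (n - k) x) \<noteq> 0"
    unfolding tetra_fn_eq[OF assms(1)] mem_Collect_eq by (metis of_real_0)
  then obtain k where k: "k \<in> {1..n-1}" "dl_haar a1 a2 i j k (n - k) x \<noteq> 0"
    by (metis (no_types, lifting) mult_zero_right sum.neutral)
  have "fst x \<in> cone1 a1 n" using k(1) by (intro UN_I[of k] dl_haar_support(1)[OF k(2)]) auto
  moreover have "snd x \<in> cone2 a2 n" by (intro UN_I[of "n - k"] dl_haar_support(2)[OF k(2)]) auto
  ultimately
  show "x \<in> cone1 a1 n \<times> cone2 a2 n" unfolding mem_Times_iff ..
qed

lemma finite_tetra_fn_support:
  assumes "tetra_height T1 T2 a1 a2 n"
  shows "finite {x. tetra_fn q r T1 T2 a1 a2 n i j m x \<noteq> 0}"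
  by (rule finite_subset[OF tetra_fn_support[OF assms]]) (intro finite_cartesian_product finite_cones)

lemma dl_haar_orthonormal:
  assumes "finite X1" "finite X2"
    and "t1.desc a1 k \<subseteq> X1" "t1.desc b1 k' \<subseteq> X1" "t2.desc a2 l \<subseteq> X2" "t2.desc b2 l' \<subseteq> X2"
    and "i \<in> {1..q-1}" "i' \<in> {1..q-1}" "j \<in> {1..r-1}" "j' \<in> {1..r-1}"
    and "1 \<le> k" "1 \<le> l" "1 \<le> k'" "1 \<le> l'"
  shows "(\<Sum>x\<in>X1 \<times> X2. dl_haar a1 a2 i j k l x * dl_haar b1 b2 i' j' k' l' x)
    = (if a1 = b1 \<and> i = i' \<and> k = k' \<and> a2 = b2 \<and> j = j' \<and> l = l' then 1 else 0)"
proof -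
  have "(\<Sum>x\<in>X1 \<times> X2. dl_haar a1 a2 i j k l x * dl_haar b1 b2 i' j' k' l' x)
    = (\<Sum>x\<in>X1. t1.tree_haar a1 i k x * t1.tree_haar b1 i' k' x) * (\<Sum>x\<in>X2. t2.tree_haar a2 j l x * t2.tree_haar b2 j' l' x)"
    unfolding dl_haar_def sum_product sum.cartesian_product by (intro sum.cong) (auto simp: mult_ac)
  also have "(\<Sum>x\<in>X1. t1.tree_haar a1 i k x * t1.tree_haar b1 i' k' x) = (if a1 = b1 \<and> i = i' \<and> k = k' then 1 else 0)"
    by (rule t1.tree_haar_orthonormal[OF assms(1,3,4)]) (use assms(7-) t1.p2 in auto)
  also have "(\<Sum>x\<in>X2. t2.tree_haar a2 j l x * t2.tree_haar b2 j' l' x) = (if a2 = b2 \<and> j = j' \<and> l = l' then 1 else 0)"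
    by (rule t2.tree_haar_orthonormal[OF assms(2,5,6)]) (use assms(7-) t2.p2 in auto)
  finally show ?thesis by auto
qed

lemma tetra_fn_orthonormal:
  assumes a: "tetra_height T1 T2 a1 a2 n" and b: "tetra_height T1 T2 b1 b2 n'"
    and "i \<in> {1..q-1}" "i' \<in> {1..q-1}" "j \<in> {1..r-1}" "j' \<in> {1..r-1}"
    and m: "m \<in> {1..n-1}" "m' \<in> {1..n'-1}"
  shows "ell2_inner V (tetra_fn q r T1 T2 a1 a2 n i j m) (tetra_fn q r T1 T2 b1 b2 n' i' j' m')
    = (if a1 = b1 \<and> a2 = b2 \<and> n = n' \<and> i = i' \<and> j = j' \<and> m = m' then 1 else 0)"
proof -
  let ?g = "tetra_fn q r T1 T2 a1 a2 n i j m" and ?g' = "tetra_fn q r T1 T2 b1 b2 n' i' j' m'"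
  let ?h = "\<lambda>k. dl_haar a1 a2 i j k (n - k)" and ?h' = "\<lambda>k. dl_haar b1 b2 i' j' k (n' - k)"
  define X1 where "X1 = cone1 a1 n \<union> cone1 b1 n'"
  define X2 where "X2 = cone2 a2 n \<union> cone2 b2 n'"
  have fin: "finite X1" "finite X2" using finite_cones by (auto simp: X1_def X2_def)
  have "ell2_inner V ?g ?g' = (\<Sum>x\<in>(X1 \<times> X2) \<inter> V. ?g x * cnj (?g' x))"
  proof (rule ell2_inner_finite_support)
    have sub: "cone1 b1 n' \<times> cone2 b2 n' \<subseteq> X1 \<times> X2" unfolding X1_def X2_def by blast
    show "?g' x = 0" if "x \<notin> X1 \<times> X2 \<inter> V" for x
      using that tetra_fn_support[OF b, of i' j' m'] tetra_fn_DL[OF b, of i' j' m' x] sub by blast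
  qed (use fin in auto)
  also have "\<dots> = (\<Sum>x\<in>X1 \<times> X2. ?g x * cnj (?g' x))"
  proof (rule sum.mono_neutral_left)
    have "?g x = 0" if "x \<notin> V" for x using that tetra_fn_DL[OF a, of i j m x] by blast
    thus "\<forall>x\<in>X1 \<times> X2 - X1 \<times> X2 \<inter> V. ?g x * cnj (?g' x) = 0" by simp
  qed (use fin in auto)
  also have "\<dots> = complex_of_real (\<Sum>x\<in>X1 \<times> X2. \<Sum>k=1..n-1. \<Sum>k'=1..n'-1.
      sine_coeff n m k * sine_coeff n' m' k' * (?h k x * ?h' k' x))"
    unfolding tetra_fn_eq[OF a] tetra_fn_eq[OF b]
    by (simp only: complex_cnj_complex_of_real of_real_sum[symmetric] of_real_mult[symmetric] sum_product mult_ac)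
  also have "(\<Sum>x\<in>X1 \<times> X2. \<Sum>k=1..n-1. \<Sum>k'=1..n'-1. sine_coeff n m k * sine_coeff n' m' k' * (?h k x * ?h' k' x))
    = (\<Sum>k=1..n-1. \<Sum>k'=1..n'-1. sine_coeff n m k * sine_coeff n' m' k' * (\<Sum>x\<in>X1 \<times> X2. ?h k x * ?h' k' x))"
    by (subst sum.swap, rule sum.cong[OF refl], subst sum.swap, simp add: sum_distrib_left)
  also have "\<dots> = (\<Sum>k=1..n-1. \<Sum>k'=1..n'-1. sine_coeff n m k * sine_coeff n' m' k' *
      (if a1 = b1 \<and> i = i' \<and> k = k' \<and> a2 = b2 \<and> j = j' \<and> n - k = n' - k' then 1 else 0))"
  proof (intro sum.cong refl arg_cong[of _ _ "\<lambda>z. _ * z"])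
    fix k k' assume k: "k \<in> {1..n-1}" "k' \<in> {1..n'-1}"
    have "t1.desc a1 k \<subseteq> cone1 a1 n" "t2.desc a2 (n - k) \<subseteq> cone2 a2 n"
      "t1.desc b1 k' \<subseteq> cone1 b1 n'" "t2.desc b2 (n' - k') \<subseteq> cone2 b2 n'"
      using k by fastforce+
    with k assms(3-6) fin show "(\<Sum>x\<in>X1 \<times> X2. ?h k x * ?h' k' x)
      = (if a1 = b1 \<and> i = i' \<and> k = k' \<and> a2 = b2 \<and> j = j' \<and> n - k = n' - k' then 1 else 0)"
      unfolding X1_def X2_def by (intro dl_haar_orthonormal) auto
  qed
  also have "\<dots> = (if a1 = b1 \<and> a2 = b2 \<and> n = n' \<and> i = i' \<and> j = j' \<and> m = m' then 1 else 0)"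
  proof (cases "a1 = b1 \<and> a2 = b2 \<and> i = i' \<and> j = j'")
    case True
    hence n: "n' = n" using a b by (simp add: tetra_height_def)
    have "(\<Sum>k=1..n-1. \<Sum>k'=1..n'-1. sine_coeff n m k * sine_coeff n' m' k' *
      (if a1 = b1 \<and> i = i' \<and> k = k' \<and> a2 = b2 \<and> j = j' \<and> n - k = n' - k' then 1 else 0))
      = (\<Sum>k=1..n-1. \<Sum>k'=1..n-1. if k = k' then sine_coeff n m k * sine_coeff n m' k' else 0)"
      unfolding n using True by (intro sum.cong refl) auto
    also have "\<dots> = (\<Sum>k=1..n-1. sine_coeff n m k * sine_coeff n m' k)" by simp
    also have "\<dots> = (if m = m' then 1 else 0)" by (rule sine_coeff_orthonormal) (use m n in auto)
    finally show ?thesis using True n by auto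
  next
    case False
    thus ?thesis by (intro trans[OF sum.neutral]) auto
  qed
  finally show ?thesis by auto
qed

lemma tetra_basis_cases:
  assumes "g \<in> tetra_basis q r T1 T2"
  obtains a1 a2 n i j m where "g = tetra_fn q r T1 T2 a1 a2 n i j m" "n \<ge> 2" "tetra_height T1 T2 a1 a2 n"
    "m \<in> {1..n-1}" "i \<in> {1..q-1}" "j \<in> {1..r-1}"
  using assms unfolding tetra_basis_def by blast

text \<open>Since the basis is a set of functions, it must be seen that different parameters give different
  functions; this follows from the inner products themselves.\<close>

lemma tetra_basis_orthonormal: "orthonormal_system V (tetra_basis q r T1 T2)"
  unfolding orthonormal_system_def
proof (intro conjI subsetI ballI)
  fix g assume "g \<in> tetra_basis q r T1 T2"
  then obtain a1 a2 n i j m where g: "g = tetra_fn q r T1 T2 a1 a2 n i j m" "tetra_height T1 T2 a1 a2 n"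
    by (rule tetra_basis_cases)
  show "g \<in> ell2 V"
    using tetra_fn_DL[OF g(2)] finite_tetra_fn_support[OF g(2), of i j m] unfolding g(1)
    by (intro ell2_finite_support(1)[of "{x. tetra_fn q r T1 T2 a1 a2 n i j m x \<noteq> 0}"]) auto
next
  fix g g' assume gg: "g \<in> tetra_basis q r T1 T2" "g' \<in> tetra_basis q r T1 T2"
  obtain a1 a2 n i j m where g: "g = tetra_fn q r T1 T2 a1 a2 n i j m" "tetra_height T1 T2 a1 a2 n"
    "m \<in> {1..n-1}" "i \<in> {1..q-1}" "j \<in> {1..r-1}" using gg(1) by (rule tetra_basis_cases)
  obtain b1 b2 n' i' j' m' where g': "g' = tetra_fn q r T1 T2 b1 b2 n' i' j' m'" "tetra_height T1 T2 b1 b2 n'"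
    "m' \<in> {1..n'-1}" "i' \<in> {1..q-1}" "j' \<in> {1..r-1}" using gg(2) by (rule tetra_basis_cases)
  let ?c = "a1 = b1 \<and> a2 = b2 \<and> n = n' \<and> i = i' \<and> j = j' \<and> m = m'"
  have in1: "ell2_inner V g g' = (if ?c then 1 else 0)"
    unfolding g(1) g'(1) by (rule tetra_fn_orthonormal) (use g g' in auto)
  have in2: "ell2_inner V g g = 1"
    unfolding g(1) using tetra_fn_orthonormal[OF g(2) g(2) g(4) g(4) g(5) g(5) g(3) g(3)] by simp
  have "?c \<Longrightarrow> g = g'" using g(1) g'(1) by simp
  moreover have "g = g' \<Longrightarrow> ?c" using in1 in2 by (auto split: if_splits)
  ultimately have "?c \<longleftrightarrow> g = g'" by blast
  thus "ell2_inner V g g' = (if g = g' then 1 else 0)" unfolding in1 by simp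
qed

text \<open>The sine matrix is symmetric and orthogonal, hence its own inverse.\<close>

lemma dl_haar_in_span:
  assumes "tetra_height T1 T2 a1 a2 (k + l)" "1 \<le> k" "1 \<le> l" "i \<in> {1..q-1}" "j \<in> {1..r-1}"
  shows "(\<lambda>x. complex_of_real (dl_haar a1 a2 i j k l x)) \<in> fspan (tetra_basis q r T1 T2)"
proof -
  let ?n = "k + l"
  have "dl_haar a1 a2 i j k l x = (\<Sum>m=1..?n-1. sine_coeff ?n m k * (\<Sum>k'=1..?n-1. sine_coeff ?n m k' * dl_haar a1 a2 i j k' (?n - k') x))" for x
  proof -
    have "(\<Sum>m=1..?n-1. sine_coeff ?n m k * (\<Sum>k'=1..?n-1. sine_coeff ?n m k' * dl_haar a1 a2 i j k' (?n - k') x))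
      = (\<Sum>m=1..?n-1. \<Sum>k'=1..?n-1. (sine_coeff ?n k m * sine_coeff ?n k' m) * dl_haar a1 a2 i j k' (?n - k') x)"
      by (simp only: sum_distrib_left sine_coeff_sym[of ?n _ k] sine_coeff_sym[of ?n _ k'] mult.assoc)
         (intro sum.cong refl, simp add: sine_coeff_sym)
    also have "\<dots> = (\<Sum>k'=1..?n-1. (\<Sum>m=1..?n-1. sine_coeff ?n k m * sine_coeff ?n k' m) * dl_haar a1 a2 i j k' (?n - k') x)"
      by (subst sum.swap) (simp add: sum_distrib_right)
    also have "\<dots> = (\<Sum>k'=1..?n-1. (if k = k' then dl_haar a1 a2 i j k' (?n - k') x else 0))"
      using assms by (intro sum.cong refl) (subst sine_coeff_orthonormal, auto)
    also have "\<dots> = dl_haar a1 a2 i j k l x" using assms by (subst sum.delta') auto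
    finally show ?thesis by simp
  qed
  hence eq: "(\<lambda>x. complex_of_real (dl_haar a1 a2 i j k l x))
    = (\<lambda>x. \<Sum>m=1..?n-1. complex_of_real (sine_coeff ?n m k) * tetra_fn q r T1 T2 a1 a2 ?n i j m x)"
    unfolding tetra_fn_eq[OF assms(1)] by (simp only: of_real_sum[symmetric] of_real_mult[symmetric])
  have "tetra_fn q r T1 T2 a1 a2 ?n i j m \<in> tetra_basis q r T1 T2" if "m \<in> {1..?n-1}" for m
    unfolding tetra_basis_def using assms that
    by (intro CollectI exI[of _ a1] exI[of _ a2] exI[of _ ?n] exI[of _ i] exI[of _ j] exI[of _ m]) auto
  thus ?thesis unfolding eq by (intro fspan_sum fspan_scale fspan_base)
qed

end

section \<open>The segment: density of the eigenvalues and separating discs\<close>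

text \<open>The points \<open>m / n\<close> are the rationals strictly between \<open>0\<close> and \<open>1\<close>, dense in the unit interval, and
  \<open>\<lambda>t. \<rho> * cos (t * pi)\<close> maps that interval onto \<open>{-\<rho>..\<rho>}\<close>.\<close>

lemma cos_rationals_dense:
  assumes "\<rho> \<ge> 0"
  shows "closure {complex_of_real (\<rho> * cos (real m / real n * pi)) | m n. n \<ge> 2 \<and> 1 \<le> m \<and> m \<le> n - 1}
    = complex_of_real ` {-\<rho>..\<rho>}" (is "closure ?E = ?I")
proof (rule antisym)
  have "compact ?I" by (intro compact_continuous_image continuous_intros compact_Icc)
  hence "closed ?I" by (rule compact_imp_closed)
  moreover have "?E \<subseteq> ?I"
  proof
    fix z assume "z \<in> ?E"
    then obtain m n where z: "z = complex_of_real (\<rho> * cos (real m / real n * pi))" by blast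
    have "\<bar>\<rho> * cos (real m / real n * pi)\<bar> \<le> \<rho> * 1"
      unfolding abs_mult using assms by (intro mult_mono) auto
    thus "z \<in> ?I" unfolding z by (intro imageI) auto
  qed
  ultimately show "closure ?E \<subseteq> ?I" by (rule closure_minimal[rotated])
next
  define f where "f = (\<lambda>t::real. complex_of_real (\<rho> * cos (t * pi)))"
  define Q where "Q = {real m / real n | m n. n \<ge> 2 \<and> 1 \<le> m \<and> m \<le> n - 1}"
  have "{0<..<1} \<subseteq> closure Q"
  proof
    fix t :: real assume t: "t \<in> {0<..<1}"
    show "t \<in> closure Q" unfolding closure_approachable
    proof (intro allI impI)
      fix e :: real assume e: "e > 0"
      have "max 0 (t - e) < min 1 (t + e)" "0 \<le> max 0 (t - e)" using t e by auto
      then obtain x where x: "x \<in> \<rat>" "max 0 (t - e) < x" "x < min 1 (t + e)" using Rats_dense_in_real by blast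
      then obtain m n where mn: "n \<noteq> 0" "\<bar>x\<bar> = real m / real n" using Rats_abs_nat_div_natE by metis
      have x': "x = real m / real n" using mn x by simp
      have "0 < real m / real n" "real m / real n < 1" using x x' by auto
      hence "0 < m" "m < n" using mn(1) by (auto simp: field_simps)
      hence "x \<in> Q" unfolding Q_def x' by (intro CollectI exI[of _ m] exI[of _ n]) auto
      thus "\<exists>y\<in>Q. dist y t < e" using x by (intro bexI[of _ x]) (auto simp: dist_real_def)
    qed
  qed
  hence "closure {0<..<1} \<subseteq> closure Q" by (metis closure_closure closure_mono)
  hence Q: "{0..1} \<subseteq> closure Q" by simp
  have "f ` Q = {f (real m / real n) | m n. n \<ge> 2 \<and> 1 \<le> m \<and> m \<le> n - 1}" unfolding Q_def by blast
  hence fQ: "f ` Q = ?E" unfolding f_def .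
  have "continuous_on (closure Q) f" unfolding f_def by (intro continuous_intros)
  hence "f ` closure Q \<subseteq> closure (f ` Q)"
    by (rule image_closure_subset) (rule closed_closure, rule closure_subset)
  hence fQ': "f ` {0..1} \<subseteq> closure ?E" unfolding fQ using Q by (meson image_mono order_trans)
  show "?I \<subseteq> closure ?E"
  proof
    fix z assume "z \<in> ?I"
    then obtain x where x: "z = complex_of_real x" "-\<rho> \<le> x" "x \<le> \<rho>" by auto
    have "\<exists>t\<in>{0..1}. \<rho> * cos (t * pi) = x"
    proof (cases "\<rho> = 0")
      case True
      thus ?thesis using x by (intro bexI[of _ 0]) auto
    next
      case False
      hence p: "-1 \<le> x / \<rho>" "x / \<rho> \<le> 1" using x assms by (auto simp: field_simps)
      have "arccos (x / \<rho>) / pi \<in> {0..1}" using arccos_lbound[OF p] arccos_ubound[OF p] by auto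
      moreover have "\<rho> * cos (arccos (x / \<rho>) / pi * pi) = x" using cos_arccos[OF p] False by simp
      ultimately show ?thesis by blast
    qed
    thus "z \<in> closure ?E" using fQ' x(1) by (auto simp: f_def)
  qed
qed

text \<open>For a point on the real axis the disc around \<open>0\<close> through the end points of the segment works.
  For other points the centre \<open>w\<close> is moved far along the imaginary axis, to the side opposite to
  \<open>z\<close>.\<close>

lemma separating_disc:
  assumes "z \<notin> complex_of_real ` {-\<rho>..\<rho>}" "\<rho> \<ge> 0"
  obtains w M where "\<And>t. t \<in> {-\<rho>..\<rho>} \<Longrightarrow> cmod (complex_of_real t - w) \<le> M" "0 \<le> M" "M < cmod (z - w)"
proof (cases "Im z = 0")
  case True
  hence z: "z = complex_of_real (Re z)" by (simp add: complex_eq_iff)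
  hence "Re z \<notin> {-\<rho>..\<rho>}" using assms(1) by (metis imageI)
  hence "\<bar>Re z\<bar> > \<rho>" by auto
  moreover have "cmod z = \<bar>Re z\<bar>" by (subst z) (simp only: norm_of_real)
  ultimately show ?thesis by (intro that[of 0 \<rho>]) (use assms(2) in auto)
next
  case False
  define y where "y = \<bar>Im z\<bar>"
  \<comment> \<open>Any shift with \<open>2 * s * y + y^2 > \<rho>^2\<close> separates.\<close>
  define s where "s = \<rho>\<^sup>2 / y"
  define w where "w = Complex 0 (- sgn (Im z) * s)"
  have y: "y > 0" "s \<ge> 0" "s * y = \<rho>\<^sup>2" using False by (auto simp: y_def s_def)
  have sg: "(sgn (Im z))\<^sup>2 = 1" using False by (auto simp: sgn_real_def)
  show ?thesis
  proof (rule that[of w "sqrt (\<rho>\<^sup>2 + s\<^sup>2)"])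
    fix t assume t: "t \<in> {-\<rho>..\<rho>}"
    hence "t\<^sup>2 \<le> \<rho>\<^sup>2" by (intro power2_le_iff_abs_le[THEN iffD2]) (use assms in auto)
    thus "cmod (complex_of_real t - w) \<le> sqrt (\<rho>\<^sup>2 + s\<^sup>2)"
      unfolding cmod_def w_def using sg by (intro real_sqrt_le_mono) (simp add: power_mult_distrib)
  next
    have im: "Im (z - w) = sgn (Im z) * (y + s)"
      using False by (auto simp: w_def y_def sgn_real_def)
    have "(y + s)\<^sup>2 = y\<^sup>2 + 2 * \<rho>\<^sup>2 + s\<^sup>2" using y(3) by (simp add: power2_sum algebra_simps)
    hence "\<rho>\<^sup>2 + s\<^sup>2 < (y + s)\<^sup>2" using zero_less_power[OF y(1), of 2] zero_le_power2[of \<rho>] by linarith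
    also have "\<dots> = (Im (z - w))\<^sup>2" unfolding im by (simp add: power_mult_distrib sg)
    finally have "sqrt (\<rho>\<^sup>2 + s\<^sup>2) < \<bar>Im (z - w)\<bar>" by (metis real_sqrt_abs real_sqrt_less_iff)
    thus "sqrt (\<rho>\<^sup>2 + s\<^sup>2) < cmod (z - w)" using abs_Im_le_cmod order_less_le_trans by blast
  qed simp
qed

section \<open>The eigenvalue equation\<close>

context diestel_leader begin

text \<open>Steps to the parent in both coordinates, or to a child in both, would change the sum of the
  Busemann functions by two.\<close>

lemma neighbours:
  assumes "(x1, x2) \<in> V"
  shows "{y. DL_adj T1 T2 (x1, x2) y} = (\<lambda>c. (t1.parent x1, c)) ` t2.children x2 \<union> (\<lambda>c. (c, t2.parent x2)) ` t1.children x1"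
proof -
  have "DL_adj T1 T2 (x1, x2) (y1, y2) \<longleftrightarrow> (y1 = t1.parent x1 \<and> t2.parent y2 = x2) \<or> (t1.parent y1 = x1 \<and> y2 = t2.parent x2)" for y1 y2
    using assms t1.busemann_par[of x1] t1.busemann_par[of y1] t2.busemann_par[of x2] t2.busemann_par[of y2]
    by (auto simp: DL_adj_def DL_def t1.adj_iff t2.adj_iff)
  thus ?thesis by auto
qed

lemma sum_neighbours:
  assumes "(x1, x2) \<in> V"
  shows "(\<Sum>y | DL_adj T1 T2 (x1, x2) y. f y)
    = (\<Sum>c\<in>t2.children x2. f (t1.parent x1, c)) + (\<Sum>c\<in>t1.children x1. f (c, t2.parent x2))"
proof -
  have "(\<Sum>y | DL_adj T1 T2 (x1, x2) y. f y)
    = sum f ((\<lambda>c. (t1.parent x1, c)) ` t2.children x2) + sum f ((\<lambda>c. (c, t2.parent x2)) ` t1.children x1)"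
    unfolding neighbours[OF assms]
    by (rule sum.union_disjoint) (auto simp: t1.finite_ch t2.finite_ch t1.par_par_neq)
  thus ?thesis by (simp add: sum.reindex inj_on_def)
qed

lemma finite_neighbours: "finite {y. DL_adj T1 T2 x y}"
proof (cases "x \<in> V")
  case True
  then show ?thesis using neighbours[of "fst x" "snd x"] t1.finite_ch t2.finite_ch by simp
next
  case False
  then show ?thesis by (simp add: DL_adj_def)
qed

lemma dl_haar_0 [simp]: "dl_haar a1 a2 i j 0 l x = 0" "dl_haar a1 a2 i j k 0 x = 0"
  by (simp_all add: dl_haar_def)

text \<open>A neighbour lies one generation further below one apex and one generation closer to the other.  At
  the border one of the two terms is zero because a Haar function of generation \<open>0\<close> is.\<close>

lemma sum_neighbours_dl_haar:
  assumes "x \<in> V" "1 \<le> k" "1 \<le> l" "i \<in> {1..q-1}" "j \<in> {1..r-1}"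
  shows "(\<Sum>y | DL_adj T1 T2 x y. dl_haar a1 a2 i j k l y)
    = sqrt (real (q * r)) * (dl_haar a1 a2 i j (Suc k) (l - 1) x + dl_haar a1 a2 i j (k - 1) (Suc l) x)"
proof -
  obtain x1 x2 where x: "x = (x1, x2)" by (cases x)
  have ij: "1 \<le> i" "i < q" "1 \<le> j" "j < r" using assms t1.p2 t2.p2 by auto
  have "(\<Sum>y | DL_adj T1 T2 x y. dl_haar a1 a2 i j k l y)
    = t1.tree_haar a1 i k (t1.parent x1) * (\<Sum>c\<in>t2.children x2. t2.tree_haar a2 j l c) + (\<Sum>c\<in>t1.children x1. t1.tree_haar a1 i k c) * t2.tree_haar a2 j l (t2.parent x2)"
    unfolding x sum_neighbours[OF assms(1)[unfolded x]] dl_haar_def by (simp add: sum_distrib_left sum_distrib_right)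
  also have "\<dots> = sqrt q * sqrt r * (t1.tree_haar a1 i (Suc k) x1 * t2.tree_haar a2 j (l - 1) x2 + t1.tree_haar a1 i (k - 1) x1 * t2.tree_haar a2 j (Suc l) x2)"
    unfolding t1.tree_haar_par[OF assms(2)] t2.tree_haar_par[OF assms(3)]
      t1.sum_tree_haar_children[OF assms(2) ij(1,2)] t2.sum_tree_haar_children[OF assms(3) ij(3,4)]
    by (simp add: algebra_simps)
  finally show ?thesis by (simp add: dl_haar_def x real_sqrt_mult)
qed

lemma tetra_fn_eigen:
  assumes "n \<ge> 2" "tetra_height T1 T2 a1 a2 n" "i \<in> {1..q-1}" "j \<in> {1..r-1}"
  shows "P (tetra_fn q r T1 T2 a1 a2 n i j m)
    = (\<lambda>x. complex_of_real (dl_eigenvalue q r m n) * tetra_fn q r T1 T2 a1 a2 n i j m x)"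
proof
  fix x
  let ?g = "tetra_fn q r T1 T2 a1 a2 n i j m"
  show "P ?g x = complex_of_real (dl_eigenvalue q r m n) * ?g x"
  proof (cases "x \<in> V")
    case False
    hence "?g x = 0" using tetra_fn_DL[OF assms(2)] by blast
    thus ?thesis using False by (simp add: srw_op_def DL_adj_def)
  next
    case True
    define F where "F = (\<lambda>k. dl_haar a1 a2 i j k (n - k))"
    define S where "S = (\<Sum>k=1..n-1. sine_coeff n m k * F k x)"
    have "(\<Sum>y | DL_adj T1 T2 x y. \<Sum>k=1..n-1. sine_coeff n m k * F k y)
      = (\<Sum>k=1..n-1. sine_coeff n m k * (\<Sum>y | DL_adj T1 T2 x y. F k y))"
      by (subst sum.swap) (simp add: sum_distrib_left)
    also have "\<dots> = (\<Sum>k=1..n-1. sine_coeff n m k * (sqrt (real (q * r)) * (F (Suc k) x + F (k - 1) x)))"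
    proof (intro sum.cong refl arg_cong[of _ _ "\<lambda>z. _ * z"])
      fix k assume k: "k \<in> {1..n-1}"
      hence "n - k - 1 = n - Suc k" "Suc (n - k) = n - (k - 1)" by auto
      thus "(\<Sum>y | DL_adj T1 T2 x y. F k y) = sqrt (real (q * r)) * (F (Suc k) x + F (k - 1) x)"
        unfolding F_def using sum_neighbours_dl_haar[OF True, of k "n - k" i j a1 a2] k assms by auto
    qed
    also have "\<dots> = sqrt (real (q * r)) * (\<Sum>k=1..n-1. sine_coeff n m k * (F (Suc k) x + F (k - 1) x))"
      by (simp add: sum_distrib_left mult.left_commute)
    also have "(\<Sum>k=1..n-1. sine_coeff n m k * (F (Suc k) x + F (k - 1) x)) = 2 * cos (real m / real n * pi) * S"
      unfolding S_def by (rule sine_coeff_sum_by_parts) (use assms(1) in \<open>auto simp: F_def\<close>)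
    finally have sum: "(\<Sum>y | DL_adj T1 T2 x y. \<Sum>k=1..n-1. sine_coeff n m k * F k y)
      = sqrt (real (q * r)) * (2 * cos (real m / real n * pi) * S)" .
    have "P ?g x = complex_of_real (1 / real (q + r) * (\<Sum>y | DL_adj T1 T2 x y. \<Sum>k=1..n-1. sine_coeff n m k * F k y))"
      unfolding srw_op_def tetra_fn_eq[OF assms(2)] F_def by (simp only: of_real_sum of_real_mult of_real_divide of_real_1 of_real_of_nat_eq)
    also have "1 / real (q + r) * (\<Sum>y | DL_adj T1 T2 x y. \<Sum>k=1..n-1. sine_coeff n m k * F k y) = dl_eigenvalue q r m n * S"
      unfolding sum by (simp add: dl_eigenvalue_def rho_def)
    finally show ?thesis unfolding tetra_fn_eq[OF assms(2)] S_def F_def by simp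
  qed
qed

section \<open>Completeness\<close>

lemma product_L2_bound:
  assumes "finite Y" "\<And>X. finite X \<Longrightarrow> (\<Sum>x\<in>X. (u x)\<^sup>2) \<le> A" "\<And>X. finite X \<Longrightarrow> (\<Sum>x\<in>X. (v x)\<^sup>2) \<le> B"
  shows "L2_set (\<lambda>y. \<bar>u (fst y) * v (snd y)\<bar>) Y \<le> sqrt (A * B)"
proof -
  have "(\<Sum>y\<in>Y. \<bar>u (fst y) * v (snd y)\<bar>\<^sup>2) \<le> (\<Sum>y\<in>fst ` Y \<times> snd ` Y. \<bar>u (fst y) * v (snd y)\<bar>\<^sup>2)"
    using assms(1) by (intro sum_mono2) (auto simp: image_iff, force+)
  also have "\<dots> = (\<Sum>x\<in>fst ` Y. (u x)\<^sup>2) * (\<Sum>x\<in>snd ` Y. (v x)\<^sup>2)"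
    unfolding sum_product sum.cartesian_product by (intro sum.cong) (auto simp: power_mult_distrib)
  also have "\<dots> \<le> A * B"
    using assms(2)[of "{}"] assms(1) by (intro mult_mono assms(2,3)) (auto intro: sum_nonneg)
  finally show ?thesis unfolding L2_set_def by (rule real_sqrt_le_mono)
qed

text \<open>With \<open>d\<close> for point masses and \<open>e\<close> for cell densities, \<open>d - e\<close> lies in the span of the Haar functions
  in each tree.  The error \<open>d1 d2 - (d1 - e1) (d2 - e2)\<close> consists of three products, each with a
  factor \<open>e\<close> of norm at most \<open>2 powr (- K / 2)\<close>.\<close>

lemma delta_approximation:
  assumes v: "v \<in> V"
  obtains g where "g \<in> fspan (tetra_basis q r T1 T2)"
    "ell2_norm V (\<lambda>x. (if x = v then 1 else 0) - g x) \<le> 3 * sqrt (1 / 2 ^ K)"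
proof -
  obtain x1 x2 where v_eq: "v = (x1, x2)" by (cases v)
  have vV: "(x1, x2) \<in> V" using v v_eq by simp
  define G where "G = (\<lambda>y. \<Sum>k=1..K. \<Sum>i=1..q-1. \<Sum>l=1..K. \<Sum>j=1..r-1.
     complex_of_real (t1.tree_haar ((t1.parent ^^ k) x1) i k x1 * t2.tree_haar ((t2.parent ^^ l) x2) j l x2)
       * complex_of_real (dl_haar ((t1.parent ^^ k) x1) ((t2.parent ^^ l) x2) i j k l y))"
  have GB: "G \<in> fspan (tetra_basis q r T1 T2)"
    unfolding G_def
  proof (intro fspan_sum fspan_scale dl_haar_in_span)
    fix k l show "tetra_height T1 T2 ((t1.parent ^^ k) x1) ((t2.parent ^^ l) x2) (k + l)"
      using vV by (auto simp: tetra_height_def t1.busemann_funpow t2.busemann_funpow DL_def)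
  qed auto
  define d1 where "d1 = (\<lambda>y. if y = x1 then 1 else 0 :: real)"
  define d2 where "d2 = (\<lambda>y. if y = x2 then 1 else 0 :: real)"
  define e1 where "e1 = t1.cell x1 K"
  define e2 where "e2 = t2.cell x2 K"
  have G_eq: "G y = complex_of_real ((d1 (fst y) - e1 (fst y)) * (d2 (snd y) - e2 (snd y)))" for y
  proof -
    have a: "d1 (fst y) - e1 (fst y) = (\<Sum>k=1..K. \<Sum>i=1..q-1. t1.tree_haar ((t1.parent ^^ k) x1) i k x1 * t1.tree_haar ((t1.parent ^^ k) x1) i k (fst y))"
      using t1.cell_telescope[of "fst y" x1 K] by (simp add: d1_def e1_def)
    have b: "d2 (snd y) - e2 (snd y) = (\<Sum>l=1..K. \<Sum>j=1..r-1. t2.tree_haar ((t2.parent ^^ l) x2) j l x2 * t2.tree_haar ((t2.parent ^^ l) x2) j l (snd y))"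
      using t2.cell_telescope[of "snd y" x2 K] by (simp add: d2_def e2_def)
    show ?thesis
      unfolding a b G_def dl_haar_def sum_distrib_right
      unfolding sum_distrib_left of_real_sum
      by (intro sum.cong refl) simp
  qed
  have err: "(if y = v then 1 else 0) - G y = complex_of_real
      (e1 (fst y) * d2 (snd y) + d1 (fst y) * e2 (snd y) - e1 (fst y) * e2 (snd y))" for y
  proof -
    have "(if y = v then 1 else 0 :: complex) = complex_of_real (d1 (fst y) * d2 (snd y))"
      by (cases y) (auto simp: v_eq d1_def d2_def)
    thus ?thesis unfolding G_eq by (simp add: algebra_simps)
  qed
  have d_le: "(\<Sum>x\<in>X. (d1 x)\<^sup>2) \<le> 1" "(\<Sum>x\<in>X'. (d2 x)\<^sup>2) \<le> 1" if "finite X" "finite X'" for X X'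
    using that by (auto simp: d1_def d2_def if_distrib[of "\<lambda>z. z\<^sup>2"] cong: if_cong)
  have e1_le: "(\<Sum>x\<in>X. (e1 x)\<^sup>2) \<le> 1 / 2 ^ K" if "finite X" for X
  proof -
    have "1 / real q ^ K \<le> 1 / 2 ^ K" using t1.p2 by (intro divide_left_mono power_mono mult_pos_pos) auto
    thus ?thesis unfolding e1_def using t1.sum_cell_sq[OF that] order_trans by blast
  qed
  have e2_le: "(\<Sum>x\<in>X. (e2 x)\<^sup>2) \<le> 1 / 2 ^ K" if "finite X" for X
  proof -
    have "1 / real r ^ K \<le> 1 / 2 ^ K" using t2.p2 by (intro divide_left_mono power_mono mult_pos_pos) auto
    thus ?thesis unfolding e2_def using t2.sum_cell_sq[OF that] order_trans by blast
  qed
  have e2_le1: "(\<Sum>x\<in>X. (e2 x)\<^sup>2) \<le> 1" if "finite X" for X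
    using e2_le[OF that] by (rule order_trans) simp
  have Gl: "G \<in> ell2 V" by (rule fspan_ell2[OF _ GB]) (use tetra_basis_orthonormal in \<open>auto simp: orthonormal_system_def\<close>)
  have dl: "(\<lambda>y. (if y = v then 1 else 0) - G y) \<in> ell2 V"
    by (rule ell2_diff(1)[OF ell2_finite_support(1)[of "{v}"] Gl]) (use v in auto)
  have "ell2_norm V (\<lambda>y. (if y = v then 1 else 0) - G y) \<le> 3 * sqrt (1 / 2 ^ K)"
  proof (rule ell2_boundI(2)[OF ell2_zero[OF dl]])
    fix Y :: "('a \<times> 'b) set" assume Y: "finite Y" "Y \<subseteq> V"
    let ?u = "\<lambda>y. \<bar>e1 (fst y) * d2 (snd y)\<bar>" and ?v = "\<lambda>y. \<bar>d1 (fst y) * e2 (snd y)\<bar>" and ?w = "\<lambda>y. \<bar>e1 (fst y) * e2 (snd y)\<bar>"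
    have "L2_set (\<lambda>y. cmod ((if y = v then 1 else 0) - G y)) Y \<le> L2_set (\<lambda>y. ?u y + (?v y + ?w y)) Y"
      unfolding err norm_of_real by (intro L2_set_mono) auto
    also have "\<dots> \<le> L2_set ?u Y + L2_set (\<lambda>y. ?v y + ?w y) Y" by (rule L2_set_triangle_ineq)
    also have "L2_set (\<lambda>y. ?v y + ?w y) Y \<le> L2_set ?v Y + L2_set ?w Y" by (rule L2_set_triangle_ineq)
    also have "L2_set ?u Y \<le> sqrt (1 / 2 ^ K * 1)" by (rule product_L2_bound[OF Y(1) e1_le d_le(2)]) auto
    also have "L2_set ?v Y \<le> sqrt (1 * (1 / 2 ^ K))" by (rule product_L2_bound[OF Y(1) d_le(1) e2_le]) auto
    also have "L2_set ?w Y \<le> sqrt (1 / 2 ^ K * 1)" by (rule product_L2_bound[OF Y(1) e1_le e2_le1]) auto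
    finally show "L2_set (\<lambda>y. cmod ((if y = v then 1 else 0) - G y)) Y \<le> 3 * sqrt (1 / 2 ^ K)" by simp
  qed
  thus ?thesis using that[OF GB] by blast
qed

lemma tetra_basis_complete: "complete_orthonormal_system V (tetra_basis q r T1 T2)"
proof (rule complete_if_deltas_approximable[OF tetra_basis_orthonormal])
  fix v and \<epsilon> :: real assume v: "v \<in> V" and e: "\<epsilon> > 0"
  have "(\<lambda>K. 3 * sqrt (1 / 2 ^ K)) \<longlonglongrightarrow> 3 * sqrt 0"
    by (intro tendsto_intros) (simp add: LIMSEQ_divide_realpow_zero)
  hence "\<forall>\<^sub>F K in sequentially. 3 * sqrt (1 / 2 ^ K) < \<epsilon>" using e by (intro order_tendstoD(2)) auto
  then obtain K where "3 * sqrt (1 / 2 ^ K) < \<epsilon>" by (auto simp: eventually_sequentially)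
  moreover obtain g where "g \<in> fspan (tetra_basis q r T1 T2)"
    "ell2_norm V (\<lambda>x. (if x = v then 1 else 0) - g x) \<le> 3 * sqrt (1 / 2 ^ K)"
    using delta_approximation[OF v] by blast
  ultimately show "\<exists>g\<in>fspan (tetra_basis q r T1 T2). ell2_norm V (\<lambda>x. (if x = v then 1 else 0) - g x) < \<epsilon>"
    by (intro bexI[of _ g]) auto
qed

section \<open>Spectrum and eigenvalues of the random walk\<close>

lemma P_symmetric:
  assumes "f \<in> ell2 V" "b \<in> ell2 V" "finite {x. b x \<noteq> 0}"
  shows "ell2_inner V (P f) b = ell2_inner V f (P b)"
proof -
  define X where "X = {x. b x \<noteq> 0}"
  define Y where "Y = (\<Union>x\<in>X. {y. DL_adj T1 T2 x y})"
  have sym: "DL_adj T1 T2 x y \<longleftrightarrow> DL_adj T1 T2 y x" for x y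
    using t1.adj_sym t2.adj_sym by (auto simp: DL_adj_def)
  have X: "finite X" "X \<subseteq> V" using assms ell2_zero[OF assms(2)] by (auto simp: X_def)
  have Y: "finite Y" "Y \<subseteq> V" using X finite_neighbours by (auto simp: Y_def DL_adj_def)
  let ?c = "1 / complex_of_nat (q + r)"
  have supp: "P b y = ?c * (\<Sum>x\<in>X. if DL_adj T1 T2 x y then b x else 0)" for y
  proof -
    have "(\<Sum>x | DL_adj T1 T2 y x. b x) = (\<Sum>x\<in>X. if DL_adj T1 T2 x y then b x else 0)"
      using X(1) finite_neighbours[of y] unfolding sym[of _ y] by (intro sum.mono_neutral_cong) (auto simp: X_def)
    thus ?thesis by (simp add: srw_op_def)
  qed
  have P0: "P b y = 0" if "y \<notin> Y" for y
  proof -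
    have "(\<Sum>x\<in>X. if DL_adj T1 T2 x y then b x else 0) = 0"
      using that by (intro sum.neutral) (auto simp: Y_def)
    thus ?thesis unfolding supp by simp
  qed
  have "ell2_inner V (P f) b = (\<Sum>x\<in>X. P f x * cnj (b x))"
    by (rule ell2_inner_finite_support[OF X]) (simp add: X_def)
  also have "\<dots> = (\<Sum>x\<in>X. \<Sum>y\<in>Y. if DL_adj T1 T2 x y then ?c * (f y * cnj (b x)) else 0)"
  proof (intro sum.cong refl)
    fix x assume x: "x \<in> X"
    have "(\<Sum>y | DL_adj T1 T2 x y. f y) = (\<Sum>y\<in>Y. if DL_adj T1 T2 x y then f y else 0)"
      using x Y(1) by (intro sum.mono_neutral_cong_left) (auto simp: Y_def)
    thus "P f x * cnj (b x) = (\<Sum>y\<in>Y. if DL_adj T1 T2 x y then ?c * (f y * cnj (b x)) else 0)"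
      by (simp add: srw_op_def sum_distrib_left sum_distrib_right sum_divide_distrib if_distrib if_distribR cong: if_cong)
  qed
  also have "\<dots> = (\<Sum>y\<in>Y. \<Sum>x\<in>X. if DL_adj T1 T2 x y then ?c * (f y * cnj (b x)) else 0)" by (rule sum.swap)
  also have "\<dots> = (\<Sum>y\<in>Y. f y * cnj (P b y))"
    unfolding supp by (intro sum.cong refl) (auto simp: sum_distrib_left intro!: sum.cong)
  also have "\<dots> = ell2_inner V f (P b)"
    by (rule ell2_inner_finite_support[OF Y P0, symmetric])
  finally show ?thesis .
qed

lemma P_local: "local_op P"
  unfolding local_op_def srw_op_def
  by (rule exI[of _ "\<lambda>x. {y. DL_adj T1 T2 x y}"], rule exI[of _ "\<lambda>x y. 1 / of_nat (q + r)"])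
     (simp add: finite_neighbours sum_distrib_left)

lemma rho_nonneg: "rho q r \<ge> 0"
  by (simp add: rho_def)

text \<open>The parameters \<open>m\<close> and \<open>n\<close> are not visible in a basis function as an element of a set, so the
  eigenvalue is recovered from the action of the walk.\<close>

definition eigval :: "('a \<times> 'b \<Rightarrow> complex) \<Rightarrow> complex" where
  "eigval b = (SOME z. P b = (\<lambda>x. z * b x))"

lemma eigval_tetra_fn:
  assumes "n \<ge> 2" "tetra_height T1 T2 a1 a2 n" "m \<in> {1..n-1}" "i \<in> {1..q-1}" "j \<in> {1..r-1}"
  shows "eigval (tetra_fn q r T1 T2 a1 a2 n i j m) = complex_of_real (dl_eigenvalue q r m n)"
proof -
  let ?g = "tetra_fn q r T1 T2 a1 a2 n i j m"
  have 1: "P ?g = (\<lambda>x. complex_of_real (dl_eigenvalue q r m n) * ?g x)"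
    using assms by (intro tetra_fn_eigen)
  have 2: "P ?g = (\<lambda>x. eigval ?g * ?g x)" 
    unfolding eigval_def using someI[of "\<lambda>z. P ?g = (\<lambda>x. z * ?g x)", OF 1] .
  have "ell2_inner V ?g ?g = 1"
    using tetra_fn_orthonormal[OF assms(2,2,4,4,5,5,3,3)] by simp
  hence "?g \<noteq> (\<lambda>x. 0)" by (auto simp: ell2_inner_def)
  then obtain x where "?g x \<noteq> 0" by blast
  thus ?thesis using fun_cong[OF 1, of x] fun_cong[OF 2, of x] by simp
qed

lemma tetrahedra_exist: "tetra_height T1 T2 (troot T1) ((t2.parent ^^ n) (troot T2)) n"
  using t1.busemann_eqI[of 0 "troot T1" 0] t2.busemann_eqI[of 0 "troot T2" 0]
  by (simp add: tetra_height_def t2.busemann_funpow)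

lemma eigval_image:
  "eigval ` tetra_basis q r T1 T2 = {complex_of_real (dl_eigenvalue q r m n) | m n. n \<ge> 2 \<and> 1 \<le> m \<and> m \<le> n - 1}"
proof (intro equalityI subsetI)
  fix z assume "z \<in> eigval ` tetra_basis q r T1 T2"
  then obtain g where g: "g \<in> tetra_basis q r T1 T2" "z = eigval g" by auto
  from g(1) show "z \<in> {complex_of_real (dl_eigenvalue q r m n) | m n. n \<ge> 2 \<and> 1 \<le> m \<and> m \<le> n - 1}"
  proof (rule tetra_basis_cases)
    fix a1 a2 n i j m assume *: "g = tetra_fn q r T1 T2 a1 a2 n i j m" "n \<ge> 2" "tetra_height T1 T2 a1 a2 n"
      "m \<in> {1..n-1}" "i \<in> {1..q-1}" "j \<in> {1..r-1}"
    have "z = complex_of_real (dl_eigenvalue q r m n)" unfolding g(2) *(1) by (rule eigval_tetra_fn) (use * in auto)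
    thus ?thesis using * by auto
  qed
next
  fix z assume "z \<in> {complex_of_real (dl_eigenvalue q r m n) | m n. n \<ge> 2 \<and> 1 \<le> m \<and> m \<le> n - 1}"
  then obtain m n where mn: "z = complex_of_real (dl_eigenvalue q r m n)" "n \<ge> 2" "1 \<le> m" "m \<le> n - 1" by blast
  let ?g = "tetra_fn q r T1 T2 (troot T1) ((t2.parent ^^ n) (troot T2)) n 1 1 m"
  have ij: "m \<in> {1..n-1}" "1 \<in> {1..q-1}" "1 \<in> {1..r-1}" using mn t1.p2 t2.p2 by auto
  have "?g \<in> tetra_basis q r T1 T2"
    unfolding tetra_basis_def using mn(2) tetrahedra_exist ij by blast
  moreover have "eigval ?g = z" unfolding mn(1) by (rule eigval_tetra_fn[OF mn(2) tetrahedra_exist ij])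
  ultimately show "z \<in> eigval ` tetra_basis q r T1 T2" by blast
qed

lemma dl_eigenvalue_bounds: "dl_eigenvalue q r m n \<in> {-rho q r..rho q r}"
proof -
  have "\<bar>rho q r * cos (real m / real n * pi)\<bar> \<le> rho q r * 1"
    unfolding abs_mult using rho_nonneg by (intro mult_mono) auto
  thus ?thesis by (auto simp: dl_eigenvalue_def)
qed

sublocale eigenbasis V "tetra_basis q r T1 T2" P eigval
proof
  show "finite {x. b x \<noteq> 0}" if "b \<in> tetra_basis q r T1 T2" for b
    using that by (rule tetra_basis_cases) (simp add: finite_tetra_fn_support)
  show "P f x = 0" if "x \<notin> V" for f x using that by (simp add: srw_op_def DL_adj_def)
  show "P b = (\<lambda>x. eigval b * b x)" if "b \<in> tetra_basis q r T1 T2" for b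
    using that by (rule tetra_basis_cases) (simp add: tetra_fn_eigen eigval_tetra_fn)
qed (rule tetra_basis_complete P_local)+

lemma eigenvalue_set:
  "op_eigenvalues V P = {complex_of_real (dl_eigenvalue q r m n) | m n. n \<ge> 2 \<and> 1 \<le> m \<and> m \<le> n - 1}"
proof -
  have "cnj (eigval b) = eigval b" if "b \<in> tetra_basis q r T1 T2" for b
  proof -
    have "eigval b \<in> eigval ` tetra_basis q r T1 T2" using that by blast
    thus ?thesis unfolding eigval_image by auto
  qed
  thus ?thesis unfolding eigval_image[symmetric]
    by (intro eigenvalues) (auto intro: P_symmetric B_ell2 finite_support)
qed

lemma closure_eigenvalues: "closure (op_eigenvalues V P) = complex_of_real ` {-rho q r..rho q r}"
  unfolding eigenvalue_set dl_eigenvalue_def by (rule cos_rationals_dense[OF rho_nonneg])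

lemma spectrum: "op_spectrum V P = complex_of_real ` {-rho q r..rho q r}"
proof (intro equalityI subsetI)
  fix z assume z: "z \<in> complex_of_real ` {-rho q r..rho q r}"
  show "z \<in> op_spectrum V P"
    by (rule closure_in_spectrum) (use z closure_eigenvalues eigenvalue_set eigval_image in simp)
next
  fix z assume z: "z \<in> op_spectrum V P"
  show "z \<in> complex_of_real ` {-rho q r..rho q r}"
  proof (rule ccontr)
    assume "z \<notin> complex_of_real ` {-rho q r..rho q r}"
    then obtain w M where wM: "\<And>t. t \<in> {-rho q r..rho q r} \<Longrightarrow> cmod (complex_of_real t - w) \<le> M"
      "0 \<le> M" "M < cmod (z - w)" using separating_disc rho_nonneg by metis
    have "cmod (eigval b - w) \<le> M" if "b \<in> tetra_basis q r T1 T2" for b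
    proof -
      have "eigval b \<in> eigval ` tetra_basis q r T1 T2" using that by blast
      thus ?thesis unfolding eigval_image using wM(1) dl_eigenvalue_bounds by auto
    qed
    from not_in_spectrum[OF this wM(2,3)] z show False by blast
  qed
qed

end

theorem theorem3p15:
  fixes q r :: nat and T1 :: "'a labelled_tree" and T2 :: "'b labelled_tree"
  assumes "q \<ge> 2" and "r \<ge> 2"
    and "homogeneous_tree q T1" and "homogeneous_tree r T2"
  shows "op_spectrum (DL T1 T2) (srw_op q r T1 T2) = complex_of_real ` {- rho q r..rho q r}
    \<and> pure_point_spectrum (DL T1 T2) (srw_op q r T1 T2)
    \<and> op_eigenvalues (DL T1 T2) (srw_op q r T1 T2)
        = {complex_of_real (dl_eigenvalue q r m n) | m n. n \<ge> 2 \<and> 1 \<le> m \<and> m \<le> n - 1}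
    \<and> op_spectrum (DL T1 T2) (srw_op q r T1 T2)
        = closure (op_eigenvalues (DL T1 T2) (srw_op q r T1 T2))
    \<and> complete_orthonormal_system (DL T1 T2) (tetra_basis q r T1 T2)
    \<and> (\<forall>g\<in>tetra_basis q r T1 T2. finite {x. g x \<noteq> 0})
    \<and> (\<forall>a1 a2 n i j m. n \<ge> 2 \<and> tetra_height T1 T2 a1 a2 n \<and>
          m \<in> {1..n-1} \<and> i \<in> {1..q-1} \<and> j \<in> {1..r-1} \<longrightarrow>
          srw_op q r T1 T2 (tetra_fn q r T1 T2 a1 a2 n i j m)
            = (\<lambda>x. complex_of_real (dl_eigenvalue q r m n) * tetra_fn q r T1 T2 a1 a2 n i j m x))"
proof -
  interpret diestel_leader T1 q T2 r
    by (intro diestel_leader.intro end_tree.intro) (use assms in auto)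
  have "pure_point_spectrum V P" unfolding pure_point_spectrum_def using complete eigen by blast
  thus ?thesis using spectrum eigenvalue_set closure_eigenvalues complete finite_support tetra_fn_eigen by auto
qed

end
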